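(* Let $m\ge1$. If $f\in\mathcal D(\mathcal P_m)$ and $k\in\mathbb N$, then for $s\in\overline{\mathcal P}_m$ $$(I_-^{k/2}f)(s)=\pi^{-km/2}\int_{\mathfrak M_{k,m}}f(s+\omega'\omega)\,d\omega.$$
   Context: $\mathfrak M_{k,m}$: real $k\times m$ matrices with Lebesgue measure; $\omega'$ transpose; $|a|$ absolute value of the determinant. $\mathcal P_m$: cone of positive definite symmetric $m\times m$ matrices, $\overline{\mathcal P}_m$ its closure, $dr=\prod_{i\le j}dr_{i,j}$. $\mathcal D(\mathcal P_m)$: $C^\infty$ functions with compact support in the open cone $\mathcal P_m$ (extended by zero). $d=(m+1)/2$; $\Gamma_m(\alpha)=\pi^{m(m-1)/4}\prod_{j=0}^{m-1}\Gamma(\alpha-j/2)$. $D_-=(-1)^m\det(\eta_{i,j}\,\partial/\partial r_{i,j})$ with $\eta_{i,i}=1$, $\eta_{i,j}=1/2$ for $i\ne j$. Right-sided Gårding–Gindikin fractional integral of $f\in\mathcal D(\mathcal P_m)$, $\alpha\in\mathbb C$, $s\in\overline{\mathcal P}_m$: $(I_-^\alpha f)(s)=\frac1{\Gamma_m(\alpha)}\int_{\{r:\,r-s\in\mathcal P_m\}}f(r)|r-s|^{\alpha-d}dr$ if $\operatorname{Re}\alpha>d-1$; $(I_-^\alpha f)(s)=(I_-^{\alpha+\ell}D_-^\ell f)(s)$ if $d-1-\ell<\operatorname{Re}\alpha\le d-\ell$, $\ell=1,2,\dots$. *)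

theory Defs
  imports "HOL-Analysis.Analysis"
begin

text \<open>
  The matrix size m is \<open>CARD('m)\<close>. The order on the finite index type \<open>'m\<close> is used only to single out
  the independent entries \<open>r $ i $ j\<close>, \<open>i \<le> j\<close>, of a symmetric matrix.
\<close>

definition pos_def_cone :: "(real^'m^'m) set" where
  "pos_def_cone = {r. transpose r = r \<and> (\<forall>x. x \<noteq> 0 \<longrightarrow> x \<bullet> (r *v x) > 0)}"


subsection \<open>The measure on symmetric matrices\<close>

definition upper_pairs :: "('m::{finite,wellorder} \<times> 'm) set" where
  "upper_pairs = {(i, j). i \<le> j}"

definition sym_matrix :: "('m::{finite,wellorder} \<times> 'm \<Rightarrow> real) \<Rightarrow> real^'m::_^'m::_" where
  "sym_matrix x = (\<chi> i j. x (min i j, max i j))"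

text \<open>The measure \<open>dr\<close>, the product of the \<open>dr\<^sub>i\<^sub>j\<close> over \<open>i \<le> j\<close>, carried by the symmetric matrices. It is not
  the Hausdorff measure induced by the Frobenius norm, which differs by a constant factor.\<close>

definition sym_lborel :: "(real^'m::{finite,wellorder}^'m::_) measure" where
  "sym_lborel = distr (\<Pi>\<^sub>M p\<in>upper_pairs. lborel) borel sym_matrix"

lemma measurable_sym_matrix [measurable]:
  "(sym_matrix :: ('m::{finite,wellorder} \<times> 'm \<Rightarrow> real) \<Rightarrow> _)
    \<in> borel_measurable (\<Pi>\<^sub>M p\<in>upper_pairs. lborel)"
proof -
  have entry: "(\<lambda>x. sym_matrix x $ i $ j) \<in> borel_measurable (\<Pi>\<^sub>M p\<in>upper_pairs. lborel)"
    for i j :: 'm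
  proof -
    have "(min i j, max i j) \<in> upper_pairs"
      by (simp add: upper_pairs_def min_le_iff_disj le_max_iff_disj)
    from measurable_component_singleton[OF this, of "\<lambda>_. lborel :: real measure"]
    show ?thesis
      by (simp add: sym_matrix_def)
  qed
  then show ?thesis
    by (subst borel_measurable_euclidean_space) (auto simp: Basis_vec_def inner_axis)
qed


subsection \<open>Derivatives in the coordinates \<open>r\<^sub>i\<^sub>j\<close>, \<open>i \<le> j\<close>\<close>

text \<open>Since \<open>r\<^sub>i\<^sub>j = r\<^sub>j\<^sub>i\<close> is a single coordinate, varying it moves both off-diagonal entries. All
  derivatives below are therefore taken along symmetric directions, and at a symmetric matrix they
  depend only on the values of the function at symmetric matrices.\<close>

definition sym_unit :: "'m \<Rightarrow> 'm \<Rightarrow> real^'m^'m" where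
  "sym_unit i j = (\<chi> a b. if a = i \<and> b = j \<or> a = j \<and> b = i then 1 else 0)"

definition sym_partial :: "'m \<Rightarrow> 'm \<Rightarrow> (real^'m^'m \<Rightarrow> complex) \<Rightarrow> (real^'m^'m \<Rightarrow> complex)" where
  "sym_partial i j f = (\<lambda>r. vector_derivative (\<lambda>t. f (r + t *\<^sub>R sym_unit i j)) (at 0))"

definition sym_partials :: "('m \<times> 'm) list \<Rightarrow> (real^'m^'m \<Rightarrow> complex) \<Rightarrow> (real^'m^'m \<Rightarrow> complex)" where
  "sym_partials ps f = foldr (\<lambda>(i, j). sym_partial i j) ps f"

text \<open>\<open>C\<^sup>\<infinity>\<close> on the cone, as an open subset of the space of symmetric matrices: the iterated partial
  derivatives of all orders exist and are continuous.\<close>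

definition smooth_on_cone :: "(real^'m^'m \<Rightarrow> complex) \<Rightarrow> bool" where
  "smooth_on_cone f \<longleftrightarrow>
    (\<forall>ps. continuous_on pos_def_cone (sym_partials ps f) \<and>
      (\<forall>i j. \<forall>r\<in>pos_def_cone. (\<lambda>t. sym_partials ps f (r + t *\<^sub>R sym_unit i j)) differentiable at 0))"

text \<open>A function on the cone is extended by zero to all matrices. As \<open>K\<close> lies in the cone, the support
  is a compact subset of the open cone.\<close>

definition test_functions :: "(real^'m^'m \<Rightarrow> complex) set" where
  "test_functions = {f. smooth_on_cone f \<and>
    (\<exists>K. compact K \<and> K \<subseteq> pos_def_cone \<and> (\<forall>r. r \<notin> K \<longrightarrow> f r = 0))}"

definition eta :: "'m \<Rightarrow> 'm \<Rightarrow> real" where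
  "eta i j = (if i = j then 1 else 1 / 2)"

text \<open>The determinant of the matrix of operators \<open>\<eta>\<^sub>i\<^sub>j \<partial>/\<partial>r\<^sub>i\<^sub>j\<close>, by the Leibniz formula. Each product is
  a composition, taken in increasing order of the row index; on smooth functions the operators
  commute and the order is immaterial.\<close>

definition D_minus ::
    "(real^'m::{finite,wellorder}^'m::_ \<Rightarrow> complex) \<Rightarrow> (real^'m::_^'m::_ \<Rightarrow> complex)" where
  "D_minus f = (\<lambda>r. (- 1) ^ CARD('m) *
    (\<Sum>p\<in>{p. p permutes (UNIV :: 'm set)}. of_int (sign p) *
      foldr (\<lambda>i g r. eta i (p i) *\<^sub>R sym_partial i (p i) g r) (sorted_list_of_set UNIV) f r))"


subsection \<open>The fractional integral\<close>

definition Gamma_m :: "nat \<Rightarrow> complex \<Rightarrow> complex" where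
  "Gamma_m m \<alpha> = of_real (pi powr (real m * (real m - 1) / 4)) * (\<Prod>j<m. Gamma (\<alpha> - of_nat j / 2))"

definition dim_d :: "nat \<Rightarrow> real" where
  "dim_d m = (real m + 1) / 2"

text \<open>The absolutely convergent integral, for \<open>Re \<alpha> > d - 1\<close>.\<close>

definition GG_integral ::
    "complex \<Rightarrow> (real^'m::{finite,wellorder}^'m::_ \<Rightarrow> complex) \<Rightarrow> real^'m::_^'m::_ \<Rightarrow> complex" where
  "GG_integral \<alpha> f s = 1 / Gamma_m CARD('m) \<alpha> *
    (LINT r:{r. r - s \<in> pos_def_cone}|sym_lborel.
      f r * of_real \<bar>det (r - s)\<bar> powr (\<alpha> - of_real (dim_d CARD('m))))"

definition I_minus ::
    "complex \<Rightarrow> (real^'m::{finite,wellorder}^'m::_ \<Rightarrow> complex) \<Rightarrow> real^'m::_^'m::_ \<Rightarrow> complex" where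
  "I_minus \<alpha> f s =
    (if Re \<alpha> > dim_d CARD('m) - 1 then GG_integral \<alpha> f s
     else let l = (THE l::nat. l \<ge> 1 \<and> dim_d CARD('m) - 1 - real l < Re \<alpha> \<and>
                       Re \<alpha> \<le> dim_d CARD('m) - real l)
          in GG_integral (\<alpha> + of_nat l) ((D_minus ^^ l) f) s)"

end

theory Submission
  imports Defs "HOL-Library.Poly_Mapping"
begin

text \<open>
  Write \<open>J\<^sub>k f (s) = \<pi>\<^bsup>-km/2\<^esup> \<integral> f (s + \<omega>'\<omega>) d\<omega>\<close>. For \<open>k \<ge> m\<close> the law of \<open>\<omega>'\<omega>\<close> is found by
  induction on the number of columns: rotate the first column \<open>v\<close> onto a multiple of a unit vector;
  then \<open>\<omega>'\<omega>\<close> has the entry \<open>|v|\<^sup>2\<close>, a free row proportional to \<open>|v|\<close>, and a Schur complement which is the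
  Gram matrix of \<open>k - 1\<close> rows and \<open>m - 1\<close> columns.

  For \<open>k < m\<close> it remains to see that \<open>J\<^sub>k\<^sub>+\<^sub>2 D\<^sub>- = J\<^sub>k\<close>, which by Fubini is the case \<open>k = 0\<close>, that is
  \<open>\<integral> (det G f)(s + xx' + yy') dx dy = (-\<pi>)\<^sup>m f(s)\<close> for \<open>G\<^sub>i\<^sub>j = \<eta>\<^sub>i\<^sub>j \<partial>\<^sub>i\<^sub>j\<close>. By the chain rule
  \<open>\<partial>/\<partial>x\<^sub>i\<close> acts as \<open>2 \<Sum>\<^sub>j x\<^sub>j G\<^sub>j\<^sub>i\<close>, so with the cofactors \<open>C\<^sub>a\<^sub>i\<close> of \<open>G\<close> Cramer's rule gives
  \<open>2 x\<^sub>a det G f = \<Sum>\<^sub>i \<partial>/\<partial>x\<^sub>i (C\<^sub>a\<^sub>i f)\<close>. After a rotation \<open>y\<^sub>a = 0\<close> and \<open>(x\<^sub>a, y\<^sub>a)\<close> contributes the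
  measure \<open>2 \<pi> x\<^sub>a dx\<^sub>a\<close> on \<open>x\<^sub>a > 0\<close>, whose factor \<open>2 x\<^sub>a\<close> is exactly the one needed: the terms \<open>i \<noteq> a\<close>
  integrate to zero and the term \<open>i = a\<close> to \<open>-\<pi>\<close> times the integral of the minor \<open>C\<^sub>a\<^sub>a f\<close> at \<open>x\<^sub>a = 0\<close>,
  and one proceeds by induction.
\<close>

text \<open>For k < m the matrix \<open>transpose \<omega> ** \<omega>\<close> is singular, so its
  law has no density with respect to \<open>sym_lborel\<close> and cannot be compared directly with
  the kernel of \<open>GG_integral\<close>; only the continuation through \<open>D_minus\<close>
  reaches it. One power of \<open>D_minus\<close> raises alpha by 1 and hence the number of rows by
  2, which is why rows are added in pairs. The continuation stops at m or m + 1 rows, the first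
  number of the right parity at which the density formula is available. Both inductions run over the
  set of columns, so arrays are functions on \<open>I \<times> S\<close> under a product measure,
  and changes of variables are made one coordinate at a time by Fubini. Laws are identified by
  nonnegative integrals and passed to complex integrands as equal image measures, so integrability
  matters only where Fubini or additivity is applied to complex functions. Cramer's rule needs a
  determinant over a commutative ring, whereas \<open>D_minus\<close> is a sum of compositions of
  operators; since partial derivatives of test functions commute, polynomials can act in their
  place.\<close>

lemma distr_eqI_nn_integral:
  assumes g: "g \<in> M \<rightarrow>\<^sub>M L" and h: "h \<in> N \<rightarrow>\<^sub>M L"
    and eq: "\<And>F. F \<in> borel_measurable L \<Longrightarrow> (\<integral>\<^sup>+x. F (g x) \<partial>M) = (\<integral>\<^sup>+y. F (h y) \<partial>N)"
  shows "distr M L g = distr N L h"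
proof (rule measure_eqI)
  fix X assume "X \<in> sets (distr M L g)"
  then have X: "X \<in> sets L" by simp
  then have iX: "(indicator X :: _ \<Rightarrow> ennreal) \<in> borel_measurable L" by simp
  have "emeasure (distr M L g) X = (\<integral>\<^sup>+x. indicator X (g x) \<partial>M)"
    using nn_integral_distr[OF g, of "indicator X"] X by simp
  also have "\<dots> = (\<integral>\<^sup>+y. indicator X (h y) \<partial>N)" by (rule eq[OF iX])
  also have "\<dots> = emeasure (distr N L h) X"
    using nn_integral_distr[OF h, of "indicator X"] X by simp
  finally show "emeasure (distr M L g) X = emeasure (distr N L h) X" .
qed simp

subsection \<open>Products of Lebesgue measure\<close>

abbreviation LP :: "'i set \<Rightarrow> ('i \<Rightarrow> real) measure" where
  "LP A \<equiv> Pi\<^sub>M A (\<lambda>_. lborel)"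

interpretation LP: product_sigma_finite "\<lambda>_. lborel :: real measure"
  by standard

lemma LP_component:
  assumes "i \<in> A" "f \<in> N \<rightarrow>\<^sub>M LP A"
  shows "(\<lambda>x. f x i) \<in> borel_measurable N"
proof -
  have "(\<lambda>x. f x i) \<in> N \<rightarrow>\<^sub>M lborel"
    using measurable_compose[OF assms(2) measurable_component_singleton[OF assms(1)]] by simp
  then show ?thesis by simp
qed

lemma LP_component': "i \<in> A \<Longrightarrow> (\<lambda>x. x i) \<in> borel_measurable (LP A)"
  using measurable_component_singleton[of i A "\<lambda>_. lborel :: real measure"] by simp

section \<open>Measure-preserving maps of a coordinate space\<close>

definition measure_preserving :: "'i set \<Rightarrow> (('i \<Rightarrow> real) \<Rightarrow> ('i \<Rightarrow> real)) \<Rightarrow> bool" where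
  "measure_preserving A \<phi> \<longleftrightarrow> \<phi> \<in> LP A \<rightarrow>\<^sub>M LP A \<and>
     (\<forall>G\<in>borel_measurable (LP A). (\<integral>\<^sup>+x. G (\<phi> x) \<partial>LP A) = (\<integral>\<^sup>+x. G x \<partial>LP A))"

lemma measure_preserving_id: "measure_preserving A (\<lambda>x. x)"
  by (simp add: measure_preserving_def)

lemma measure_preservingD:
  "measure_preserving A f \<Longrightarrow> G \<in> borel_measurable (LP A) \<Longrightarrow> (\<integral>\<^sup>+x. G (f x) \<partial>LP A) = (\<integral>\<^sup>+x. G x \<partial>LP A)"
  by (simp add: measure_preserving_def)

lemma measure_preserving_comp:
  assumes "measure_preserving A f" "measure_preserving A g"
  shows "measure_preserving A (\<lambda>x. f (g x))"
proof -
  have f: "f \<in> LP A \<rightarrow>\<^sub>M LP A" "g \<in> LP A \<rightarrow>\<^sub>M LP A" using assms by (auto simp: measure_preserving_def)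
  have "(\<integral>\<^sup>+x. G (f (g x)) \<partial>LP A) = (\<integral>\<^sup>+x. G x \<partial>LP A)" if G: "G \<in> borel_measurable (LP A)" for G
    using measure_preservingD[OF assms(2) measurable_compose[OF f(1) G]] measure_preservingD[OF assms(1) G] by simp
  then show ?thesis using f by (auto simp: measure_preserving_def intro: measurable_compose)
qed

text \<open>By Fubini the coordinate \<open>p\<close> may be integrated innermost. As
  \<open>hp\<close> makes \<open>h\<close> independent of it, the map is then a translation of the
  line, possibly with a reflection.\<close>

lemma measure_preserving_update:
  assumes A: "finite A" "p \<in> A" and h[measurable]: "h \<in> borel_measurable (LP A)"
    and hp: "\<And>w y. h (w(p := y)) = h w" and c: "\<bar>c\<bar> = 1"
  shows "measure_preserving A (\<lambda>w. w(p := h w + c * w p))"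
  unfolding measure_preserving_def
proof (intro conjI ballI)
  have [measurable]: "(\<lambda>w. w p) \<in> borel_measurable (LP A)"
    using A(2) by measurable
  show m[measurable]: "(\<lambda>w. w(p := h w + c * w p)) \<in> LP A \<rightarrow>\<^sub>M LP A"
    using A(2) by (intro measurable_fun_upd[where J=A]) auto
  fix G :: "_ \<Rightarrow> ennreal" assume G[measurable]: "G \<in> borel_measurable (LP A)"
  define B where "B = A - {p}"
  have B: "finite B" "p \<notin> B" "A = insert p B" using A by (auto simp: B_def)
  have G': "G \<in> borel_measurable (LP (insert p B))" using G B by simp
  have "(\<integral>\<^sup>+w. G (w(p := h w + c * w p)) \<partial>LP A) =
      (\<integral>\<^sup>+x. \<integral>\<^sup>+y. G ((x(p := y))(p := h (x(p := y)) + c * y)) \<partial>lborel \<partial>LP B)"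
    using measurable_compose[OF m G] unfolding B(3)
    by (subst LP.product_nn_integral_insert[OF B(1,2)]) (simp_all add: B(3))
  also have "\<dots> = (\<integral>\<^sup>+x. \<integral>\<^sup>+y. G (x(p := h x + c * y)) \<partial>lborel \<partial>LP B)"
    by (simp add: hp)
  also have "\<dots> = (\<integral>\<^sup>+x. \<integral>\<^sup>+y. G (x(p := y)) \<partial>lborel \<partial>LP B)"
  proof (rule nn_integral_cong)
    fix x assume "x \<in> space (LP B)"
    then have "(\<lambda>y. x(p := y)) \<in> lborel \<rightarrow>\<^sub>M LP (insert p B)"
      using B by measurable
    then have "(\<lambda>y. G (x(p := y))) \<in> borel_measurable borel"
      using measurable_compose G' by fastforce
    from nn_integral_real_affine[OF this, of c "h x"] c
    show "(\<integral>\<^sup>+y. G (x(p := h x + c * y)) \<partial>lborel) = (\<integral>\<^sup>+y. G (x(p := y)) \<partial>lborel)"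
      by fastforce
  qed
  also have "\<dots> = (\<integral>\<^sup>+w. G w \<partial>LP A)"
    unfolding B(3) by (subst LP.product_nn_integral_insert[OF B(1,2) G']) simp
  finally show "(\<integral>\<^sup>+w. G (w(p := h w + c * w p)) \<partial>LP A) = (\<integral>\<^sup>+w. G w \<partial>LP A)" .
qed

lemma measure_preserving_shear:
  assumes "finite A" "p \<in> A" "q \<in> A" "p \<noteq> q"
  shows "measure_preserving A (\<lambda>w. w(p := t * w q + w p))"
  using measure_preserving_update[of A p "\<lambda>w. t * w q" 1] assms by simp

lemma measure_preserving_neg:
  assumes "finite A" "p \<in> A"
  shows "measure_preserving A (\<lambda>w. w(p := - w p))"
  using measure_preserving_update[of A p "\<lambda>w. 0" "-1"] assms by simp

text \<open>A plane rotation is a product of three shears.\<close>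

lemma measure_preserving_rotation:
  assumes A: "finite A" "p \<in> A" "q \<in> A" "p \<noteq> q" and cs: "c\<^sup>2 + s\<^sup>2 = 1"
  shows "measure_preserving A (\<lambda>w. w(p := c * w p - s * w q, q := s * w p + c * w q))"
\<comment> \<open>The factorisation into shears divides by \<open>s\<close>; for
  \<open>s = 0\<close> the rotation is plus or minus the identity.\<close>
proof (cases "s = 0")
  case True
  then have "c = 1 \<or> c = -1" using cs by (simp add: power2_eq_1_iff)
  then show ?thesis
  proof
    assume "c = 1" then show ?thesis using True measure_preserving_id[of A] by simp
  next
    assume "c = -1"
    then show ?thesis
      using True measure_preserving_comp[OF measure_preserving_neg[OF A(1,3)] measure_preserving_neg[OF A(1,2)]] A(4)
      by simp
  qed
next
  case False
  \<comment> \<open>The tangent of half the angle. The shears are \<open>-t\<close> along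
    \<open>p\<close>, then \<open>s\<close> along \<open>q\<close>, then \<open>-t\<close> along
    \<open>p\<close>; \<open>t2\<close> evaluates the off-diagonal entry of their product.\<close>
  define t where "t = (1 - c) / s"
  have ts: "1 - t * s = c" using False by (simp add: t_def)
  have "t * (1 + c) = s"
    using False cs by (simp add: t_def field_simps power2_eq_square)
  then have "t * (1 + (1 - t * s)) = s" using ts by simp
  then have t2: "- 2 * t + t * t * s = - s" by (simp add: algebra_simps)
  define U where "U = (\<lambda>w::'a \<Rightarrow> real. w(p := - t * w q + w p))"
  define L where "L = (\<lambda>w::'a \<Rightarrow> real. w(q := s * w p + w q))"
  have UL: "measure_preserving A U" "measure_preserving A L"
    using measure_preserving_shear[OF A, of "- t"] measure_preserving_shear[OF A(1,3,2) A(4)[symmetric], of s]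
    unfolding U_def L_def by auto
  have "measure_preserving A (\<lambda>w. U (L (U w)))"
    using measure_preserving_comp[OF UL(1) measure_preserving_comp[OF UL(2,1)]] .
  moreover have "U (L (U w)) = w(p := c * w p - s * w q, q := s * w p + c * w q)" for w
  proof -
    have 1: "s * (- t * w q + w p) + w q = s * w p + c * w q"
      unfolding ts[symmetric] by (simp add: algebra_simps)
    have "- t * (s * (- t * w q + w p) + w q) + (- t * w q + w p) = (1 - t * s) * w p + (- 2 * t + t * t * s) * w q"
      by (simp add: algebra_simps)
    then have 2: "- t * (s * (- t * w q + w p) + w q) + (- t * w q + w p) = c * w p - s * w q"
      unfolding ts t2 by simp
    show ?thesis
    proof
      fix x
      show "U (L (U w)) x = (w(p := c * w p - s * w q, q := s * w p + c * w q)) x"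
        unfolding 1[symmetric] 2[symmetric] U_def L_def fun_upd_apply using A(4) by presburger
    qed
  qed
  ultimately show ?thesis by simp
qed

text \<open>Different columns use disjoint pairs of coordinates, so one plane rotation per column
  can be composed. That all other coordinates stay fixed is what keeps the columns already treated
  intact.\<close>

lemma measure_preserving_rotate_rows:
  assumes "finite T" "finite A" "{p, q} \<times> T \<subseteq> A" "p \<noteq> q" and cs: "c\<^sup>2 + s\<^sup>2 = 1"
  shows "\<exists>\<phi>. measure_preserving A \<phi> \<and>
    (\<forall>w. (\<forall>j\<in>T. \<phi> w (p, j) = c * w (p, j) - s * w (q, j) \<and> \<phi> w (q, j) = s * w (p, j) + c * w (q, j)) \<and>
      (\<forall>x. x \<notin> {p, q} \<times> T \<longrightarrow> \<phi> w x = w x))"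
  using assms(1,3)
proof (induction T rule: finite_induct)
  case empty
  show ?case by (rule exI[of _ "\<lambda>x. x"]) (simp add: measure_preserving_id)
next
  case (insert a T)
  then have "{p, q} \<times> T \<subseteq> A" by auto
  then obtain \<phi> where \<phi>: "measure_preserving A \<phi>"
    "\<And>w j. j \<in> T \<Longrightarrow> \<phi> w (p, j) = c * w (p, j) - s * w (q, j)"
    "\<And>w j. j \<in> T \<Longrightarrow> \<phi> w (q, j) = s * w (p, j) + c * w (q, j)"
    "\<And>w x. x \<notin> {p, q} \<times> T \<Longrightarrow> \<phi> w x = w x"
    using insert.IH by blast
  have pq: "(p, a) \<in> A" "(q, a) \<in> A" "(p, a) \<noteq> (q, a)" using insert.prems assms(4) by auto
  show ?case
  proof (intro exI conjI allI ballI impI)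
    show "measure_preserving A (\<lambda>w. (\<phi> w)((p, a) := c * \<phi> w (p, a) - s * \<phi> w (q, a),
        (q, a) := s * \<phi> w (p, a) + c * \<phi> w (q, a)))"
      by (rule measure_preserving_comp[OF measure_preserving_rotation[OF assms(2) pq cs] \<phi>(1)])
  next
    fix w x assume "x \<notin> {p, q} \<times> insert a T"
    then have "x \<notin> {p, q} \<times> T" "x \<noteq> (p, a)" "x \<noteq> (q, a)" by auto
    then show "((\<phi> w)((p, a) := c * \<phi> w (p, a) - s * \<phi> w (q, a),
        (q, a) := s * \<phi> w (p, a) + c * \<phi> w (q, a))) x = w x"
      using \<phi>(4) by simp
  qed (use insert.hyps(2) assms(4) in \<open>auto simp: \<phi>(2,3) \<phi>(4)\<close>)
qed

text \<open>In matrix terms \<open>\<phi> w = Q w\<close> with \<open>Q\<close> orthogonal and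
  \<open>Q' v\<close> equal to \<open>|v|\<close> times the unit vector at \<open>p\<close>.
  \<open>Q\<close> is a product of Givens rotations, one for each row of \<open>J\<close>; only its
  effect on inner products is recorded.\<close>

lemma measure_preserving_align:
  fixes v :: "'k \<Rightarrow> real"
  assumes "finite J" "p \<notin> J" "finite T" "finite A" "insert p J \<times> T \<subseteq> A"
  shows "\<exists>\<phi>. measure_preserving A \<phi> \<and> (\<forall>w.
    (\<forall>j\<in>T. (\<Sum>i\<in>insert p J. v i * \<phi> w (i, j)) = sqrt (\<Sum>i\<in>insert p J. (v i)\<^sup>2) * w (p, j)) \<and>
    (\<forall>j\<in>T. \<forall>l\<in>T. (\<Sum>i\<in>insert p J. \<phi> w (i, j) * \<phi> w (i, l)) = (\<Sum>i\<in>insert p J. w (i, j) * w (i, l))) \<and>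
    (\<forall>x. x \<notin> insert p J \<times> T \<longrightarrow> \<phi> w x = w x))"
  using assms(1,2,5)
proof (induction J rule: finite_induct)
  case empty
  \<comment> \<open>With a single row the only orthogonal maps are signs; this one turns
    \<open>v p\<close> into its absolute value.\<close>
  define \<epsilon> where "\<epsilon> = (if v p \<ge> 0 then 1 else - 1 :: real)"
  have \<epsilon>: "\<epsilon> * \<epsilon> = 1" "\<bar>\<epsilon>\<bar> = 1" "v p * \<epsilon> = \<bar>v p\<bar>" by (auto simp: \<epsilon>_def)
  have "\<exists>\<phi>. measure_preserving A \<phi> \<and> (\<forall>w. (\<forall>j\<in>T'. \<phi> w (p, j) = \<epsilon> * w (p, j)) \<and> (\<forall>x. x \<notin> {p} \<times> T' \<longrightarrow> \<phi> w x = w x))"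
    if "finite T'" "T' \<subseteq> T" for T'
    using that
  proof (induction T' rule: finite_induct)
    case empty
    show ?case by (rule exI[of _ "\<lambda>x. x"]) (simp add: measure_preserving_id)
  next
    case (insert a T')
    then have "\<exists>\<phi>. measure_preserving A \<phi> \<and> (\<forall>w. (\<forall>j\<in>T'. \<phi> w (p, j) = \<epsilon> * w (p, j)) \<and> (\<forall>x. x \<notin> {p} \<times> T' \<longrightarrow> \<phi> w x = w x))"
      by simp
    then obtain \<phi> where \<phi>: "measure_preserving A \<phi>"
      "\<And>w j. j \<in> T' \<Longrightarrow> \<phi> w (p, j) = \<epsilon> * w (p, j)"
      "\<And>w x. x \<notin> {p} \<times> T' \<Longrightarrow> \<phi> w x = w x" by auto
    have pa: "(p, a) \<in> A" using insert.prems empty.prems by auto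
    have m: "measure_preserving A (\<lambda>w. w((p, a) := \<epsilon> * w (p, a)))"
      using measure_preserving_update[OF assms(4) pa, of "\<lambda>_. 0" \<epsilon>] \<epsilon> by simp
    show ?case
    proof (intro exI conjI allI ballI impI)
      show "measure_preserving A (\<lambda>w. (\<phi> w)((p, a) := \<epsilon> * \<phi> w (p, a)))"
        by (rule measure_preserving_comp[OF m \<phi>(1)])
      next
      fix w x assume "x \<notin> {p} \<times> insert a T'"
      then have "x \<notin> {p} \<times> T'" "x \<noteq> (p, a)" by auto
      then show "((\<phi> w)((p, a) := \<epsilon> * \<phi> w (p, a))) x = w x"
        using \<phi>(3) by simp
    qed (use insert.hyps(2) in \<open>auto simp: \<phi>(2,3)\<close>)
  qed
  from this[OF assms(3) order_refl] obtain \<phi> where \<phi>: "measure_preserving A \<phi>"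
      "\<And>w j. j \<in> T \<Longrightarrow> \<phi> w (p, j) = \<epsilon> * w (p, j)"
      "\<And>w x. x \<notin> {p} \<times> T \<Longrightarrow> \<phi> w x = w x" by auto
  have "v p * (\<epsilon> * x) = \<bar>v p\<bar> * x" for x using \<epsilon>(3) by (metis mult.assoc)
  moreover have "\<epsilon> * x * (\<epsilon> * y) = x * y" for x y using \<epsilon>(1) by (simp add: algebra_simps)
  ultimately show ?case
    by (intro exI[of _ \<phi>]) (simp add: \<phi>)
next
  case (insert b J)
  then have "p \<notin> J" "insert p J \<times> T \<subseteq> A" by auto
  with insert.IH obtain \<phi> where \<phi>: "measure_preserving A \<phi>"
    "\<And>w j. j \<in> T \<Longrightarrow> (\<Sum>i\<in>insert p J. v i * \<phi> w (i, j)) = sqrt (\<Sum>i\<in>insert p J. (v i)\<^sup>2) * w (p, j)"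
    "\<And>w j l. j \<in> T \<Longrightarrow> l \<in> T \<Longrightarrow> (\<Sum>i\<in>insert p J. \<phi> w (i, j) * \<phi> w (i, l)) = (\<Sum>i\<in>insert p J. w (i, j) * w (i, l))"
    "\<And>w x. x \<notin> insert p J \<times> T \<Longrightarrow> \<phi> w x = w x"
    by blast
  define \<rho> where "\<rho> = sqrt (\<Sum>i\<in>insert p J. (v i)\<^sup>2)"
  define \<rho>' where "\<rho>' = sqrt (\<Sum>i\<in>insert p (insert b J). (v i)\<^sup>2)"
  have eq: "insert p (insert b J) = insert b (insert p J)" by auto
  have b: "b \<notin> insert p J" "finite (insert p J)" using insert by auto
  have s0: "0 \<le> (\<Sum>i\<in>insert p J. (v i)\<^sup>2)" by (intro sum_nonneg) auto
  then have r2: "\<rho>'\<^sup>2 = \<rho>\<^sup>2 + (v b)\<^sup>2"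
    using b by (simp only: \<rho>_def \<rho>'_def eq sum.insert) (simp add: add_nonneg_nonneg)
  have nn: "\<rho> \<ge> 0" "\<rho>' \<ge> 0" using s0 unfolding \<rho>_def \<rho>'_def by (auto intro!: sum_nonneg)
  \<comment> \<open>The rotation taking the vector \<open>(\<rho>, v b)\<close> to
    \<open>(\<rho>', 0)\<close>. If \<open>\<rho>' = 0\<close>, the vector is zero and the identity
    will do.\<close>
  have "\<exists>c s. c\<^sup>2 + s\<^sup>2 = 1 \<and> \<rho> * c + v b * s = \<rho>' \<and> v b * c - \<rho> * s = 0"
  proof (cases "\<rho>' = 0")
    case True
    then have "\<rho> = 0 \<and> v b = 0" using r2 by (simp add: sum_power2_eq_zero_iff)
    then show ?thesis using True by (intro exI[of _ 1] exI[of _ 0]) simp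
  next
    case False
    have "\<rho> * (\<rho> / \<rho>') + v b * (v b / \<rho>') = (\<rho>\<^sup>2 + (v b)\<^sup>2) / \<rho>'"
      by (simp add: add_divide_distrib power2_eq_square)
    moreover have "(\<rho> / \<rho>')\<^sup>2 + (v b / \<rho>')\<^sup>2 = (\<rho>\<^sup>2 + (v b)\<^sup>2) / \<rho>'\<^sup>2"
      by (simp add: add_divide_distrib power_divide)
    ultimately show ?thesis using False unfolding r2[symmetric]
      by (intro exI[of _ "\<rho> / \<rho>'"] exI[of _ "v b / \<rho>'"]) (simp add: power2_eq_square)
  qed
  then obtain c s where cs: "c\<^sup>2 + s\<^sup>2 = 1" "\<rho> * c + v b * s = \<rho>'" "v b * c - \<rho> * s = 0" by blast
  have pb: "p \<noteq> b" "{p, b} \<times> T \<subseteq> A" using insert by auto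
  obtain R where R: "measure_preserving A R"
    "\<And>w j. j \<in> T \<Longrightarrow> R w (p, j) = c * w (p, j) - s * w (b, j)"
    "\<And>w j. j \<in> T \<Longrightarrow> R w (b, j) = s * w (p, j) + c * w (b, j)"
    "\<And>w x. x \<notin> {p, b} \<times> T \<Longrightarrow> R w x = w x"
    using measure_preserving_rotate_rows[OF assms(3,4) pb(2,1) cs(1)] by blast
  \<comment> \<open>The new rotation mixes rows \<open>p\<close> and \<open>b\<close> first; the
    alignment of \<open>insert p J\<close> then leaves row \<open>b\<close> alone.\<close>
  define \<psi> where "\<psi> = (\<lambda>w. \<phi> (R w))"
  have \<phi>b: "\<phi> w (b, j) = w (b, j)" for w j using \<phi>(4) b by auto
  show ?case
  proof (intro exI[of _ \<psi>] conjI allI ballI impI)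
    show "measure_preserving A \<psi>" unfolding \<psi>_def by (rule measure_preserving_comp[OF \<phi>(1) R(1)])
  next
    fix w j assume j: "j \<in> T"
    have "(\<Sum>i\<in>insert p (insert b J). v i * \<psi> w (i, j)) = v b * R w (b, j) + \<rho> * R w (p, j)"
      unfolding eq \<psi>_def \<rho>_def using \<phi>(2)[OF j] b \<phi>b by simp
    also have "\<dots> = (\<rho> * c + v b * s) * w (p, j) + (v b * c - \<rho> * s) * w (b, j)"
      unfolding R(2,3)[OF j] by (simp add: algebra_simps)
    also have "\<dots> = \<rho>' * w (p, j)" unfolding cs by simp
    finally show "(\<Sum>i\<in>insert p (insert b J). v i * \<psi> w (i, j)) =
        sqrt (\<Sum>i\<in>insert p (insert b J). (v i)\<^sup>2) * w (p, j)" unfolding \<rho>'_def .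
  next
    fix w j l assume j: "j \<in> T" and l: "l \<in> T"
    have J: "(\<Sum>i\<in>J. R w (i, j) * R w (i, l)) = (\<Sum>i\<in>J. w (i, j) * w (i, l))"
      using insert.hyps(2) insert.prems(1) by (intro sum.cong refl arg_cong2[where f="(*)"] R(4)) auto
    have "(\<Sum>i\<in>insert p (insert b J). \<psi> w (i, j) * \<psi> w (i, l)) =
       R w (b, j) * R w (b, l) + (R w (p, j) * R w (p, l) + (\<Sum>i\<in>J. w (i, j) * w (i, l)))"
      unfolding eq \<psi>_def using \<phi>(3)[OF j l] b \<phi>b J insert by simp
    also have "\<dots> = w (b, j) * w (b, l) + (w (p, j) * w (p, l) + (\<Sum>i\<in>J. w (i, j) * w (i, l)))"
    proof -
      have "(s * x + c * y) * (s * x' + c * y') + ((c * x - s * y) * (c * x' - s * y') + z) =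
          (c\<^sup>2 + s\<^sup>2) * (y * y' + x * x') + z" for x y x' y' z
        by (simp add: algebra_simps power2_eq_square)
      then show ?thesis unfolding R(2,3)[OF j] R(2,3)[OF l] cs(1) by simp
    qed
    also have "\<dots> = (\<Sum>i\<in>insert p (insert b J). w (i, j) * w (i, l))"
      unfolding eq using b insert by simp
    finally show "(\<Sum>i\<in>insert p (insert b J). \<psi> w (i, j) * \<psi> w (i, l)) =
      (\<Sum>i\<in>insert p (insert b J). w (i, j) * w (i, l))" .
  next
    fix w x assume "x \<notin> insert p (insert b J) \<times> T"
    then show "\<psi> w x = w x" unfolding \<psi>_def by (subst \<phi>(4), force, subst R(4), auto)
  qed
qed

section \<open>Affine substitution and relabelling of coordinates\<close>

lemma LP_affine:
  fixes c :: real
  assumes "finite A" "c > 0" "G \<in> borel_measurable (LP A)"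
  shows "(\<integral>\<^sup>+x. G x \<partial>LP A) = ennreal (c ^ card A) * (\<integral>\<^sup>+x. G (\<lambda>i\<in>A. c * x i + b i) \<partial>LP A)"
  using assms(1,3)
proof (induction A arbitrary: G rule: finite_induct)
  case empty
  show ?case by (simp add: PiM_empty nn_integral_count_space_finite)
next
  case (insert a A)
  note [measurable] = insert.prems
  have G'[measurable]: "(\<lambda>x. G (\<lambda>i\<in>insert a A. c * x i + b i)) \<in> borel_measurable (LP (insert a A))"
    by measurable
  have "(\<integral>\<^sup>+x. G x \<partial>LP (insert a A)) = (\<integral>\<^sup>+x. \<integral>\<^sup>+y. G (x(a := y)) \<partial>lborel \<partial>LP A)"
    by (rule LP.product_nn_integral_insert[OF insert.hyps insert.prems])
  also have "\<dots> = (\<integral>\<^sup>+x. ennreal c * (\<integral>\<^sup>+y. G (x(a := c * y + b a)) \<partial>lborel) \<partial>LP A)"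
  proof (intro nn_integral_cong)
    fix x assume "x \<in> space (LP A)"
    then have "(\<lambda>y. x(a := y)) \<in> lborel \<rightarrow>\<^sub>M LP (insert a A)"
      using insert.hyps by measurable
    then have "(\<lambda>y. G (x(a := y))) \<in> borel_measurable borel"
      using measurable_compose insert.prems by fastforce
    from nn_integral_real_affine[OF this, of c "b a"] \<open>c > 0\<close>
    show "(\<integral>\<^sup>+y. G (x(a := y)) \<partial>lborel) = ennreal c * (\<integral>\<^sup>+y. G (x(a := c * y + b a)) \<partial>lborel)"
      by (simp add: add.commute)
  qed
  also have "\<dots> = ennreal (c ^ card A) * (\<integral>\<^sup>+x. ennreal c * (\<integral>\<^sup>+y. G ((\<lambda>i\<in>A. c * x i + b i)(a := c * y + b a)) \<partial>lborel) \<partial>LP A)"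
    by (rule insert.IH) measurable
  also have "\<dots> = ennreal (c ^ card A) * (ennreal c * (\<integral>\<^sup>+x. \<integral>\<^sup>+y. G ((\<lambda>i\<in>A. c * x i + b i)(a := c * y + b a)) \<partial>lborel \<partial>LP A))"
    by (subst nn_integral_cmult) measurable
  also have "(\<integral>\<^sup>+x. \<integral>\<^sup>+y. G ((\<lambda>i\<in>A. c * x i + b i)(a := c * y + b a)) \<partial>lborel \<partial>LP A)
     = (\<integral>\<^sup>+x. \<integral>\<^sup>+y. G (\<lambda>i\<in>insert a A. c * (x(a := y)) i + b i) \<partial>lborel \<partial>LP A)"
    using insert.hyps(2) by (intro nn_integral_cong arg_cong[where f=G]) (auto simp: fun_eq_iff)
  also have "\<dots> = (\<integral>\<^sup>+x. G (\<lambda>i\<in>insert a A. c * x i + b i) \<partial>LP (insert a A))"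
    by (rule LP.product_nn_integral_insert[OF insert.hyps G', symmetric])
  finally have "(\<integral>\<^sup>+x. G x \<partial>LP (insert a A)) =
      ennreal (c ^ card A) * (ennreal c * (\<integral>\<^sup>+x. G (\<lambda>i\<in>insert a A. c * x i + b i) \<partial>LP (insert a A)))" .
  moreover have "ennreal (c ^ card (insert a A)) = ennreal (c ^ card A) * ennreal c"
    using insert.hyps \<open>c > 0\<close> by (simp add: ennreal_mult mult.commute)
  ultimately show ?case by (simp only: mult.assoc)
qed

lemma LP_reindex:
  assumes "finite A" "inj_on f A" "G \<in> borel_measurable (LP A)"
  shows "(\<integral>\<^sup>+x. G x \<partial>LP A) = (\<integral>\<^sup>+x. G (\<lambda>i\<in>A. x (f i)) \<partial>LP (f ` A))"
  using assms
proof (induction A arbitrary: G rule: finite_induct)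
  case empty
  show ?case by (simp add: PiM_empty nn_integral_count_space_finite)
next
  case (insert a A)
  note [measurable] = insert.prems(2)
  have fa: "f a \<notin> f ` A" "inj_on f A" "finite (f ` A)" using insert by auto
  have G'[measurable]: "(\<lambda>x. G (\<lambda>i\<in>insert a A. x (f i))) \<in> borel_measurable (LP (f ` insert a A))"
  proof -
    have "(\<lambda>x. \<lambda>i\<in>insert a A. x (f i)) \<in> LP (f ` insert a A) \<rightarrow>\<^sub>M LP (insert a A)"
      by (intro measurable_restrict measurable_component_singleton) blast
    from measurable_compose[OF this insert.prems(2)] show ?thesis .
  qed
  have M: "(\<lambda>x. \<integral>\<^sup>+y. G (x(a := y)) \<partial>lborel) \<in> borel_measurable (LP A)"
    by measurable
  have "(\<integral>\<^sup>+x. G x \<partial>LP (insert a A)) = (\<integral>\<^sup>+x. \<integral>\<^sup>+y. G (x(a := y)) \<partial>lborel \<partial>LP A)"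
    by (rule LP.product_nn_integral_insert[OF insert.hyps insert.prems(2)])
  also have "\<dots> = (\<integral>\<^sup>+x. \<integral>\<^sup>+y. G ((\<lambda>i\<in>A. x (f i))(a := y)) \<partial>lborel \<partial>LP (f ` A))"
    by (rule insert.IH[OF fa(2) M])
  also have "\<dots> = (\<integral>\<^sup>+x. \<integral>\<^sup>+y. G (\<lambda>i\<in>insert a A. (x(f a := y)) (f i)) \<partial>lborel \<partial>LP (f ` A))"
  proof -
    have "(\<lambda>i\<in>A. x (f i))(a := y) = (\<lambda>i\<in>insert a A. (x(f a := y)) (f i))" for x and y :: real
      using fa(1) insert.hyps(2) by (fastforce simp: fun_eq_iff image_iff)
    then show ?thesis by (simp only:)
  qed
  also have "\<dots> = (\<integral>\<^sup>+x. G (\<lambda>i\<in>insert a A. x (f i)) \<partial>LP (f ` insert a A))"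
    unfolding image_insert
    by (rule LP.product_nn_integral_insert[OF fa(3,1) G'[unfolded image_insert], symmetric])
  finally show ?case .
qed

subsection \<open>Gram matrices and radial integration\<close>

text \<open>Row and column sets are parameters, so that both can shrink in an induction within one
  matrix type. Outside \<open>S\<close> the entries are zero, not padded by ones, so that
  \<open>s + gram I S w\<close> is meaningful for proper subsets \<open>S\<close>.\<close>

definition gram :: "'k set \<Rightarrow> 'm set \<Rightarrow> ('k \<times> 'm \<Rightarrow> real) \<Rightarrow> real^'m::finite^'m" where
  "gram I S w = (\<chi> j l. if j \<in> S \<and> l \<in> S then \<Sum>i\<in>I. w (i, j) * w (i, l) else 0)"

lemma measurable_matrix [measurable (raw)]:
  fixes f :: "'a \<Rightarrow> 'm::finite \<Rightarrow> 'n::finite \<Rightarrow> real"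
  assumes "\<And>i j. (\<lambda>x. f x i j) \<in> borel_measurable M"
  shows "(\<lambda>x. \<chi> i j. f x i j) \<in> borel_measurable M"
  using assms by (subst borel_measurable_euclidean_space) (auto simp: Basis_vec_def inner_axis)

lemma measurable_gram:
  assumes "finite I" "I \<times> S \<subseteq> A"
  shows "gram I S \<in> borel_measurable (LP A)"
  unfolding gram_def using assms
proof (intro measurable_matrix)
  fix j l
  show "(\<lambda>w. if j \<in> S \<and> l \<in> S then \<Sum>i\<in>I. w (i, j) * w (i, l) else 0) \<in> borel_measurable (LP A)"
  proof (cases "j \<in> S \<and> l \<in> S")
    case True
    have "(\<lambda>w. \<Sum>i\<in>I. w (i, j) * w (i, l)) \<in> borel_measurable (LP A)"
      using True assms by (intro borel_measurable_sum borel_measurable_times LP_component') blast+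
    then show ?thesis using True by simp
  qed (simp only: if_False borel_measurable_const)
qed

text \<open>The normal form of an array after rotation: column \<open>a\<close> has only its entry
  in row \<open>p\<close> left.\<close>

definition ext_col :: "'m \<Rightarrow> 'k \<Rightarrow> real \<Rightarrow> ('k \<times> 'm \<Rightarrow> real) \<Rightarrow> ('k \<times> 'm \<Rightarrow> real)" where
  "ext_col a p \<rho> w = (\<lambda>(i, j). if j = a then (if i = p then \<rho> else 0) else w (i, j))"

lemma gram_ext_col:
  assumes "finite I" "p \<in> I" "a \<notin> T"
  shows "gram I (insert a T) (ext_col a p \<rho> w) = (\<chi> j l.
    if j = a \<and> l = a then \<rho>\<^sup>2 else if j = a \<and> l \<in> T then \<rho> * w (p, l)
    else if l = a \<and> j \<in> T then \<rho> * w (p, j)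
    else if j \<in> T \<and> l \<in> T then \<Sum>i\<in>I. w (i, j) * w (i, l) else 0)"
proof -
  have d: "(\<Sum>i\<in>I. (if i = p then \<rho> else 0) * h i) = \<rho> * h p"
    "(\<Sum>i\<in>I. h i * (if i = p then \<rho> else 0)) = \<rho> * h p" for h
  proof -
    have "(if i = p then \<rho> else 0) * h i = (if i = p then \<rho> * h p else 0)"
      "h i * (if i = p then \<rho> else 0) = (if i = p then \<rho> * h p else 0)" for i
      by auto
    then show "(\<Sum>i\<in>I. (if i = p then \<rho> else 0) * h i) = \<rho> * h p"
      "(\<Sum>i\<in>I. h i * (if i = p then \<rho> else 0)) = \<rho> * h p"
      using assms(1,2) by (simp_all only: sum.delta if_True)
  qed
  have c: "ext_col a p \<rho> w (i, a) = (if i = p then \<rho> else 0)" for i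
    by (simp add: ext_col_def)
  have c': "ext_col a p \<rho> w (i, j) = w (i, j)" if "j \<in> T" for i j
    using that assms(3) by (auto simp: ext_col_def)
  have "gram I (insert a T) (ext_col a p \<rho> w) $ j $ l =
    (if j = a \<and> l = a then \<rho>\<^sup>2 else if j = a \<and> l \<in> T then \<rho> * w (p, l)
    else if l = a \<and> j \<in> T then \<rho> * w (p, j)
    else if j \<in> T \<and> l \<in> T then \<Sum>i\<in>I. w (i, j) * w (i, l) else 0)" for j l
    unfolding gram_def using assms(3)
    by (cases "j = a"; cases "l = a"; cases "j \<in> T"; cases "l \<in> T") (simp_all add: c c' d power2_eq_square)
  then show ?thesis by (simp add: vec_eq_iff)
qed

lemma measurable_gram_ext_col:
  assumes I: "finite I" "p \<in> I" "a \<notin> T" and B: "I \<times> T \<subseteq> B"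
    and r: "r \<in> borel_measurable M" and g: "g \<in> M \<rightarrow>\<^sub>M LP B"
  shows "(\<lambda>x. gram I (insert a T) (ext_col a p (r x) (g x))) \<in> borel_measurable M"
proof -
  have [measurable]: "(\<lambda>x. g x (i, j)) \<in> borel_measurable M" if "i \<in> I" "j \<in> T" for i j
    using that B by (intro LP_component[OF _ g]) auto
  note [measurable] = r
  show ?thesis
    unfolding gram_ext_col[OF I]
  proof (rule measurable_matrix)
    fix j l
    show "(\<lambda>x. if j = a \<and> l = a then (r x)\<^sup>2 else if j = a \<and> l \<in> T then r x * g x (p, l)
      else if l = a \<and> j \<in> T then r x * g x (p, j)
      else if j \<in> T \<and> l \<in> T then \<Sum>i\<in>I. g x (i, j) * g x (i, l) else 0) \<in> borel_measurable M"
      using I by (cases "j \<in> T"; cases "l \<in> T"; cases "j = a"; cases "l = a"; simp) measurable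
  qed
qed

text \<open>For a fixed column \<open>v\<close> the remaining columns are rotated so that \<open>v\<close> becomes \<open>|v|\<close> times a unit vector.\<close>

lemma nn_integral_gram_insert:
  fixes F :: "real^'m::finite^'m \<Rightarrow> ennreal"
  assumes I: "finite I" "p \<in> I" and a: "a \<notin> T" and F[measurable]: "F \<in> borel_measurable borel"
  shows "(\<integral>\<^sup>+w. F (gram I (insert a T) w) \<partial>LP (I \<times> insert a T)) =
    (\<integral>\<^sup>+v. \<integral>\<^sup>+w. F (gram I (insert a T) (ext_col a p (sqrt (\<Sum>x\<in>I \<times> {a}. (v x)\<^sup>2)) w)) \<partial>LP (I \<times> T) \<partial>LP (I \<times> {a}))"
proof -
  have T: "finite T" by simp
  define J where "J = I - {p}"
  have J: "finite J" "p \<notin> J" "I = insert p J" using I by (auto simp: J_def)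
  have un: "I \<times> insert a T = (I \<times> {a}) \<union> (I \<times> T)" "(I \<times> {a}) \<inter> (I \<times> T) = {}" using a by auto
  have fin: "finite (I \<times> {a})" "finite (I \<times> T)" using I by auto
  have mg: "(\<lambda>w. F (gram I (insert a T) w)) \<in> borel_measurable (LP (I \<times> insert a T))"
    using I by (intro measurable_compose[OF measurable_gram F]) auto
  have "(\<integral>\<^sup>+w. F (gram I (insert a T) w) \<partial>LP (I \<times> insert a T)) =
    (\<integral>\<^sup>+v. \<integral>\<^sup>+w. F (gram I (insert a T) (merge (I \<times> {a}) (I \<times> T) (v, w))) \<partial>LP (I \<times> T) \<partial>LP (I \<times> {a}))"
    using mg unfolding un(1) by (intro LP.product_nn_integral_fold[OF un(2) fin])
  also have "\<dots> = (\<integral>\<^sup>+v. \<integral>\<^sup>+w. F (gram I (insert a T) (ext_col a p (sqrt (\<Sum>x\<in>I \<times> {a}. (v x)\<^sup>2)) w)) \<partial>LP (I \<times> T) \<partial>LP (I \<times> {a}))"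
  proof (rule nn_integral_cong)
    fix v assume v: "v \<in> space (LP (I \<times> {a}))"
    \<comment> \<open>\<open>\<phi>\<close> depends on \<open>v\<close>, but it is used only in the
      inner integral at fixed \<open>v\<close>, so no measurability of this choice in
      \<open>v\<close> is involved.\<close>
    obtain \<phi> where \<phi>: "measure_preserving (I \<times> T) \<phi>"
      "\<And>w j. j \<in> T \<Longrightarrow> (\<Sum>i\<in>I. v (i, a) * \<phi> w (i, j)) = sqrt (\<Sum>i\<in>I. (v (i, a))\<^sup>2) * w (p, j)"
      "\<And>w j l. j \<in> T \<Longrightarrow> l \<in> T \<Longrightarrow> (\<Sum>i\<in>I. \<phi> w (i, j) * \<phi> w (i, l)) = (\<Sum>i\<in>I. w (i, j) * w (i, l))"
      using measure_preserving_align[OF J(1,2) T fin(2), of "\<lambda>i. v (i, a)", folded J(3), OF order_refl] by blast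
    let ?H = "\<lambda>w. F (gram I (insert a T) (merge (I \<times> {a}) (I \<times> T) (v, w)))"
    have mm: "(\<lambda>w. merge (I \<times> {a}) (I \<times> T) (v, w)) \<in> LP (I \<times> T) \<rightarrow>\<^sub>M LP (I \<times> insert a T)"
      unfolding un(1) using v by measurable
    have H: "?H \<in> borel_measurable (LP (I \<times> T))"
      using measurable_compose[OF mm mg] .
    have s: "(\<Sum>x\<in>I \<times> {a}. (v x)\<^sup>2) = (\<Sum>i\<in>I. (v (i, a))\<^sup>2)"
      by (simp add: sum.cartesian_product' )
    have nn: "0 \<le> (\<Sum>i\<in>I. (v (i, a))\<^sup>2)" by (intro sum_nonneg) auto
    have eq: "gram I (insert a T) (merge (I \<times> {a}) (I \<times> T) (v, \<phi> w)) =
       gram I (insert a T) (ext_col a p (sqrt (\<Sum>x\<in>I \<times> {a}. (v x)\<^sup>2)) w)" for w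
    proof -
      let ?m = "merge (I \<times> {a}) (I \<times> T) (v, \<phi> w)"
      have m1: "?m (i, a) = v (i, a)" if "i \<in> I" for i using that by (simp add: merge_def)
      have m2: "?m (i, j) = \<phi> w (i, j)" if "i \<in> I" "j \<in> T" for i j using that a by (auto simp: merge_def)
      have e1: "(\<Sum>i\<in>I. ?m (i, a) * ?m (i, a)) = (sqrt (\<Sum>i\<in>I. (v (i, a))\<^sup>2))\<^sup>2"
        using nn by (simp add: m1 power2_eq_square cong: sum.cong)
      have e2: "(\<Sum>i\<in>I. ?m (i, a) * ?m (i, j)) = sqrt (\<Sum>i\<in>I. (v (i, a))\<^sup>2) * w (p, j)" if "j \<in> T" for j
        using \<phi>(2)[OF that, of w] that by (simp add: m1 m2 cong: sum.cong)
      have e2': "(\<Sum>i\<in>I. ?m (i, j) * ?m (i, a)) = sqrt (\<Sum>i\<in>I. (v (i, a))\<^sup>2) * w (p, j)" if "j \<in> T" for j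
        using e2[OF that] by (simp add: mult.commute)
      have e3: "(\<Sum>i\<in>I. ?m (i, j) * ?m (i, l)) = (\<Sum>i\<in>I. w (i, j) * w (i, l))" if "j \<in> T" "l \<in> T" for j l
        using \<phi>(3)[OF that, of w] that by (simp add: m2 cong: sum.cong)
      show ?thesis
        unfolding gram_ext_col[OF I a] unfolding gram_def vec_eq_iff s using a by (auto simp: e1 e2 e2' e3)
    qed
    show "(\<integral>\<^sup>+w. ?H w \<partial>LP (I \<times> T)) =
      (\<integral>\<^sup>+w. F (gram I (insert a T) (ext_col a p (sqrt (\<Sum>x\<in>I \<times> {a}. (v x)\<^sup>2)) w)) \<partial>LP (I \<times> T))"
      using measure_preservingD[OF \<phi>(1) H] unfolding eq by simp
  qed
  finally show ?thesis .
qed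

text \<open>Half-lines are stable under intersection and generate the Borel sets, so they determine
  the image measure of \<open>X\<close>. \<open>M\<close> may be infinite; \<open>fin\<close>
  supplies the exhaustion by sets of finite measure that uniqueness requires.\<close>

lemma nn_integral_cdf_transfer:
  fixes X :: "'a \<Rightarrow> real" and g :: "real \<Rightarrow> ennreal"
  assumes X[measurable]: "X \<in> borel_measurable M" and g[measurable]: "g \<in> borel_measurable borel"
    and H[measurable]: "H \<in> borel_measurable borel"
    and cdf: "\<And>x. emeasure M {w \<in> space M. X w \<le> x} = (\<integral>\<^sup>+y. g y * indicator {..x} y \<partial>lborel)"
    and fin: "\<And>x. emeasure M {w \<in> space M. X w \<le> x} < \<infinity>"
  shows "(\<integral>\<^sup>+w. H (X w) \<partial>M) = (\<integral>\<^sup>+y. g y * H y \<partial>lborel)"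
proof -
  have em: "emeasure (distr M borel X) {..x} = emeasure M {w \<in> space M. X w \<le> x}" for x
  proof -
    have "X -` {..x} \<inter> space M = {w \<in> space M. X w \<le> x}" by fastforce
    then show ?thesis using emeasure_distr[OF X, of "{..x}"] by simp
  qed
  have bs: "sets (borel :: real measure) = sigma_sets UNIV (range atMost)"
    by (subst borel_eq_atMost) (rule sets_measure_of, simp)
  have "distr M borel X = density lborel g"
  proof (rule measure_eqI_generator_eq[where E="range atMost" and \<Omega>=UNIV and A="\<lambda>n. {..real n}"])
    show "Int_stable (range (atMost :: real \<Rightarrow> _))"
      by (auto simp: Int_stable_def)
    show "sets (distr M borel X) = sigma_sets UNIV (range atMost)"
      "sets (density lborel g) = sigma_sets UNIV (range atMost)"
      unfolding sets_distr sets_density sets_lborel by (rule bs)+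
    fix A :: "real set" assume "A \<in> range atMost"
    then show "emeasure (distr M borel X) A = emeasure (density lborel g) A"
      by (auto simp: em cdf emeasure_density)
  next
    show "(\<Union>i. {..real i}) = UNIV" using real_arch_simple by auto
    show "range atMost \<subseteq> Pow (UNIV :: real set)" "range (\<lambda>n. {..real n}) \<subseteq> range atMost"
      by blast+
    show "emeasure (distr M borel X) {..real i} \<noteq> \<infinity>" for i using em fin[of "real i"] by simp
  qed
  then have "(\<integral>\<^sup>+y. H y \<partial>distr M borel X) = (\<integral>\<^sup>+y. H y \<partial>density lborel g)" by (rule arg_cong)
  moreover have "(\<integral>\<^sup>+y. H y \<partial>distr M borel X) = (\<integral>\<^sup>+w. H (X w) \<partial>M)"
    by (rule nn_integral_distr[OF X]) (use H in simp)
  moreover have "(\<integral>\<^sup>+y. H y \<partial>density lborel g) = (\<integral>\<^sup>+y. g y * H y \<partial>lborel)"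
    using g H by (intro nn_integral_density) simp_all
  ultimately show ?thesis by metis
qed

lemma measurable_powr_density:
  fixes b c :: real
  shows "(\<lambda>y. ennreal (indicator {0<..} y * (c * y powr b))) \<in> borel_measurable borel"
  by measurable

lemma nn_integral_powr_Iic:
  fixes b :: real
  assumes "b > 0" "c \<ge> 0"
  shows "(\<integral>\<^sup>+y. ennreal (indicator {0<..} y * (c * y powr (b - 1))) * indicator {..x} y \<partial>lborel) =
    ennreal (if x > 0 then c / b * x powr b else 0)"
proof (cases "x > 0")
  case True
  have hi: "((\<lambda>y. c * y powr (b - 1)) has_integral (c * (x powr (b - 1 + 1) / (b - 1 + 1)))) {0..x}"
    using assms True by (intro has_integral_mult_right has_integral_powr_from_0) auto
  have "(\<integral>\<^sup>+y. ennreal (c * y powr (b - 1)) * indicator {0..x} y \<partial>lborel) = ennreal (c * (x powr (b - 1 + 1) / (b - 1 + 1)))"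
    using assms True by (intro nn_integral_has_integral_lebesgue' hi) auto
  \<comment> \<open>The ranges differ only at \<open>y = 0\<close>, where \<open>powr\<close> has
    the value 0.\<close>
  also have "(\<integral>\<^sup>+y. ennreal (c * y powr (b - 1)) * indicator {0..x} y \<partial>lborel) =
    (\<integral>\<^sup>+y. ennreal (indicator {0<..} y * (c * y powr (b - 1))) * indicator {..x} y \<partial>lborel)"
    by (intro nn_integral_cong) (auto simp: indicator_def)
  finally show ?thesis using True by simp
next
  case False
  then have "(\<integral>\<^sup>+y. ennreal (indicator {0<..} y * (c * y powr (b - 1))) * indicator {..x} y \<partial>lborel) = (\<integral>\<^sup>+y. 0 \<partial>(lborel :: real measure))"
    by (intro nn_integral_cong) (auto simp: indicator_def)
  then show ?thesis using False by simp
qed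

text \<open>For positive \<open>r\<close> this is the volume of a ball. Otherwise the set contains
  at most the origin, a null set because \<open>A\<close> is nonempty.\<close>

lemma emeasure_LP_norm_le:
  assumes A: "finite A" "A \<noteq> {}"
  shows "emeasure (LP A) {v \<in> space (LP A). sqrt (\<Sum>x\<in>A. (v x)\<^sup>2) \<le> r} =
    ennreal (if r > 0 then unit_ball_vol (real (card A)) * r ^ card A else 0)"
proof (cases "r > 0")
  case True
  have "{v \<in> space (LP A). sqrt (\<Sum>x\<in>A. (v x)\<^sup>2) \<le> r} = {f. sqrt (\<Sum>i\<in>A. (f i)\<^sup>2) \<le> r} \<inter> space (LP A)" by auto
  then show ?thesis using emeasure_cball_aux[OF A(1) True] True by simp
next
  case False
  from A obtain a where a: "a \<in> A" by auto
  have "{v \<in> space (LP A). sqrt (\<Sum>x\<in>A. (v x)\<^sup>2) \<le> r} \<subseteq> PiE A (\<lambda>_. {0})"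
  proof
    fix v assume v: "v \<in> {v \<in> space (LP A). sqrt (\<Sum>x\<in>A. (v x)\<^sup>2) \<le> r}"
    then have "sqrt (\<Sum>x\<in>A. (v x)\<^sup>2) \<le> r" by blast
    then have "sqrt (\<Sum>x\<in>A. (v x)\<^sup>2) \<le> 0" using False by linarith
    moreover have "(\<Sum>x\<in>A. (v x)\<^sup>2) \<ge> 0" by (intro sum_nonneg) auto
    ultimately have "(\<Sum>x\<in>A. (v x)\<^sup>2) = 0" by simp
    then have "\<forall>x\<in>A. v x = 0" using A by (simp add: sum_nonneg_eq_0_iff)
    then show "v \<in> PiE A (\<lambda>_. {0})" using v by (intro PiE_I) (auto simp: space_PiM PiE_def extensional_def)
  qed
  then have "emeasure (LP A) {v \<in> space (LP A). sqrt (\<Sum>x\<in>A. (v x)\<^sup>2) \<le> r} \<le> emeasure (LP A) (PiE A (\<lambda>_. {0}))"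
    using A by (intro emeasure_mono sets_PiM_I_finite) auto
  also have "\<dots> = 0"
    using A a by (subst LP.emeasure_PiM) auto
  finally have "emeasure (LP A) {v \<in> space (LP A). sqrt (\<Sum>x\<in>A. (v x)\<^sup>2) \<le> r} = 0"
    by simp
  then show ?thesis using False by simp
qed

text \<open>The density is the derivative of the ball volume, that is, the surface area of the
  sphere of radius \<open>r\<close>.\<close>

lemma nn_integral_LP_norm:
  assumes A: "finite A" "A \<noteq> {}" and H: "H \<in> borel_measurable borel"
  shows "(\<integral>\<^sup>+v. H (sqrt (\<Sum>x\<in>A. (v x)\<^sup>2)) \<partial>LP A) = (\<integral>\<^sup>+r. ennreal (indicator {0<..} r *
    (real (card A) * unit_ball_vol (real (card A)) * r powr (real (card A) - 1))) * H r \<partial>lborel)"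
proof (rule nn_integral_cdf_transfer[OF _ _ H])
  have n: "real (card A) > 0" using A by (simp add: card_gt_0_iff)
  show m: "(\<lambda>v. sqrt (\<Sum>x\<in>A. (v x)\<^sup>2)) \<in> borel_measurable (LP A)" by measurable
  show "emeasure (LP A) {w \<in> space (LP A). sqrt (\<Sum>x\<in>A. (w x)\<^sup>2) \<le> r} < \<infinity>" for r
    by (simp add: emeasure_LP_norm_le[OF A])
  show "emeasure (LP A) {w \<in> space (LP A). sqrt (\<Sum>x\<in>A. (w x)\<^sup>2) \<le> r} =
     (\<integral>\<^sup>+y. ennreal (indicator {0<..} y * (real (card A) * unit_ball_vol (real (card A)) * y powr (real (card A) - 1))) * indicator {..r} y \<partial>lborel)" for r
  proof -
    have e: "real (card A) * unit_ball_vol (real (card A)) / real (card A) * r powr real (card A) =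
      unit_ball_vol (real (card A)) * r ^ card A" if "r > 0"
      unfolding powr_realpow[OF that] using n by simp
    have "0 \<le> real (card A) * unit_ball_vol (real (card A))" by (simp add: unit_ball_vol_nonneg)
    from nn_integral_powr_Iic[OF n this, of r] show ?thesis
      unfolding emeasure_LP_norm_le[OF A] by (cases "r > 0") (simp_all only: e if_True if_False)
  qed
qed (rule measurable_powr_density)

text \<open>The distribution function at \<open>r\<close> is the volume of the ball of radius
  \<open>sqrt r\<close>; differentiating it gives the constant, since half the dimension times the
  unit ball volume is \<open>pi powr (n / 2) / Gamma (n / 2)\<close>. Each column of a Gram matrix
  contributes one such factor to \<open>Gamma_m\<close>.\<close>

lemma nn_integral_LP_norm_square:
  assumes A: "finite A" "A \<noteq> {}" and H: "H \<in> borel_measurable borel"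
  shows "(\<integral>\<^sup>+v. H (\<Sum>x\<in>A. (v x)\<^sup>2) \<partial>LP A) = (\<integral>\<^sup>+r. ennreal (indicator {0<..} r *
    (pi powr (real (card A) / 2) / Gamma (real (card A) / 2) * r powr (real (card A) / 2 - 1))) * H r \<partial>lborel)"
proof (rule nn_integral_cdf_transfer[OF _ _ H])
  let ?n = "real (card A)"
  have n: "?n > 0" using A by (simp add: card_gt_0_iff)
  have G: "Gamma (?n / 2) > 0" using n by (intro Gamma_real_pos) simp
  show m: "(\<lambda>v. (\<Sum>x\<in>A. (v x)\<^sup>2)) \<in> borel_measurable (LP A)" by measurable
  have set: "{w \<in> space (LP A). (\<Sum>x\<in>A. (w x)\<^sup>2) \<le> r} = (if r \<ge> 0 then {w \<in> space (LP A). sqrt (\<Sum>x\<in>A. (w x)\<^sup>2) \<le> sqrt r} else {})" for r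
  proof -
    have "(\<Sum>x\<in>A. (w x)\<^sup>2) \<ge> 0" for w :: "'a \<Rightarrow> real" by (intro sum_nonneg) auto
    then have "\<not> (\<Sum>x\<in>A. (w x)\<^sup>2) \<le> r" if "\<not> r \<ge> 0" for w :: "'a \<Rightarrow> real" using that by (meson order_trans)
    then show ?thesis by (cases "r \<ge> 0") (simp_all only: real_sqrt_le_iff if_True if_False, blast)
  qed
  have em: "emeasure (LP A) {w \<in> space (LP A). (\<Sum>x\<in>A. (w x)\<^sup>2) \<le> r} =
      ennreal (if r > 0 then unit_ball_vol ?n * sqrt r ^ card A else 0)" for r
  proof (cases "r \<ge> 0")
    case True
    show ?thesis
      using emeasure_LP_norm_le[OF A, of "sqrt r"] unfolding set real_sqrt_gt_0_iff by (simp only: True if_True)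
  next
    case False
    then show ?thesis unfolding set by simp
  qed
  show "emeasure (LP A) {w \<in> space (LP A). (\<Sum>x\<in>A. (w x)\<^sup>2) \<le> r} < \<infinity>" for r
    by (simp add: em)
  have vol: "unit_ball_vol ?n = pi powr (?n / 2) / Gamma (?n / 2) / (?n / 2)"
  proof -
    have g: "Gamma (?n / 2 + 1) = ?n / 2 * Gamma (?n / 2)"
      using n by (intro Gamma_plus1) (auto dest: nonpos_Ints_nonpos)
    show ?thesis unfolding unit_ball_vol_def g by simp
  qed
  have pw: "sqrt r ^ card A = r powr (?n / 2)" if "r > 0" for r
  proof -
    have s1: "sqrt r ^ card A = sqrt r powr ?n" by (rule powr_realpow[symmetric]) (use that in simp)
    have s2: "sqrt r = r powr (1 / 2)" by (rule powr_half_sqrt[symmetric]) (use that in simp)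
    have s3: "1 / 2 * ?n = ?n / 2" by simp
    show ?thesis unfolding s1 unfolding s2 powr_powr s3 ..
  qed
  have b: "?n / 2 > 0" and c: "0 \<le> pi powr (?n / 2) / Gamma (?n / 2)" using n G by auto
  show "emeasure (LP A) {w \<in> space (LP A). (\<Sum>x\<in>A. (w x)\<^sup>2) \<le> r} =
     (\<integral>\<^sup>+y. ennreal (indicator {0<..} y * (pi powr (?n / 2) / Gamma (?n / 2) * y powr (?n / 2 - 1))) * indicator {..r} y \<partial>lborel)" for r
    unfolding nn_integral_powr_Iic[OF b c] em vol by (cases "r > 0") (simp_all only: pw if_True if_False)
qed (rule measurable_powr_density)

subsection \<open>The positive definite cone\<close>

lemma transpose_eq_iff: "transpose r = r \<longleftrightarrow> (\<forall>i j. r $ i $ j = r $ j $ i)"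
  for r :: "real^'n^'n"
  by (auto simp: transpose_def vec_eq_iff)

lemma closed_symmetric: "closed {r :: real^'n^'n. transpose r = r}"
proof -
  have "{r :: real^'n^'n. transpose r = r} = (\<Inter>i j. {r. r $ i $ j = r $ j $ i})"
    by (auto simp: transpose_eq_iff)
  then show ?thesis
    by (auto intro!: closed_INT closed_Collect_eq continuous_intros)
qed

lemma continuous_quadratic_form: "continuous_on UNIV (\<lambda>(r :: real^'n^'n, x). x \<bullet> (r *v x))"
  unfolding inner_vec_def matrix_vector_mult_def split_beta by (auto intro!: continuous_intros)

text \<open>By homogeneity positivity need only be tested on the unit sphere; as this is compact,
  the tube lemma makes it an open condition. Both the Borel measurability of the cone and the
  continuity of test functions rest on this relative openness.\<close>

lemma pos_def_cone_eq: "\<exists>U. open U \<and> pos_def_cone = {r :: real^'n^'n. transpose r = r} \<inter> U"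
proof -
  let ?U = "{r :: real^'n^'n. \<forall>x\<in>sphere 0 1. x \<bullet> (r *v x) > 0}"
  let ?W = "{(r :: real^'n^'n, x). x \<bullet> (r *v x) > 0}"
  have W: "open ?W"
    using open_Collect_less[OF continuous_on_const continuous_quadratic_form, of 0]
    by (simp add: case_prod_unfold)
  have "open ?U"
  proof (subst open_subopen, intro ballI)
    fix r :: "real^'n^'n" assume "r \<in> ?U"
    then have "{r} \<times> sphere 0 1 \<subseteq> ?W" by auto
    with tube_lemma_right[of euclidean euclidean ?W "sphere 0 1" r] W
    obtain X C where "r \<in> X" "open X" "sphere 0 1 \<subseteq> C" "X \<times> C \<subseteq> ?W"
      by (auto simp: compactin_euclidean_iff)
    then have "X \<times> sphere 0 1 \<subseteq> ?W" by blast
    then show "\<exists>T. open T \<and> r \<in> T \<and> T \<subseteq> ?U" by (intro exI[of _ X]) (use \<open>r \<in> X\<close> \<open>open X\<close> in auto)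
  qed
  moreover have pos: "x \<bullet> (r *v x) > 0" if "r \<in> ?U" "x \<noteq> 0" for r :: "real^'n^'n" and x
  proof -
    let ?y = "(1 / norm x) *\<^sub>R x"
    have x: "x = norm x *\<^sub>R ?y" using that(2) by simp
    have "?y \<in> sphere 0 1" using that(2) by simp
    then have "?y \<bullet> (r *v ?y) > 0" using that(1) by blast
    moreover have pos: "x \<bullet> (r *v x) = (norm x)\<^sup>2 * (?y \<bullet> (r *v ?y))"
      using that(2) by (simp add: matrix_vector_mult_scaleR power2_eq_square)
    ultimately show ?thesis using that(2) by (metis mult_pos_pos zero_less_norm_iff zero_less_power)
  qed
  moreover have "pos_def_cone = {r. transpose r = r} \<inter> ?U"
  proof (intro set_eqI iffI IntI CollectI ballI)
    fix r :: "real^'n^'n" and x :: "real^'n" assume "r \<in> pos_def_cone" "x \<in> sphere 0 1"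
    moreover then have "x \<noteq> 0" by auto
    ultimately show "x \<bullet> (r *v x) > 0" by (simp add: pos_def_cone_def)
  next
    fix r :: "real^'n^'n" assume "r \<in> {r. transpose r = r} \<inter> ?U"
    then show "r \<in> pos_def_cone" using pos[of r] by (simp add: pos_def_cone_def)
  qed (simp add: pos_def_cone_def)
  ultimately show ?thesis by blast
qed

lemma sets_pos_def_cone [measurable]: "(pos_def_cone :: (real^'n^'n) set) \<in> sets borel"
proof -
  obtain U :: "(real^'n^'n) set" where "open U" "pos_def_cone = {r. transpose r = r} \<inter> U"
    using pos_def_cone_eq by blast
  then show ?thesis using sets.Int[OF borel_closed[OF closed_symmetric] borel_open, of U] by simp
qed

lemma pos_def_congruence:
  fixes L R :: "real^'n^'n"
  assumes "det L \<noteq> 0"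
  shows "L ** R ** transpose L \<in> pos_def_cone \<longleftrightarrow> R \<in> pos_def_cone"
proof -
  have *: "L ** R ** transpose L \<in> pos_def_cone" if "R \<in> pos_def_cone" and d: "det L \<noteq> 0" for L R :: "real^'n^'n"
  proof -
    have inv: "invertible (transpose L)" using d by (simp add: invertible_det_nz)
    have "x \<bullet> (L ** R ** transpose L *v x) > 0" if "x \<noteq> 0" for x
    proof -
      have "transpose L *v x \<noteq> 0"
        using inv that by (metis invertible_def matrix_vector_mul_assoc matrix_vector_mul_lid matrix_vector_mult_0_right)
      moreover have "x \<bullet> (L ** R ** transpose L *v x) = (transpose L *v x) \<bullet> (R *v (transpose L *v x))"
        by (metis dot_lmul_matrix matrix_mul_assoc matrix_vector_mul_assoc transpose_matrix_vector transpose_transpose)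
      ultimately show ?thesis using \<open>R \<in> pos_def_cone\<close> by (simp add: pos_def_cone_def)
    qed
    moreover have "transpose (L ** R ** transpose L) = L ** R ** transpose L"
      using \<open>R \<in> pos_def_cone\<close> by (simp add: pos_def_cone_def matrix_transpose_mul matrix_mul_assoc)
    ultimately show ?thesis by (simp add: pos_def_cone_def)
  qed
  \<comment> \<open>The converse is the implication just proved, applied to the inverse of
    \<open>L\<close>.\<close>
  obtain L' where L': "L' ** L = mat 1" "L ** L' = mat 1"
    using assms by (metis invertible_det_nz invertible_def)
  then have d': "det L' \<noteq> 0" by (metis det_I det_mul mult_zero_left zero_neq_one)
  have t: "transpose L ** transpose L' = mat 1"
    using L'(1) by (metis matrix_transpose_mul transpose_mat)
  have "R = L' ** (L ** R ** transpose L) ** transpose L'"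
    using L'(1) t by (metis matrix_mul_assoc matrix_mul_lid matrix_mul_rid)
  then show ?thesis using *[of R L] *[of "L ** R ** transpose L" L'] assms d' by metis
qed

text \<open>Matrices indexed by a subset \<open>S\<close> are padded by the identity, which changes neither the determinant nor
  positivity. This permits induction on \<open>S\<close> within one matrix type.\<close>

definition pad :: "'m set \<Rightarrow> real^'m::finite^'m" where
  "pad S = (\<chi> i j. if i = j \<and> i \<notin> S then 1 else 0)"

definition upr :: "'m::linorder set \<Rightarrow> ('m \<times> 'm) set" where
  "upr S = {(i, j). i \<le> j \<and> i \<in> S \<and> j \<in> S}"

definition sym_pad :: "'m set \<Rightarrow> ('m::{finite,linorder} \<times> 'm \<Rightarrow> real) \<Rightarrow> real^'m::_^'m::_" where
  "sym_pad S x = (\<chi> i j. if i \<in> S \<and> j \<in> S then x (min i j, max i j) else 0) + pad S"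

lemma measurable_sym_pad:
  assumes "upr S \<subseteq> A"
  shows "sym_pad S \<in> borel_measurable (LP A)"
proof -
  have "(\<lambda>x. \<chi> i j. if i \<in> S \<and> j \<in> S then x (min i j, max i j) else 0) \<in> borel_measurable (LP A)"
  proof (rule measurable_matrix)
    fix i j
    show "(\<lambda>x. if i \<in> S \<and> j \<in> S then x (min i j, max i j) else 0) \<in> borel_measurable (LP A)"
    proof (cases "i \<in> S \<and> j \<in> S")
      case True
      then have "(min i j, max i j) \<in> A" using assms by (auto simp: upr_def min_def max_def)
      from LP_component'[OF this] True show ?thesis by simp
    qed (simp only: if_False borel_measurable_const)
  qed
  then show ?thesis unfolding sym_pad_def[abs_def] by simp
qed

text \<open>The block matrix with diagonal entry \<open>\<rho>\<^sup>2\<close> at \<open>a\<close> and Schur complement \<open>R\<close>.\<close>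

definition block :: "'m \<Rightarrow> 'm set \<Rightarrow> real \<Rightarrow> ('m \<Rightarrow> real) \<Rightarrow> real^'m^'m \<Rightarrow> real^'m::finite^'m" where
  "block a T \<rho> u R = (\<chi> i j. if i = a \<and> j = a then \<rho>\<^sup>2 else if i = a \<and> j \<in> T then \<rho> * u j
     else if j = a \<and> i \<in> T then \<rho> * u i else if i \<in> T \<and> j \<in> T then R $ i $ j + u i * u j else R $ i $ j)"

text \<open>One step of a Cholesky factorisation: \<open>block\<close> arises from its Schur
  complement by congruence with this matrix. It is lower triangular when \<open>a\<close> precedes
  \<open>T\<close>, hence its determinant is \<open>\<rho>\<close>.\<close>

definition chol :: "'m \<Rightarrow> 'm set \<Rightarrow> real \<Rightarrow> ('m \<Rightarrow> real) \<Rightarrow> real^'m::finite^'m" where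
  "chol a T \<rho> u = (\<chi> i j. if i = a \<and> j = a then \<rho> else if j = a \<and> i \<in> T then u i else if i = j then 1 else 0)"

lemma block_eq_congruence:
  assumes "a \<notin> T" and R: "R $ a $ a = 1" "\<And>j. j \<noteq> a \<Longrightarrow> R $ a $ j = 0" "\<And>j. j \<noteq> a \<Longrightarrow> R $ j $ a = 0"
  shows "block a T \<rho> u R = chol a T \<rho> u ** R ** transpose (chol a T \<rho> u)"
proof -
  define l where "l i = (if i = a then \<rho> else if i \<in> T then u i else 0)" for i
  define e where "e i = (if i = a then 0 else 1::real)" for i
  \<comment> \<open>A matrix supported on column \<open>a\<close> plus a diagonal matrix vanishing
    at \<open>a\<close>; written with Kronecker deltas, the sums in both matrix products
    collapse.\<close>
  have c: "chol a T \<rho> u $ i $ k = (if k = a then l i else 0) + (if k = i then e i else 0)" for i k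
    using assms(1) by (auto simp: chol_def l_def e_def)
  have 1: "(chol a T \<rho> u ** R) $ i $ j = l i * R $ a $ j + e i * R $ i $ j" for i j
    unfolding matrix_matrix_mult_def by (simp add: c distrib_right sum.distrib if_distrib[of "\<lambda>x. x * _"] cong: if_cong)
  have 2: "(chol a T \<rho> u ** R ** transpose (chol a T \<rho> u)) $ i $ j =
    (l i * R $ a $ a + e i * R $ i $ a) * l j + (l i * R $ a $ j + e i * R $ i $ j) * e j" for i j
    unfolding matrix_matrix_mult_def[of "chol a T \<rho> u ** R"]
    by (simp add: 1 c transpose_def distrib_left sum.distrib if_distrib[of "\<lambda>x. _ * x"] cong: if_cong)
  show ?thesis
    unfolding vec_eq_iff 2 using assms(1)
    by (auto simp: block_def l_def e_def R power2_eq_square)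
qed

lemma det_chol:
  fixes a :: "'m::{finite,wellorder}"
  assumes "\<And>i. i \<in> T \<Longrightarrow> a < i"
  shows "det (chol a T \<rho> u) = \<rho>"
proof -
  have "det (chol a T \<rho> u) = (\<Prod>i\<in>UNIV. chol a T \<rho> u $ i $ i)"
    using assms by (intro det_lowerdiagonal) (force simp: chol_def)
  also have "\<dots> = (\<Prod>i\<in>UNIV. if i = a then \<rho> else 1)"
    by (intro prod.cong) (auto simp: chol_def)
  finally show ?thesis by (simp add: prod.delta)
qed

subsection \<open>The Gram matrix of at least as many rows as columns\<close>

lemma measurable_matrix_entry:
  fixes f :: "'a \<Rightarrow> real^'n::finite^'m::finite"
  assumes "f \<in> borel_measurable M"
  shows "(\<lambda>x. f x $ i $ j) \<in> borel_measurable M"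
proof -
  have "(\<lambda>r :: real^'n^'m. r $ i $ j) \<in> borel_measurable borel"
    by (intro borel_measurable_continuous_onI continuous_intros)
  from measurable_compose[OF assms this] show ?thesis .
qed

lemma measurable_block:
  assumes r: "r \<in> borel_measurable M" and g: "\<And>j. j \<in> T \<Longrightarrow> (\<lambda>x. g x j) \<in> borel_measurable M"
    and h: "h \<in> borel_measurable M"
  shows "(\<lambda>x. block a T (r x) (g x) (h x)) \<in> borel_measurable M"
  unfolding block_def
proof (rule measurable_matrix)
  fix i j
  note [measurable] = r g measurable_matrix_entry[OF h]
  show "(\<lambda>x. if i = a \<and> j = a then (r x)\<^sup>2 else if i = a \<and> j \<in> T then r x * g x j
     else if j = a \<and> i \<in> T then r x * g x i else if i \<in> T \<and> j \<in> T then h x $ i $ j + g x i * g x j else h x $ i $ j)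
    \<in> borel_measurable M"
    by (cases "i \<in> T"; cases "j \<in> T"; cases "i = a"; cases "j = a"; simp) measurable
qed

text \<open>Row \<open>p\<close> contributes the diagonal entry \<open>t\<close>, the off-diagonal
  entries \<open>sqrt t\<close> times \<open>u\<close>, and the rank-one term formed from
  \<open>u\<close>. What remains is the Gram matrix of the other rows, so the Schur complement is
  independent of \<open>t\<close> and \<open>u\<close>.\<close>

lemma gram_ext_col_merge:
  assumes "finite I" "p \<notin> I" "a \<notin> T" "0 \<le> t"
  shows "gram (insert p I) (insert a T) (ext_col a p (sqrt t) (merge ({p} \<times> T) (I \<times> T) (u, z))) + pad (insert a T) =
    block a T (sqrt t) (\<lambda>j. u (p, j)) (gram I T z + pad T)"
proof -
  let ?m = "merge ({p} \<times> T) (I \<times> T) (u, z)"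
  have m1: "?m (p, j) = u (p, j)" if "j \<in> T" for j using that by (simp add: merge_def)
  have m2: "?m (i, j) = z (i, j)" if "j \<in> T" "i \<in> I" for i j using that assms(2) by (auto simp: merge_def)
  have s: "(\<Sum>i\<in>insert p I. ?m (i, j) * ?m (i, l)) = (\<Sum>i\<in>I. z (i, j) * z (i, l)) + u (p, j) * u (p, l)"
    if "j \<in> T" "l \<in> T" for j l
  proof -
    have "(\<Sum>i\<in>I. ?m (i, j) * ?m (i, l)) = (\<Sum>i\<in>I. z (i, j) * z (i, l))"
      using that by (intro sum.cong refl) (simp add: m2)
    then show ?thesis using assms(1,2) that by (simp add: m1)
  qed
  have "(gram (insert p I) (insert a T) (ext_col a p (sqrt t) ?m) + pad (insert a T)) $ j $ l =
    block a T (sqrt t) (\<lambda>j. u (p, j)) (gram I T z + pad T) $ j $ l" for j l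
    using assms(1,3) unfolding gram_ext_col[OF _ _ assms(3), of "insert p I" p, simplified, OF assms(1)]
    unfolding block_def pad_def gram_def
    by (cases "j \<in> T"; cases "l \<in> T"; cases "j = a"; cases "l = a") (simp_all add: s m1)
  then show ?thesis by (simp add: vec_eq_iff)
qed

text \<open>The substitution from Cholesky coordinates \<open>(\<rho>, u, x)\<close> to the
  independent entries \<open>y\<close>. Because \<open>a\<close> is below \<open>T\<close>, the
  pairs \<open>(a, j)\<close> are in the order that \<open>sym_pad\<close> reads.\<close>

lemma sym_pad_insert:
  fixes a :: "'m::{finite,wellorder}"
  assumes T: "\<And>i. i \<in> T \<Longrightarrow> a < i"
    and y1: "\<And>j. j \<in> T \<Longrightarrow> y (a, j) = \<rho> * u j" and y2: "y (a, a) = \<rho>\<^sup>2"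
    and y3: "\<And>i j. i \<in> T \<Longrightarrow> j \<in> T \<Longrightarrow> i \<le> j \<Longrightarrow> y (i, j) = x (i, j) + u i * u j"
  shows "sym_pad (insert a T) y = block a T \<rho> u (sym_pad T x)"
proof -
  have a: "a \<notin> T" using T by blast
  have m: "min a j = a" "min j a = a" "max a j = j" "max j a = j" if "j \<in> T" for j
    using T[OF that] by (auto simp: min_def max_def)
  have mm: "y (min i j, max i j) = x (min i j, max i j) + u i * u j" if "i \<in> T" "j \<in> T" for i j
    using that y3[of i j] y3[of j i] by (auto simp: min_def max_def mult.commute)
  have "sym_pad (insert a T) y $ i $ j = block a T \<rho> u (sym_pad T x) $ i $ j" for i j
    unfolding sym_pad_def block_def pad_def using a
    by (cases "i \<in> T"; cases "j \<in> T"; cases "i = a"; cases "j = a") (simp_all add: m mm y1 y2)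
  then show ?thesis by (simp add: vec_eq_iff)
qed

lemma upr_insert:
  fixes a :: "'m::{finite,wellorder}"
  assumes T: "\<And>i. i \<in> T \<Longrightarrow> a < i"
  shows "upr (insert a T) = insert (a, a) ({a} \<times> T \<union> upr T)" "(a, a) \<notin> {a} \<times> T \<union> upr T" "({a} \<times> T) \<inter> upr T = {}"
proof -
  have a: "a \<notin> T" using T by blast
  show "(a, a) \<notin> {a} \<times> T \<union> upr T" "({a} \<times> T) \<inter> upr T = {}" using a by (auto simp: upr_def)
  show "upr (insert a T) = insert (a, a) ({a} \<times> T \<union> upr T)"
    using T by (force simp: upr_def less_imp_le)
qed

lemma sym_pad_col:
  fixes a :: "'m::{finite,wellorder}"
  assumes "a \<notin> T"
  shows "sym_pad T x $ a $ a = 1" "j \<noteq> a \<Longrightarrow> sym_pad T x $ a $ j = 0" "j \<noteq> a \<Longrightarrow> sym_pad T x $ j $ a = 0"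
  using assms by (auto simp: sym_pad_def pad_def)

lemma block_sym_pad:
  fixes a :: "'m::{finite,wellorder}"
  assumes T: "\<And>i. i \<in> T \<Longrightarrow> a < i" and "\<rho> \<noteq> 0"
  shows "block a T \<rho> u (sym_pad T x) \<in> pos_def_cone \<longleftrightarrow> sym_pad T x \<in> pos_def_cone"
    "det (block a T \<rho> u (sym_pad T x)) = \<rho>\<^sup>2 * det (sym_pad T x)"
proof -
  have a: "a \<notin> T" using T by blast
  have b: "block a T \<rho> u (sym_pad T x) = chol a T \<rho> u ** sym_pad T x ** transpose (chol a T \<rho> u)"
    using sym_pad_col[OF a] by (intro block_eq_congruence[OF a]) auto
  have d: "det (chol a T \<rho> u) = \<rho>" using T by (rule det_chol)
  show "block a T \<rho> u (sym_pad T x) \<in> pos_def_cone \<longleftrightarrow> sym_pad T x \<in> pos_def_cone"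
    unfolding b using assms(2) by (intro pos_def_congruence) (simp add: d)
  show "det (block a T \<rho> u (sym_pad T x)) = \<rho>\<^sup>2 * det (sym_pad T x)"
    unfolding b by (simp add: det_mul d power2_eq_square)
qed

lemma pos_def_cone_diag_pos:
  assumes "r \<in> pos_def_cone" shows "r $ a $ a > 0"
proof -
  have "axis a 1 \<bullet> (r *v axis a 1) > 0" using assms by (auto simp: pos_def_cone_def axis_eq_0_iff)
  then show ?thesis by (simp add: matrix_vector_mult_basis column_def inner_axis' )
qed

lemma mat_1_pos_def: "mat 1 \<in> pos_def_cone"
  by (simp add: pos_def_cone_def)

lemma emeasure_LP_empty: "emeasure (LP {}) (space (LP {})) = 1"
  by (simp add: PiM_empty)

text \<open>The normalising constant of the law of a Gram matrix with \<open>k\<close> rows and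
  \<open>n\<close> columns. For \<open>n \<le> k\<close> it is \<open>pi powr (k n / 2)\<close>
  divided by \<open>Gamma_m n (k / 2)\<close>, see \<open>gram_const_eq\<close>.\<close>

definition gram_const :: "nat \<Rightarrow> nat \<Rightarrow> real" where
  "gram_const k n = (\<Prod>j<n. pi powr ((real k - real j) / 2) / Gamma ((real k - real j) / 2))"

lemma gram_const_Suc:
  "gram_const (Suc k) (Suc n) = pi powr (real (Suc k) / 2) / Gamma (real (Suc k) / 2) * gram_const k n"
  unfolding gram_const_def by (subst prod.lessThan_Suc_shift) simp

text \<open>The Wishart density without its exponential factor and constant. The exponent is alpha -
  d for alpha = k / 2 and matrices of size \<open>card S\<close>.\<close>

definition wishart_weight :: "nat \<Rightarrow> 'm set \<Rightarrow> ('m::{finite,linorder} \<times> 'm \<Rightarrow> real) \<Rightarrow> ennreal" where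
  "wishart_weight k S x = ennreal (indicator pos_def_cone (sym_pad S x) * \<bar>det (sym_pad S x)\<bar> powr ((real k - real (card S) - 1) / 2))"

lemma measurable_wishart_weight:
  fixes S :: "'m::{finite,wellorder} set"
  shows "wishart_weight k S \<in> borel_measurable (LP (upr S))"
proof -
  have sp: "sym_pad S \<in> borel_measurable (LP (upr S))" by (rule measurable_sym_pad) simp
  have d: "(\<lambda>r :: real^'m::_^'m::_. ennreal (indicator pos_def_cone r * \<bar>det r\<bar> powr c)) \<in> borel_measurable borel" for c
  proof -
    have [measurable]: "(det :: real^'m::_^'m::_ \<Rightarrow> real) \<in> borel_measurable borel"
      unfolding det_def by (intro borel_measurable_continuous_onI continuous_intros)
    show ?thesis by measurable
  qed
  show ?thesis unfolding wishart_weight_def by (rule measurable_compose[OF sp d])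
qed

text \<open>Integration over the cone in Cholesky coordinates. The Jacobian of the scaling by
  \<open>sqrt t\<close> is \<open>t powr (card T / 2)\<close>, the shift by \<open>u i * u j\<close>
  has Jacobian 1, and the determinant contributes \<open>t powr ?\<beta>\<close>. The label
  \<open>p\<close> only names the row in which \<open>u\<close> will be found in the array.\<close>

lemma nn_integral_upr_insert:
  fixes a :: "'m::{finite,wellorder}" and F :: "real^'m::_^'m::_ \<Rightarrow> ennreal" and p :: 'k
  assumes T: "\<And>i. i \<in> T \<Longrightarrow> a < i" and F: "F \<in> borel_measurable borel"
  shows "(\<integral>\<^sup>+y. wishart_weight (Suc k) (insert a T) y * F (sym_pad (insert a T) y) \<partial>LP (upr (insert a T))) =
    (\<integral>\<^sup>+t. ennreal (indicator {0<..} t * t powr (real (Suc k) / 2 - 1)) *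
      (\<integral>\<^sup>+u. \<integral>\<^sup>+x. wishart_weight k T x * F (block a T (sqrt t) (\<lambda>j. u (p, j)) (sym_pad T x)) \<partial>LP (upr T) \<partial>LP ({p} \<times> T)) \<partial>lborel)"
proof -
  let ?S = "insert a T"
  let ?B = "{a} \<times> T \<union> upr T"
  let ?\<beta> = "(real k - real (card T) - 1) / 2"
  have aT: "a \<notin> T" using T by blast
  have u: "upr ?S = insert (a, a) ?B" "(a, a) \<notin> ?B" "({a} \<times> T) \<inter> upr T = {}"
    using upr_insert[of T a] T by blast+
  have fin: "finite ({a} \<times> T)" "finite (upr T)" "finite ?B" by simp_all
  define G where "G y = wishart_weight (Suc k) ?S y * F (sym_pad ?S y)" for y
  have "G \<in> borel_measurable (LP (upr ?S))"
    unfolding G_def[abs_def]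
    by (intro borel_measurable_times_ennreal measurable_wishart_weight measurable_compose[OF measurable_sym_pad F]) simp
  then have G: "G \<in> borel_measurable (LP (insert (a, a) ?B))" unfolding u(1) .
  have "(\<integral>\<^sup>+y. G y \<partial>LP (upr ?S)) = (\<integral>\<^sup>+t. \<integral>\<^sup>+y. G (y((a, a) := t)) \<partial>LP ?B \<partial>lborel)"
    unfolding u(1) by (rule LP.product_nn_integral_insert_rev[OF fin(3) u(2) G])
  also have "\<dots> = (\<integral>\<^sup>+t. ennreal (indicator {0<..} t * t powr (real (Suc k) / 2 - 1)) *
      (\<integral>\<^sup>+u. \<integral>\<^sup>+x. wishart_weight k T x * F (block a T (sqrt t) (\<lambda>j. u (p, j)) (sym_pad T x)) \<partial>LP (upr T) \<partial>LP ({p} \<times> T)) \<partial>lborel)"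
  proof (rule nn_integral_cong)
    fix t :: real
    show "(\<integral>\<^sup>+y. G (y((a, a) := t)) \<partial>LP ?B) = ennreal (indicator {0<..} t * t powr (real (Suc k) / 2 - 1)) *
      (\<integral>\<^sup>+u. \<integral>\<^sup>+x. wishart_weight k T x * F (block a T (sqrt t) (\<lambda>j. u (p, j)) (sym_pad T x)) \<partial>LP (upr T) \<partial>LP ({p} \<times> T))"
    proof (cases "t > 0")
      case False
      have "G (y((a, a) := t)) = 0" for y
      proof -
        have "sym_pad ?S (y((a, a) := t)) $ a $ a = t" by (simp add: sym_pad_def pad_def)
        then have "sym_pad ?S (y((a, a) := t)) \<notin> pos_def_cone"
          using pos_def_cone_diag_pos[of "sym_pad ?S (y((a, a) := t))" a] False by auto
        then show ?thesis by (simp add: G_def wishart_weight_def)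
      qed
      then show ?thesis using False by simp
    next
      case True
      define y where "y u x = (merge ({a} \<times> T) (upr T) (u, x))((a, a) := t)" for u x :: "'m \<times> 'm \<Rightarrow> real"
      have up: "(\<lambda>y. y((a, a) := t)) \<in> LP ?B \<rightarrow>\<^sub>M LP (insert (a, a) ?B)"
        by (intro measurable_fun_upd[where J="?B"]) auto
      have my: "(\<lambda>z. y (fst z) (snd z)) \<in> LP ({a} \<times> T) \<Otimes>\<^sub>M LP (upr T) \<rightarrow>\<^sub>M LP (insert (a, a) ?B)"
        using measurable_compose[OF measurable_merge up] by (simp add: y_def)
      have mGy: "(\<lambda>z. G (y (fst z) (snd z))) \<in> borel_measurable (LP ({a} \<times> T) \<Otimes>\<^sub>M LP (upr T))"
        by (rule measurable_compose[OF my G])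
      define Q where "Q u = (\<integral>\<^sup>+x. G (y u x) \<partial>LP (upr T))" for u
      have mQ: "Q \<in> borel_measurable (LP ({a} \<times> T))"
        unfolding Q_def[abs_def] using mGy
        by (intro sigma_finite_measure.borel_measurable_nn_integral LP.sigma_finite fin) (simp add: case_prod_unfold)
      have mQ2: "(\<lambda>u. Q (\<lambda>i\<in>{a} \<times> T. sqrt t * u i)) \<in> borel_measurable (LP ({a} \<times> T))"
      proof -
        have "(\<lambda>u. \<lambda>i\<in>{a} \<times> T. sqrt t * u i) \<in> LP ({a} \<times> T) \<rightarrow>\<^sub>M LP ({a} \<times> T)"
          by (intro measurable_restrict) (auto intro!: borel_measurable_times LP_component')
        from measurable_compose[OF this mQ] show ?thesis .
      qed
      have upG: "(\<lambda>y. G (y((a, a) := t))) \<in> borel_measurable (LP ?B)"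
        by (rule measurable_compose[OF up G])
      have "(\<integral>\<^sup>+y. G (y((a, a) := t)) \<partial>LP ?B) = (\<integral>\<^sup>+u. Q u \<partial>LP ({a} \<times> T))"
        unfolding Q_def y_def by (rule LP.product_nn_integral_fold[OF u(3) fin(1,2) upG])
      also have "\<dots> = ennreal (sqrt t ^ card ({a} \<times> T)) * (\<integral>\<^sup>+u. Q (\<lambda>i\<in>{a} \<times> T. sqrt t * u i) \<partial>LP ({a} \<times> T))"
        using LP_affine[OF fin(1) _ mQ, of "sqrt t" "\<lambda>_. 0"] True by simp
      \<comment> \<open>Relabel \<open>(a, j)\<close>, an entry of the matrix, as
        \<open>(p, j)\<close>, an entry of the array.\<close>
      also have "(\<integral>\<^sup>+u. Q (\<lambda>i\<in>{a} \<times> T. sqrt t * u i) \<partial>LP ({a} \<times> T)) =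
         (\<integral>\<^sup>+u. Q (\<lambda>i\<in>{a} \<times> T. sqrt t * (\<lambda>i\<in>{a} \<times> T. u (p, snd i)) i) \<partial>LP ((\<lambda>i. (p, snd i)) ` ({a} \<times> T)))"
        by (rule LP_reindex[OF fin(1) _ mQ2]) (auto simp: inj_on_def)
      also have "(\<lambda>i. (p, snd i)) ` ({a} \<times> T) = {p} \<times> T" by force
      also have "(\<integral>\<^sup>+u. Q (\<lambda>i\<in>{a} \<times> T. sqrt t * (\<lambda>i\<in>{a} \<times> T. u (p, snd i)) i) \<partial>LP ({p} \<times> T)) =
        (\<integral>\<^sup>+u. ennreal (t powr ?\<beta>) * (\<integral>\<^sup>+x. wishart_weight k T x * F (block a T (sqrt t) (\<lambda>j. u (p, j)) (sym_pad T x)) \<partial>LP (upr T)) \<partial>LP ({p} \<times> T))"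
      proof (rule nn_integral_cong)
        fix w assume w: "w \<in> space (LP ({p} \<times> T))"
        let ?v = "\<lambda>i\<in>{a} \<times> T. sqrt t * (\<lambda>i\<in>{a} \<times> T. w (p, snd i)) i"
        let ?u = "\<lambda>j. w (p, j)"
        have v: "?v \<in> space (LP ({a} \<times> T))" by (auto simp: space_PiM)
        have m1: "(\<lambda>x. G (y ?v x)) \<in> borel_measurable (LP (upr T))"
          using measurable_Pair2[OF mGy v] by simp
        have eq: "G (y ?v (\<lambda>i\<in>upr T. 1 * x i + ?u (fst i) * ?u (snd i))) =
          ennreal (t powr ?\<beta>) * (wishart_weight k T x * F (block a T (sqrt t) ?u (sym_pad T x)))" for x
        proof -
          let ?y = "y ?v (\<lambda>i\<in>upr T. 1 * x i + ?u (fst i) * ?u (snd i))"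
          have ya: "?y (a, j) = sqrt t * ?u j" if "j \<in> T" for j
            using that aT by (auto simp: y_def merge_def)
          have yaa: "?y (a, a) = (sqrt t)\<^sup>2" using True by (simp add: y_def)
          have yij: "?y (i, j) = x (i, j) + ?u i * ?u j" if "i \<in> T" "j \<in> T" "i \<le> j" for i j
          proof -
            have "(i, j) \<in> upr T" "i \<noteq> a" using that aT by (auto simp: upr_def)
            then show ?thesis by (simp add: y_def merge_def)
          qed
          have sp: "sym_pad ?S ?y = block a T (sqrt t) ?u (sym_pad T x)"
            by (rule sym_pad_insert[where u = "?u" and x = x, OF T ya yaa yij])
          have st: "sqrt t \<noteq> 0" "(sqrt t)\<^sup>2 = t" using True by auto
          have b: "block a T (sqrt t) ?u (sym_pad T x) \<in> pos_def_cone \<longleftrightarrow> sym_pad T x \<in> pos_def_cone"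
            "det (block a T (sqrt t) ?u (sym_pad T x)) = t * det (sym_pad T x)"
            using block_sym_pad[of T a "sqrt t" ?u x] T st by auto
          \<comment> \<open>The number of rows and the size both grow by one, so the exponent of the
            determinant is unchanged.\<close>
          have c: "card ?S = Suc (card T)" using aT by simp
          have "wishart_weight (Suc k) ?S ?y = ennreal (t powr ?\<beta>) * wishart_weight k T x"
            unfolding wishart_weight_def sp b indicator_def using True c
            by (auto simp: abs_mult powr_mult ennreal_mult[symmetric])
          then show ?thesis unfolding G_def sp by (simp add: mult.assoc)
        qed
        have mF: "(\<lambda>x. wishart_weight k T x * F (block a T (sqrt t) ?u (sym_pad T x))) \<in> borel_measurable (LP (upr T))"
          by (intro borel_measurable_times_ennreal measurable_wishart_weight measurable_compose[OF measurable_block F]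
              measurable_sym_pad) simp_all
        have "Q ?v = (\<integral>\<^sup>+x. G (y ?v (\<lambda>i\<in>upr T. 1 * x i + ?u (fst i) * ?u (snd i))) \<partial>LP (upr T))"
          unfolding Q_def using LP_affine[OF fin(2) zero_less_one m1, of "\<lambda>i. ?u (fst i) * ?u (snd i)"] by simp
        also have "\<dots> = ennreal (t powr ?\<beta>) * (\<integral>\<^sup>+x. wishart_weight k T x * F (block a T (sqrt t) ?u (sym_pad T x)) \<partial>LP (upr T))"
          unfolding eq by (rule nn_integral_cmult[OF mF])
        finally show "Q ?v = ennreal (t powr ?\<beta>) * (\<integral>\<^sup>+x. wishart_weight k T x * F (block a T (sqrt t) ?u (sym_pad T x)) \<partial>LP (upr T))" .
      qed
      also have "\<dots> = ennreal (t powr ?\<beta>) * (\<integral>\<^sup>+u. \<integral>\<^sup>+x. wishart_weight k T x * F (block a T (sqrt t) (\<lambda>j. u (p, j)) (sym_pad T x)) \<partial>LP (upr T) \<partial>LP ({p} \<times> T))"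
      proof (rule nn_integral_cmult, rule sigma_finite_measure.borel_measurable_nn_integral[OF LP.sigma_finite[OF fin(2)]])
        have "(\<lambda>z. wishart_weight k T (snd z) * F (block a T (sqrt t) (\<lambda>j. fst z (p, j)) (sym_pad T (snd z))))
          \<in> borel_measurable (LP ({p} \<times> T) \<Otimes>\<^sub>M LP (upr T))"
          by (intro borel_measurable_times_ennreal measurable_compose[OF measurable_snd measurable_wishart_weight]
              measurable_compose[OF measurable_block F] measurable_compose[OF measurable_snd measurable_sym_pad]
              measurable_compose[OF measurable_fst LP_component']) auto
        then show "(\<lambda>(u, x). wishart_weight k T x * F (block a T (sqrt t) (\<lambda>j. u (p, j)) (sym_pad T x)))
          \<in> borel_measurable (LP ({p} \<times> T) \<Otimes>\<^sub>M LP (upr T))" by (simp add: case_prod_unfold)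
      qed
      also have "ennreal (sqrt t ^ card ({a} \<times> T)) * (ennreal (t powr ?\<beta>) * X) =
          ennreal (indicator {0<..} t * t powr (real (Suc k) / 2 - 1)) * X" for X
      proof -
        have "sqrt t ^ card ({a} \<times> T) = sqrt t powr real (card T)"
          using True by (simp add: card_cartesian_product powr_realpow)
        also have "\<dots> = t powr (real (card T) / 2)"
          using True by (simp add: powr_half_sqrt[symmetric] powr_powr)
        finally have "sqrt t ^ card ({a} \<times> T) * t powr ?\<beta> = t powr (real (card T) / 2 + ?\<beta>)"
          by (simp add: powr_add)
        also have "real (card T) / 2 + ?\<beta> = real (Suc k) / 2 - 1" by (simp add: field_simps)
        finally show ?thesis using True by (simp add: mult.assoc[symmetric] ennreal_mult[symmetric])
      qed
      finally show ?thesis .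
    qed
  qed
  finally show ?thesis unfolding G_def .
qed

text \<open>A step removes one row and one column, so \<open>card S \<le> card I\<close> persists,
  and it keeps every Gamma argument in the constant positive. The radial density of the removed
  column matches the factor in \<open>nn_integral_upr_insert\<close> up to the first factor of
  \<open>gram_const\<close>.\<close>

lemma nn_integral_gram:
  fixes F :: "real^'m::{finite,wellorder}^'m::_ \<Rightarrow> ennreal" and I :: "'k set" and S :: "'m set"
  assumes "finite I" "card S \<le> card I" "F \<in> borel_measurable borel"
  shows "(\<integral>\<^sup>+w. F (gram I S w + pad S) \<partial>LP (I \<times> S)) =
    ennreal (gram_const (card I) (card S)) * (\<integral>\<^sup>+x. wishart_weight (card I) S x * F (sym_pad S x) \<partial>LP (upr S))"
  using finite[of S] assms
\<comment> \<open>The new index lies below all earlier ones, as triangularity of \<open>chol\<close>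
  requires.\<close>
proof (induction S arbitrary: I F rule: finite_linorder_min_induct)
  case empty
  have e: "upr ({} :: 'm set) = {}" "gram I {} w + pad {} = mat 1" "sym_pad {} x = mat 1" for w :: "'k \<times> 'm \<Rightarrow> real" and x :: "'m \<times> 'm \<Rightarrow> real"
    by (auto simp: upr_def gram_def pad_def sym_pad_def mat_def vec_eq_iff)
  show ?case
    by (simp add: e wishart_weight_def mat_1_pos_def gram_const_def emeasure_LP_empty)
next
  case (insert a T)
  have T: "\<And>i. i \<in> T \<Longrightarrow> a < i" using insert.hyps by blast
  have aT: "a \<notin> T" using T by blast
  note F = insert.prems(3)
  obtain p where p: "p \<in> I" using insert.prems(1,2) aT by fastforce
  define I' where "I' = I - {p}"
  have I': "finite I'" "p \<notin> I'" "I = insert p I'" using insert.prems(1) p by (auto simp: I'_def)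
  let ?k = "card I'"
  have k: "card I = Suc ?k" "card T \<le> ?k" using I' insert.prems(2) aT by auto
  have un: "I \<times> T = {p} \<times> T \<union> I' \<times> T" "({p} \<times> T) \<inter> (I' \<times> T) = {}" using I' by auto
  have fin: "finite ({p} \<times> T)" "finite (I' \<times> T)" "finite (I \<times> {a})" "I \<times> {a} \<noteq> {}" "finite (I \<times> T)" "finite (upr T)"
    using insert.prems(1) I' p by auto
  define K where "K t = (\<integral>\<^sup>+u. \<integral>\<^sup>+x. wishart_weight ?k T x * F (block a T (sqrt t) (\<lambda>j. u (p, j)) (sym_pad T x)) \<partial>LP (upr T) \<partial>LP ({p} \<times> T))" for t
  have mK: "K \<in> borel_measurable lborel"
  proof -
    have "(\<lambda>z. wishart_weight ?k T (snd z) * F (block a T (sqrt (fst (fst z))) (\<lambda>j. snd (fst z) (p, j)) (sym_pad T (snd z))))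
      \<in> borel_measurable ((lborel \<Otimes>\<^sub>M LP ({p} \<times> T)) \<Otimes>\<^sub>M LP (upr T))"
      by (intro borel_measurable_times_ennreal measurable_compose[OF measurable_snd measurable_wishart_weight]
              measurable_compose[OF measurable_block F] measurable_compose[OF measurable_snd measurable_sym_pad]
              measurable_compose[OF measurable_fst measurable_compose[OF measurable_snd LP_component']]) auto
    then have "(\<lambda>z. \<integral>\<^sup>+x. wishart_weight ?k T x * F (block a T (sqrt (fst z)) (\<lambda>j. snd z (p, j)) (sym_pad T x)) \<partial>LP (upr T))
      \<in> borel_measurable (lborel \<Otimes>\<^sub>M LP ({p} \<times> T))"
      by (intro sigma_finite_measure.borel_measurable_nn_integral LP.sigma_finite fin) (simp add: case_prod_unfold)
    then show ?thesis unfolding K_def[abs_def]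
      by (intro sigma_finite_measure.borel_measurable_nn_integral LP.sigma_finite fin) (simp add: case_prod_unfold)
  qed
  define H where "H t = (\<integral>\<^sup>+w. F (gram I (insert a T) (ext_col a p (sqrt t) w) + pad (insert a T)) \<partial>LP (I \<times> T))" for t
  have mF: "(\<lambda>r. F (r + pad (insert a T))) \<in> borel_measurable borel"
    using F by measurable
  have mH: "H \<in> borel_measurable borel"
  proof -
    have "(\<lambda>z. gram I (insert a T) (ext_col a p (sqrt (fst z)) (snd z))) \<in> borel_measurable (borel \<Otimes>\<^sub>M LP (I \<times> T))"
      using insert.prems(1) p aT by (intro measurable_gram_ext_col[where B="I \<times> T"]) auto
    from measurable_compose[OF this mF] show ?thesis
      unfolding H_def[abs_def]
      by (intro sigma_finite_measure.borel_measurable_nn_integral LP.sigma_finite fin) (simp add: case_prod_unfold)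
  qed
  \<comment> \<open>The induction hypothesis for the Schur complement, with \<open>t\<close> and
    \<open>u\<close> frozen. Values at \<open>t \<le> 0\<close> do not matter, since the radial
    density vanishes there.\<close>
  have HK: "H t = ennreal (gram_const ?k (card T)) * K t" if t: "t > 0" for t
  proof -
    have m: "(\<lambda>w. F (gram I (insert a T) (ext_col a p (sqrt t) w) + pad (insert a T))) \<in> borel_measurable (LP ({p} \<times> T \<union> I' \<times> T))"
      unfolding un(1)[symmetric] using insert.prems(1) p aT
      by (intro measurable_compose[OF measurable_gram_ext_col[where B="I \<times> T"] mF]) auto
    have "H t = (\<integral>\<^sup>+u. \<integral>\<^sup>+z. F (gram I (insert a T) (ext_col a p (sqrt t) (merge ({p} \<times> T) (I' \<times> T) (u, z))) + pad (insert a T)) \<partial>LP (I' \<times> T) \<partial>LP ({p} \<times> T))"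
      unfolding H_def un(1) by (rule LP.product_nn_integral_fold[OF un(2) fin(1,2) m])
    also have "\<dots> = (\<integral>\<^sup>+u. \<integral>\<^sup>+z. F (block a T (sqrt t) (\<lambda>j. u (p, j)) (gram I' T z + pad T)) \<partial>LP (I' \<times> T) \<partial>LP ({p} \<times> T))"
      unfolding I'(3) by (subst gram_ext_col_merge) (use I' aT t in auto)
    also have "\<dots> = (\<integral>\<^sup>+u. ennreal (gram_const ?k (card T)) * (\<integral>\<^sup>+x. wishart_weight ?k T x * F (block a T (sqrt t) (\<lambda>j. u (p, j)) (sym_pad T x)) \<partial>LP (upr T)) \<partial>LP ({p} \<times> T))"
    proof (rule nn_integral_cong)
      fix u :: "'k \<times> 'm \<Rightarrow> real"
      have "(\<lambda>r. F (block a T (sqrt t) (\<lambda>j. u (p, j)) r)) \<in> borel_measurable borel"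
        by (intro measurable_compose[OF measurable_block F]) auto
      from insert.IH[OF I'(1) k(2) this]
      show "(\<integral>\<^sup>+z. F (block a T (sqrt t) (\<lambda>j. u (p, j)) (gram I' T z + pad T)) \<partial>LP (I' \<times> T)) =
        ennreal (gram_const ?k (card T)) * (\<integral>\<^sup>+x. wishart_weight ?k T x * F (block a T (sqrt t) (\<lambda>j. u (p, j)) (sym_pad T x)) \<partial>LP (upr T))" .
    qed
    also have "\<dots> = ennreal (gram_const ?k (card T)) * K t"
      unfolding K_def
    proof (rule nn_integral_cmult, rule sigma_finite_measure.borel_measurable_nn_integral[OF LP.sigma_finite[OF fin(6)]])
      have "(\<lambda>z. wishart_weight ?k T (snd z) * F (block a T (sqrt t) (\<lambda>j. fst z (p, j)) (sym_pad T (snd z))))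
          \<in> borel_measurable (LP ({p} \<times> T) \<Otimes>\<^sub>M LP (upr T))"
          by (intro borel_measurable_times_ennreal measurable_compose[OF measurable_snd measurable_wishart_weight]
              measurable_compose[OF measurable_block F] measurable_compose[OF measurable_snd measurable_sym_pad]
              measurable_compose[OF measurable_fst LP_component']) auto
      then show "(\<lambda>(u, x). wishart_weight ?k T x * F (block a T (sqrt t) (\<lambda>j. u (p, j)) (sym_pad T x)))
          \<in> borel_measurable (LP ({p} \<times> T) \<Otimes>\<^sub>M LP (upr T))" by (simp add: case_prod_unfold)
    qed
    finally show ?thesis .
  qed
  let ?c = "pi powr (real (card I) / 2) / Gamma (real (card I) / 2)"
  have c: "?c \<ge> 0" by (intro divide_nonneg_nonneg less_imp_le[OF Gamma_real_pos]) (simp_all add: k)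
  have ca: "card (I \<times> {a}) = card I" by (simp add: card_cartesian_product)
  have gc: "gram_const ?k (card T) \<ge> 0"
    unfolding gram_const_def using k(2) by (intro prod_nonneg divide_nonneg_nonneg less_imp_le[OF Gamma_real_pos]) auto
  have "(\<integral>\<^sup>+w. F (gram I (insert a T) w + pad (insert a T)) \<partial>LP (I \<times> insert a T)) = (\<integral>\<^sup>+v. H (\<Sum>x\<in>I \<times> {a}. (v x)\<^sup>2) \<partial>LP (I \<times> {a}))"
    unfolding H_def by (rule nn_integral_gram_insert[OF insert.prems(1) p aT mF])
  also have "\<dots> = (\<integral>\<^sup>+t. ennreal (indicator {0<..} t * (?c * t powr (real (card I) / 2 - 1))) * H t \<partial>lborel)"
    using nn_integral_LP_norm_square[OF fin(3,4) mH] unfolding ca .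
  also have "\<dots> = (\<integral>\<^sup>+t. ennreal (?c * gram_const ?k (card T)) * (ennreal (indicator {0<..} t * t powr (real (card I) / 2 - 1)) * K t) \<partial>lborel)"
  proof (rule nn_integral_cong)
    fix t :: real
    show "ennreal (indicator {0<..} t * (?c * t powr (real (card I) / 2 - 1))) * H t =
      ennreal (?c * gram_const ?k (card T)) * (ennreal (indicator {0<..} t * t powr (real (card I) / 2 - 1)) * K t)"
    proof (cases "t > 0")
      case True
      then have "ennreal (indicator {0<..} t * (?c * t powr (real (card I) / 2 - 1))) * H t =
        (ennreal ?c * ennreal (t powr (real (card I) / 2 - 1))) * (ennreal (gram_const ?k (card T)) * K t)"
        using c HK[OF True] True by (simp only: indicator_simps(1) greaterThan_iff mult_1 ennreal_mult powr_ge_zero)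
      also have "\<dots> = (ennreal ?c * ennreal (gram_const ?k (card T))) * (ennreal (t powr (real (card I) / 2 - 1)) * K t)"
        by (simp only: ac_simps)
      finally show ?thesis using True ennreal_mult[OF c gc] by simp
    qed simp
  qed
  also have "\<dots> = ennreal (?c * gram_const ?k (card T)) * (\<integral>\<^sup>+t. ennreal (indicator {0<..} t * t powr (real (card I) / 2 - 1)) * K t \<partial>lborel)"
    by (intro nn_integral_cmult borel_measurable_times_ennreal mK) measurable
  also have "?c * gram_const ?k (card T) = gram_const (card I) (card (insert a T))"
    using gram_const_Suc[of ?k "card T"] aT unfolding k(1) by simp
  also have "(\<integral>\<^sup>+t. ennreal (indicator {0<..} t * t powr (real (card I) / 2 - 1)) * K t \<partial>lborel) =
    (\<integral>\<^sup>+y. wishart_weight (card I) (insert a T) y * F (sym_pad (insert a T) y) \<partial>LP (upr (insert a T)))"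
    unfolding K_def k(1) by (rule nn_integral_upr_insert[OF T F, symmetric])
  finally show ?case .
qed

subsection \<open>Test functions\<close>

text \<open>Write \<open>g u v - g 0 v\<close> as the integral of \<open>g1\<close>, differentiate
  under the integral sign in \<open>v\<close>, and then differentiate the result in \<open>u\<close>
  at 0. Of the two mixed derivatives only \<open>g12\<close> has to be continuous.\<close>

lemma mixed_partials_eq:
  fixes g g1 g2 g12 g21 :: "real \<Rightarrow> real \<Rightarrow> 'a::banach"
  assumes g1: "\<And>u v. ((\<lambda>u. g u v) has_vector_derivative g1 u v) (at u)"
    and g2: "\<And>u v. ((\<lambda>v. g u v) has_vector_derivative g2 u v) (at v)"
    and g12: "\<And>u v. ((\<lambda>v. g1 u v) has_vector_derivative g12 u v) (at v)"
    and g21: "\<And>u v. ((\<lambda>u. g2 u v) has_vector_derivative g21 u v) (at u)"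
    and c1: "continuous_on UNIV (\<lambda>(u, v). g1 u v)"
    and c12: "continuous_on UNIV (\<lambda>(u, v). g12 u v)"
  shows "g12 0 0 = g21 0 0"
proof -
  have c1': "continuous_on A (\<lambda>u. g1 u v)" for A v
    by (rule continuous_on_compose2[OF c1, of _ "\<lambda>u. (u, v)", simplified]) (intro continuous_intros)
  have c12': "continuous_on A (\<lambda>u. g12 u v)" for A v
    by (rule continuous_on_compose2[OF c12, of _ "\<lambda>u. (u, v)", simplified]) (intro continuous_intros)
  have ftc: "integral {0..u} (\<lambda>s. g1 s v) = g u v - g 0 v" if "u \<ge> 0" for u v
    using that by (intro integral_unique fundamental_theorem_of_calculus has_vector_derivative_at_within[OF g1])
  have lhs: "g2 u 0 - g2 0 0 = integral {0..u} (\<lambda>s. g12 s 0)" if u: "u \<ge> 0" for u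
  proof -
    have "((\<lambda>v. integral (cbox 0 u) (\<lambda>s. g1 s v)) has_vector_derivative integral (cbox 0 u) (\<lambda>s. g12 s 0)) (at 0 within UNIV)"
    proof (rule leibniz_rule_vector_derivative)
      show "continuous_on (UNIV \<times> cbox 0 u) (\<lambda>(v, s). g12 s v)"
        unfolding split_beta
        by (rule continuous_on_compose2[OF c12, of _ "\<lambda>z. (snd z, fst z)", simplified]) (intro continuous_intros)
    qed (auto intro: g12 integrable_continuous_real c1')
    then have "((\<lambda>v. g u v - g 0 v) has_vector_derivative integral {0..u} (\<lambda>s. g12 s 0)) (at 0)"
      using u by (simp add: ftc)
    moreover have "((\<lambda>v. g u v - g 0 v) has_vector_derivative g2 u 0 - g2 0 0) (at 0)"
      by (intro derivative_intros g2)
    ultimately show ?thesis by (rule vector_derivative_unique_at[symmetric])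
  qed
  \<comment> \<open>The integral formula is available for \<open>u \<ge> 0\<close> only, so the
    derivatives at 0 are compared from the right.\<close>
  have "((\<lambda>u. integral {0..u} (\<lambda>s. g12 s 0)) has_vector_derivative g12 0 0) (at 0 within {0..1})"
    by (rule integral_has_vector_derivative[OF c12']) simp
  then have "((\<lambda>u. g2 u 0 - g2 0 0) has_vector_derivative g12 0 0) (at 0 within {0..1})"
    by (rule has_vector_derivative_transform_within[of _ _ _ _ 1]) (auto simp: lhs)
  moreover have "((\<lambda>u. g2 u 0 - g2 0 0) has_vector_derivative g21 0 0 - 0) (at 0 within {0..1})"
    by (intro derivative_intros has_vector_derivative_at_within[OF g21])
  ultimately show ?thesis
    using vector_derivative_unique_within_closed_interval[of 0 1 0] by fastforce
qed

section \<open>Symmetric directions and the calculus of test functions\<close>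

abbreviation symm :: "(real^'m^'m) set" where
  "symm \<equiv> {r. transpose r = r}"

lemma sym_unit_symm: "sym_unit i j \<in> symm"
  by (auto simp: sym_unit_def transpose_def vec_eq_iff)

lemma symm_add: "r \<in> symm \<Longrightarrow> r' \<in> symm \<Longrightarrow> r + r' \<in> symm"
  by (auto simp: transpose_def vec_eq_iff)

lemma symm_scale: "r \<in> symm \<Longrightarrow> c *\<^sub>R r \<in> symm"
  by (auto simp: transpose_def vec_eq_iff)

lemma symm_sum: "(\<And>i. i \<in> A \<Longrightarrow> h i \<in> symm) \<Longrightarrow> sum h A \<in> symm"
  by (induction A rule: infinite_finite_induct) (auto intro: symm_add simp: transpose_def vec_eq_iff)

lemma sym_unit_commute: "sym_unit i j = sym_unit j i"
  by (auto simp: sym_unit_def vec_eq_iff)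

lemma sym_partial_commute: "sym_partial i j = sym_partial j i"
  by (simp add: sym_partial_def fun_eq_iff sym_unit_commute)

lemma pos_def_cone_subset_symm: "pos_def_cone \<subseteq> symm"
  by (auto simp: pos_def_cone_def)

lemma sym_partials_Nil: "sym_partials [] f = f"
  by (simp add: sym_partials_def)

lemma sym_partials_Cons: "sym_partials ((i, j) # ps) f = sym_partial i j (sym_partials ps f)"
  by (simp add: sym_partials_def)

lemma sym_partials_append: "sym_partials (ps @ qs) f = sym_partials ps (sym_partials qs f)"
  by (simp add: sym_partials_def)

lemma has_sym_partial_zero:
  assumes K: "closed K" "\<And>r. r \<notin> K \<Longrightarrow> g r = 0" and r: "r \<notin> K"
  shows "((\<lambda>t. g (r + t *\<^sub>R sym_unit i j)) has_vector_derivative 0) (at 0)"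
proof -
  let ?T = "(\<lambda>t::real. r + t *\<^sub>R sym_unit i j) -` (- K)"
  have o: "open ?T" using K(1) by (intro open_vimage continuous_intros) auto
  have 0: "0 \<in> ?T" using r by simp
  have "0 = g (r + t *\<^sub>R sym_unit i j)" if "t \<in> ?T" for t
    using that by (simp add: K(2))
  from has_vector_derivative_transform_within_open[OF has_vector_derivative_const o 0 this]
  show ?thesis .
qed

text \<open>A single \<open>K\<close> serves all derivatives: it is closed in the space of all
  matrices, so a function vanishing off \<open>K\<close> vanishes near each point off
  \<open>K\<close>, and so do its difference quotients.\<close>

lemma test_function_support:
  assumes "f \<in> test_functions"
  obtains K where "compact K" "K \<subseteq> pos_def_cone" "\<And>ps r. r \<notin> K \<Longrightarrow> sym_partials ps f r = 0"
proof -
  from assms obtain K where K: "compact K" "K \<subseteq> pos_def_cone" "\<And>r. r \<notin> K \<Longrightarrow> f r = 0"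
    by (auto simp: test_functions_def)
  have "\<forall>r. r \<notin> K \<longrightarrow> sym_partials ps f r = 0" for ps
  proof (induction ps)
    case Nil
    then show ?case using K(3) by (simp add: sym_partials_Nil)
  next
    case (Cons p ps)
    obtain i j where p: "p = (i, j)" by force
    show ?case
    proof (intro allI impI)
      fix r assume r: "r \<notin> K"
      have "((\<lambda>t. sym_partials ps f (r + t *\<^sub>R sym_unit i j)) has_vector_derivative 0) (at 0)"
        using Cons r by (intro has_sym_partial_zero[OF compact_imp_closed[OF K(1)]]) auto
      then show "sym_partials (p # ps) f r = 0"
        unfolding p sym_partials_Cons sym_partial_def by (rule vector_derivative_at)
    qed
  qed
  then show ?thesis using that K by blast
qed

text \<open>Valid at every matrix: inside the cone by smoothness, outside because \<open>f\<close>
  vanishes nearby. Later differentiations thus need no distinction of cases.\<close>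

lemma has_sym_partial_0:
  assumes "f \<in> test_functions"
  shows "((\<lambda>t. f (r + t *\<^sub>R sym_unit i j)) has_vector_derivative sym_partial i j f r) (at 0)"
proof (cases "r \<in> pos_def_cone")
  case True
  have "\<forall>ps. \<forall>i j. \<forall>r\<in>pos_def_cone. (\<lambda>t. sym_partials ps f (r + t *\<^sub>R sym_unit i j)) differentiable at 0"
    using assms by (auto simp: test_functions_def smooth_on_cone_def)
  then have "(\<lambda>t. sym_partials [] f (r + t *\<^sub>R sym_unit i j)) differentiable at 0"
    using True by blast
  then show ?thesis
    unfolding sym_partials_Nil sym_partial_def using vector_derivative_works by blast
next
  case False
  obtain K where K: "compact K" "K \<subseteq> pos_def_cone" "\<And>ps r. r \<notin> K \<Longrightarrow> sym_partials ps f r = 0"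
    using test_function_support[OF assms] by metis
  have "((\<lambda>t. f (r + t *\<^sub>R sym_unit i j)) has_vector_derivative 0) (at 0)"
    using K(2) K(3)[of _ "[]"] False
    by (intro has_sym_partial_zero[OF compact_imp_closed[OF K(1)]]) (auto simp: sym_partials_Nil)
  then show ?thesis unfolding sym_partial_def using vector_derivative_at by force
qed

lemma has_sym_partial:
  assumes "f \<in> test_functions"
  shows "((\<lambda>t. f (r + t *\<^sub>R sym_unit i j)) has_vector_derivative sym_partial i j f (r + t *\<^sub>R sym_unit i j)) (at t)"
proof -
  have "((\<lambda>x. f ((r + t *\<^sub>R sym_unit i j) + (- t + x) *\<^sub>R sym_unit i j)) has_vector_derivative sym_partial i j f (r + t *\<^sub>R sym_unit i j)) (at t)"
  proof -
    have "((\<lambda>x. - t + x) has_vector_derivative 1) (at t)" by (auto intro!: derivative_eq_intros)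
    from vector_diff_chain_at[OF this, of "\<lambda>x. f ((r + t *\<^sub>R sym_unit i j) + x *\<^sub>R sym_unit i j)"] has_sym_partial_0[OF assms]
    show ?thesis by (simp add: o_def)
  qed
  moreover have "(\<lambda>x. f ((r + t *\<^sub>R sym_unit i j) + (- t + x) *\<^sub>R sym_unit i j)) = (\<lambda>x. f (r + x *\<^sub>R sym_unit i j))"
    by (simp add: algebra_simps)
  ultimately show ?thesis by (simp only:)
qed

lemma test_function_partials:
  assumes "f \<in> test_functions"
  shows "sym_partials ps f \<in> test_functions"
proof -
  obtain K where K: "compact K" "K \<subseteq> pos_def_cone" "\<And>ps r. r \<notin> K \<Longrightarrow> sym_partials ps f r = 0"
    using test_function_support[OF assms] by metis
  have "smooth_on_cone (sym_partials ps f)"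
    using assms unfolding test_functions_def smooth_on_cone_def sym_partials_append[symmetric] by blast
  moreover have "\<forall>r. r \<notin> K \<longrightarrow> sym_partials ps f r = 0" using K(3) by blast
  ultimately show ?thesis unfolding test_functions_def using K(1,2) by blast
qed

lemma test_function_partial:
  "f \<in> test_functions \<Longrightarrow> sym_partial i j f \<in> test_functions"
  using test_function_partials[of f "[(i, j)]"] by (simp add: sym_partials_Cons sym_partials_Nil)

text \<open>Relative to the symmetric matrices, the cone and the complement of the support are open
  and cover everything. Continuity on all matrices would fail in general, since the extension is
  zero at every non-symmetric matrix.\<close>

lemma test_function_continuous:
  fixes f :: "real^'m^'m \<Rightarrow> complex"
  assumes "f \<in> test_functions"
  shows "continuous_on symm f"
proof -
  obtain K where K: "compact K" "K \<subseteq> pos_def_cone" "\<And>ps r. r \<notin> K \<Longrightarrow> sym_partials ps f r = 0"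
    using test_function_support[OF assms] by metis
  have f0: "f r = 0" if "r \<notin> K" for r using K(3)[OF that, of "[]"] by (simp add: sym_partials_Nil)
  have c1: "continuous_on pos_def_cone f"
  proof -
    have "\<forall>ps. continuous_on pos_def_cone (sym_partials ps f)"
      using assms unfolding test_functions_def smooth_on_cone_def by blast
    from this[rule_format, of "[]"] show ?thesis by (simp only: sym_partials_Nil)
  qed
  have c2: "continuous_on (symm - K) f"
    using f0 by (subst continuous_on_cong[OF refl, of _ _ "\<lambda>_. 0"]) auto
  have un: "symm = pos_def_cone \<union> (symm - K)" using K(2) pos_def_cone_subset_symm by auto
  obtain U :: "(real^'m^'m) set" where U: "open U" "pos_def_cone = symm \<inter> U" using pos_def_cone_eq by blast
  have o1: "openin (top_of_set symm) (pos_def_cone :: (real^'m^'m) set)" unfolding U(2) by (rule openin_open_Int[OF U(1)])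
  have o2: "openin (top_of_set symm) (symm - K)"
    unfolding Diff_eq by (rule openin_open_Int[OF open_Compl[OF compact_imp_closed[OF K(1)]]])
  have "continuous_on (pos_def_cone \<union> (symm - K)) f"
    by (rule continuous_on_Un_local_open[OF _ _ c1 c2]) (simp_all only: un[symmetric] o1 o2)
  then show ?thesis by (simp only: un[symmetric])
qed

lemma test_function_lin:
  fixes f g :: "real^'m^'m \<Rightarrow> complex"
  assumes f: "f \<in> test_functions" and g: "g \<in> test_functions"
  shows "(\<lambda>r. c * f r + g r) \<in> test_functions"
    and "sym_partial i j (\<lambda>r. c * f r + g r) = (\<lambda>r. c * sym_partial i j f r + sym_partial i j g r)"
proof -
  have P: "sym_partial i j (\<lambda>r. c * f r + g r) = (\<lambda>r. c * sym_partial i j f r + sym_partial i j g r)"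
    if f: "f \<in> test_functions" and g: "g \<in> test_functions" for i j and f g :: "real^'m^'m \<Rightarrow> complex"
  proof
    fix r
    have "((\<lambda>t. c * f (r + t *\<^sub>R sym_unit i j) + g (r + t *\<^sub>R sym_unit i j)) has_vector_derivative
      c * sym_partial i j f r + sym_partial i j g r) (at 0)"
      by (intro has_vector_derivative_add has_vector_derivative_mult_right has_sym_partial_0 f g)
    then show "sym_partial i j (\<lambda>r. c * f r + g r) r = c * sym_partial i j f r + sym_partial i j g r"
      unfolding sym_partial_def by (rule vector_derivative_at)
  qed
  show "sym_partial i j (\<lambda>r. c * f r + g r) = (\<lambda>r. c * sym_partial i j f r + sym_partial i j g r)"
    by (rule P[OF f g])
  have Ps: "sym_partials ps (\<lambda>r. c * f r + g r) = (\<lambda>r. c * sym_partials ps f r + sym_partials ps g r)" for ps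
  proof (induction ps)
    case Nil
    then show ?case by (simp add: sym_partials_Nil)
  next
    case (Cons p ps)
    obtain i j where p: "p = (i, j)" by force
    show ?case unfolding p sym_partials_Cons Cons.IH
      by (rule P[OF test_function_partials[OF f] test_function_partials[OF g]])
  qed
  obtain K where K: "compact K" "K \<subseteq> pos_def_cone" "\<And>ps r. r \<notin> K \<Longrightarrow> sym_partials ps f r = 0"
    using test_function_support[OF f] by metis
  obtain L where L: "compact L" "L \<subseteq> pos_def_cone" "\<And>ps r. r \<notin> L \<Longrightarrow> sym_partials ps g r = 0"
    using test_function_support[OF g] by metis
  have "smooth_on_cone (\<lambda>r. c * f r + g r)"
    unfolding smooth_on_cone_def Ps
  proof (intro allI conjI ballI)
    fix ps
    show "continuous_on pos_def_cone (\<lambda>r. c * sym_partials ps f r + sym_partials ps g r)"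
    proof (intro continuous_intros)
      show "continuous_on pos_def_cone (sym_partials ps f)" "continuous_on pos_def_cone (sym_partials ps g)"
        using f g unfolding test_functions_def smooth_on_cone_def by blast+
    qed
    fix i j r
    have "((\<lambda>t. c * sym_partials ps f (r + t *\<^sub>R sym_unit i j) + sym_partials ps g (r + t *\<^sub>R sym_unit i j))
      has_vector_derivative c * sym_partial i j (sym_partials ps f) r + sym_partial i j (sym_partials ps g) r) (at 0)"
      by (intro has_vector_derivative_add has_vector_derivative_mult_right
          has_sym_partial_0 test_function_partials f g)
    then show "(\<lambda>t. c * sym_partials ps f (r + t *\<^sub>R sym_unit i j) + sym_partials ps g (r + t *\<^sub>R sym_unit i j)) differentiable at 0"
      by (rule differentiableI_vector)
  qed
  moreover have "compact (K \<union> L)" "K \<union> L \<subseteq> pos_def_cone" using K L by auto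
  moreover have "c * f r + g r = 0" if "r \<notin> K \<union> L" for r
    using K(3)[of r "[]"] L(3)[of r "[]"] that by (simp add: sym_partials_Nil)
  ultimately show "(\<lambda>r. c * f r + g r) \<in> test_functions"
    unfolding test_functions_def by blast
qed

text \<open>Through a symmetric matrix the plane spanned by the two directions stays symmetric, so
  all partials are continuous on it and \<open>mixed_partials_eq\<close> applies. At other matrices
  both sides vanish.\<close>

lemma sym_partial_swap:
  assumes f: "f \<in> test_functions"
  shows "sym_partial i j (sym_partial k l f) = sym_partial k l (sym_partial i j f)"
proof
  fix r
  show "sym_partial i j (sym_partial k l f) r = sym_partial k l (sym_partial i j f) r"
  proof (cases "r \<in> symm")
    case False
    obtain K where K: "compact K" "K \<subseteq> pos_def_cone" "\<And>ps r. r \<notin> K \<Longrightarrow> sym_partials ps f r = 0"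
      using test_function_support[OF f] by metis
    have "r \<notin> K" using False K(2) pos_def_cone_subset_symm by blast
    from K(3)[OF this, of "[(i, j), (k, l)]"] K(3)[OF this, of "[(k, l), (i, j)]"]
    show ?thesis by (simp add: sym_partials_Cons sym_partials_Nil)
  next
    case True
    let ?p = "\<lambda>u v. (r + v *\<^sub>R sym_unit i j) + u *\<^sub>R sym_unit k l"
    have p': "?p u v = (r + u *\<^sub>R sym_unit k l) + v *\<^sub>R sym_unit i j" for u v by simp
    have sy: "?p u v \<in> symm" for u v
      using True by (intro symm_add symm_scale sym_unit_symm)
    have c: "continuous_on UNIV (\<lambda>(u, v). h (?p u v))" if "h \<in> test_functions" for h :: "_ \<Rightarrow> complex"
      unfolding split_beta
      by (rule continuous_on_compose2[OF test_function_continuous[OF that]]) (use sy in \<open>auto intro!: continuous_intros\<close>)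
    have "sym_partial i j (sym_partial k l f) (?p 0 0) = sym_partial k l (sym_partial i j f) (?p 0 0)"
    proof (rule mixed_partials_eq[of "\<lambda>u v. f (?p u v)" "\<lambda>u v. sym_partial k l f (?p u v)" "\<lambda>u v. sym_partial i j f (?p u v)"
        "\<lambda>u v. sym_partial i j (sym_partial k l f) (?p u v)" "\<lambda>u v. sym_partial k l (sym_partial i j f) (?p u v)"])
      fix u v
      show "((\<lambda>u. f (?p u v)) has_vector_derivative sym_partial k l f (?p u v)) (at u)"
        by (rule has_sym_partial[OF f])
      show "((\<lambda>v. f (?p u v)) has_vector_derivative sym_partial i j f (?p u v)) (at v)"
        unfolding p' by (rule has_sym_partial[OF f])
      show "((\<lambda>u. sym_partial i j f (?p u v)) has_vector_derivative sym_partial k l (sym_partial i j f) (?p u v)) (at u)"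
        by (rule has_sym_partial[OF test_function_partial[OF f]])
      show "((\<lambda>v. sym_partial k l f (?p u v)) has_vector_derivative sym_partial i j (sym_partial k l f) (?p u v)) (at v)"
        unfolding p' by (rule has_sym_partial[OF test_function_partial[OF f]])
      show "continuous_on UNIV (\<lambda>(u, v). sym_partial k l f (?p u v))"
        by (rule c[OF test_function_partial[OF f]])
      show "continuous_on UNIV (\<lambda>(u, v). sym_partial i j (sym_partial k l f) (?p u v))"
        by (rule c[OF test_function_partial[OF test_function_partial[OF f]]])
    qed
    then show ?thesis by simp
  qed
qed

lemma sym_partials_mset:
  assumes f: "f \<in> test_functions" and "mset ps = mset qs"
  shows "sym_partials ps f = sym_partials qs f"
  using assms(2)
proof (induction ps arbitrary: qs)
  case Nil
  then show ?case by simp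
next
  case (Cons x ps)
  then have "x \<in> set qs" by (metis list.set_intros(1) set_mset_mset)
  then obtain as bs where qs: "qs = as @ x # bs" by (meson split_list)
  obtain i j where x: "x = (i, j)" by force
  have mv: "sym_partials (as @ [x]) h = sym_partials (x # as) h" if h: "h \<in> test_functions" for h
  proof (induction as)
    case (Cons y as)
    obtain k l where y: "y = (k, l)" by force
    show ?case
      using Cons sym_partial_swap[OF test_function_partials[OF h, of as], of k l i j]
      unfolding x y by (simp add: sym_partials_Cons)
  qed simp
  have "mset ps = mset (as @ bs)" using Cons.prems qs by simp
  from Cons.IH[OF this] have "sym_partials (x # ps) f = sym_partials (x # as @ bs) f"
    unfolding x sym_partials_Cons by simp
  also have "\<dots> = sym_partials (x # as) (sym_partials bs f)" by (simp add: sym_partials_append[symmetric])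
  also have "\<dots> = sym_partials (as @ [x]) (sym_partials bs f)" by (rule mv[OF test_function_partials[OF f], symmetric])
  also have "\<dots> = sym_partials qs f" unfolding qs by (simp add: sym_partials_append[symmetric])
  finally show ?case .
qed

text \<open>Only partial derivatives along symmetric directions are given, so the chain rule is
  built up one direction at a time: freeze the new coordinate, use the induction hypothesis in
  \<open>t\<close>, and combine this with the continuous partial derivative in the new
  coordinate.\<close>

lemma test_function_chain:
  assumes "finite J" and f: "f \<in> test_functions" and A: "A \<in> symm"
    and "\<And>j. j \<in> J \<Longrightarrow> (\<gamma> j has_real_derivative \<gamma>' j) (at x)"
  shows "((\<lambda>t. f (A + (\<Sum>j\<in>J. \<gamma> j t *\<^sub>R sym_unit i j))) has_vector_derivative
    (\<Sum>j\<in>J. \<gamma>' j *\<^sub>R sym_partial i j f (A + (\<Sum>j\<in>J. \<gamma> j x *\<^sub>R sym_unit i j)))) (at x)"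
  using assms(1,3,4)
proof (induction J arbitrary: A rule: finite_induct)
  case empty
  then show ?case by simp
next
  case (insert a J)
  let ?c = "\<lambda>t y. (A + y *\<^sub>R sym_unit i a) + (\<Sum>j\<in>J. \<gamma> j t *\<^sub>R sym_unit i j)"
  let ?P = "\<lambda>t y. sym_partial i a f (?c t y)"
  have sy: "?c t y \<in> symm" for t y
    using insert.prems(1) by (intro symm_add symm_scale symm_sum sym_unit_symm)
  have c': "?c t y = (A + (\<Sum>j\<in>J. \<gamma> j t *\<^sub>R sym_unit i j)) + y *\<^sub>R sym_unit i a" for t y by simp
  let ?D = "\<Sum>j\<in>J. \<gamma>' j *\<^sub>R sym_partial i j f (?c x (\<gamma> a x))"
  have fx: "((\<lambda>t. f (?c t (\<gamma> a x))) has_derivative (\<lambda>h. h *\<^sub>R ?D)) (at x within UNIV)"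
  proof -
    have "A + \<gamma> a x *\<^sub>R sym_unit i a \<in> symm"
      by (intro symm_add symm_scale sym_unit_symm insert.prems(1))
    from insert.IH[OF this] insert.prems(2) show ?thesis
      by (simp add: has_vector_derivative_def)
  qed
  have fy: "((\<lambda>y. f (?c t y)) has_derivative blinfun_apply (blinfun_scaleR_left (?P t y))) (at y within UNIV)" for t y
    using has_sym_partial[OF f, of "A + (\<Sum>j\<in>J. \<gamma> j t *\<^sub>R sym_unit i j)" i a y]
    unfolding c' by (simp add: has_vector_derivative_def)
  have cont: "continuous (at (x, \<gamma> a x) within UNIV \<times> UNIV) (\<lambda>(t, y). blinfun_scaleR_left (?P t y))"
  proof -
    have "isCont (\<lambda>z. ?c (fst z) (snd z)) (x, \<gamma> a x)"
      using insert.prems(2)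
      by (intro continuous_intros isCont_o2[where g="\<gamma> _" and f=fst]) (auto intro: DERIV_isCont)
    then have c: "((\<lambda>z. ?c (fst z) (snd z)) \<longlongrightarrow> ?c x (\<gamma> a x)) (at (x, \<gamma> a x))"
      by (simp add: isCont_def)
    have cf: "continuous_on symm (sym_partial i a f)"
      by (rule test_function_continuous[OF test_function_partial[OF f]])
    have "((\<lambda>z. ?P (fst z) (snd z)) \<longlongrightarrow> ?P x (\<gamma> a x)) (at (x, \<gamma> a x))"
      using continuous_on_tendsto_compose[OF cf c] sy
      by simp
    then have "isCont (\<lambda>z. ?P (fst z) (snd z)) (x, \<gamma> a x)" by (simp add: isCont_def)
    then show ?thesis
      unfolding split_beta by (auto intro!: continuous_intros)
  qed
  have "((\<lambda>(t, y). f (?c t y)) has_derivative (\<lambda>(tx, ty). tx *\<^sub>R ?D + blinfun_apply (blinfun_scaleR_left (?P x (\<gamma> a x))) ty)) (at (x, \<gamma> a x) within UNIV \<times> UNIV)"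
    by (rule has_derivative_partialsI[OF fx fy cont]) auto
  then have F: "((\<lambda>(t, y). f (?c t y)) has_derivative (\<lambda>(tx, ty). tx *\<^sub>R ?D + ty *\<^sub>R ?P x (\<gamma> a x))) (at (x, \<gamma> a x))"
    by simp
  have G: "((\<lambda>t. (t, \<gamma> a t)) has_derivative (\<lambda>h. (h, h * \<gamma>' a))) (at x)"
    using insert.prems(2)[of a] by (intro derivative_intros) (auto simp: has_field_derivative_def mult_commute_abs)
  have "((\<lambda>t. f (?c t (\<gamma> a t))) has_derivative (\<lambda>h. h *\<^sub>R ?D + (h * \<gamma>' a) *\<^sub>R ?P x (\<gamma> a x))) (at x)"
    using has_derivative_compose[OF G F] by simp
  then have "((\<lambda>t. f (?c t (\<gamma> a t))) has_vector_derivative (\<gamma>' a *\<^sub>R ?P x (\<gamma> a x) + ?D)) (at x)"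
    unfolding has_vector_derivative_def by (simp add: scaleR_add_right add.commute)
  then show ?case
    using insert.hyps by (simp add: add.assoc)
qed

subsection \<open>The determinant operator\<close>

lemma test_function_sum:
  fixes f :: "real^'m^'m \<Rightarrow> complex" and h :: "'i \<Rightarrow> real^'m^'m \<Rightarrow> complex"
  assumes "finite A" and "\<And>a. a \<in> A \<Longrightarrow> h a \<in> test_functions" and "f \<in> test_functions"
  shows "(\<lambda>r. \<Sum>a\<in>A. c a * h a r) \<in> test_functions \<and>
    sym_partial i j (\<lambda>r. \<Sum>a\<in>A. c a * h a r) = (\<lambda>r. \<Sum>a\<in>A. c a * sym_partial i j (h a) r)"
  using assms(1,2)
proof (induction A rule: finite_induct)
  case empty
  from test_function_lin[OF assms(3,3), where c = "-1"] show ?case by simp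
next
  case (insert a A)
  then have h: "h a \<in> test_functions" and s: "(\<lambda>r. \<Sum>a\<in>A. c a * h a r) \<in> test_functions" by auto
  from test_function_lin[OF h s, where c = "c a"] insert show ?case by simp
qed

text \<open>An arbitrary enumeration; by \<open>sym_partials_mset\<close> the derivative does not
  depend on it.\<close>

definition mset_list :: "'a multiset \<Rightarrow> 'a list" where
  "mset_list M = (SOME xs. mset xs = M)"

lemma mset_mset_list [simp]: "mset (mset_list M) = M"
  unfolding mset_list_def by (rule someI_ex[OF ex_mset])

lemma mset_list_empty [simp]: "mset_list {#} = []"
  by (metis mset_mset_list mset_zero_iff)

text \<open>Polynomials in commuting variables \<open>\<partial>\<^sub>i\<^sub>j\<close>, acting on test functions.\<close>

definition diff_op :: "(('m \<times> 'm) multiset \<Rightarrow>\<^sub>0 real) \<Rightarrow> (real^'m^'m \<Rightarrow> complex) \<Rightarrow> (real^'m^'m \<Rightarrow> complex)" where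
  "diff_op P f = (\<lambda>r. \<Sum>M\<in>Poly_Mapping.keys P. of_real (Poly_Mapping.lookup P M) * sym_partials (mset_list M) f r)"

lemma diff_op_superset:
  assumes "finite A" "Poly_Mapping.keys P \<subseteq> A"
  shows "diff_op P f r = (\<Sum>M\<in>A. of_real (Poly_Mapping.lookup P M) * sym_partials (mset_list M) f r)"
  unfolding diff_op_def using assms by (intro sum.mono_neutral_left) (auto simp: in_keys_iff)

lemma diff_op_add: "diff_op (P + Q) f r = diff_op P f r + diff_op Q f r"
proof -
  let ?A = "Poly_Mapping.keys P \<union> Poly_Mapping.keys Q"
  have "Poly_Mapping.keys (P + Q) \<subseteq> ?A" by (rule Poly_Mapping.keys_add)
  then show ?thesis
    by (subst (1 2 3) diff_op_superset[of ?A]) (auto simp: lookup_add distrib_right sum.distrib)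
qed

lemma diff_op_zero [simp]: "diff_op 0 f r = 0"
  by (simp add: diff_op_def)

lemma diff_op_sum: "diff_op (\<Sum>a\<in>A. h a) f r = (\<Sum>a\<in>A. diff_op (h a) f r)"
  by (induction A rule: infinite_finite_induct) (simp_all add: diff_op_add)

lemma diff_op_uminus: "diff_op (- P) f r = - diff_op P f r"
  using diff_op_add[of P "- P" f r] by (simp add: add_eq_0_iff)

lemma diff_op_single: "diff_op (Poly_Mapping.single M c) f r = of_real c * sym_partials (mset_list M) f r"
  by (subst diff_op_superset[of "{M}"]) auto

lemma diff_op_one [simp]: "diff_op 1 f = f"
proof
  fix r
  have "diff_op (Poly_Mapping.single 0 1) f r = f r"
    unfolding diff_op_single by (simp add: sym_partials_Nil flip: zero_multiset_def)
  then show "diff_op 1 f r = f r" by simp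
qed

lemma diff_op_test_function:
  assumes "f \<in> test_functions"
  shows "diff_op P f \<in> test_functions"
  unfolding diff_op_def
  using test_function_sum[OF _ test_function_partials[OF assms] assms, of "Poly_Mapping.keys P"
      "\<lambda>M. of_real (Poly_Mapping.lookup P M)" mset_list] by simp

lemma sum_singles: "(\<Sum>M\<in>Poly_Mapping.keys P. Poly_Mapping.single M (Poly_Mapping.lookup P M)) = P"
proof (rule poly_mapping_eqI)
  fix N
  have "Poly_Mapping.lookup (\<Sum>M\<in>Poly_Mapping.keys P. Poly_Mapping.single M (Poly_Mapping.lookup P M)) N =
    (\<Sum>M\<in>Poly_Mapping.keys P. if M = N then Poly_Mapping.lookup P M else 0)"
    unfolding lookup_sum by (intro sum.cong) (auto simp: lookup_single when_def)
  also have "\<dots> = Poly_Mapping.lookup P N"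
    by (simp add: sum.delta in_keys_iff)
  finally show "Poly_Mapping.lookup (\<Sum>M\<in>Poly_Mapping.keys P. Poly_Mapping.single M (Poly_Mapping.lookup P M)) N = Poly_Mapping.lookup P N" .
qed

abbreviation var :: "'m \<Rightarrow> 'm \<Rightarrow> real \<Rightarrow> ('m \<times> 'm) multiset \<Rightarrow>\<^sub>0 real" where
  "var i j c \<equiv> Poly_Mapping.single {#(i, j)#} c"

text \<open>This makes \<open>diff_op\<close> an action of the polynomial ring: identities between
  polynomials turn into identities between differential operators.\<close>

lemma diff_op_var_mult:
  assumes f: "f \<in> test_functions"
  shows "diff_op (var i j c * P) f = (\<lambda>r. of_real c * sym_partial i j (diff_op P f) r)"
proof
  fix r
  let ?K = "Poly_Mapping.keys P" and ?l = "Poly_Mapping.lookup P"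
  have sp: "sym_partials (mset_list ({#(i, j)#} + M)) f = sym_partial i j (sym_partials (mset_list M) f)" for M
    unfolding sym_partials_Cons[symmetric] by (rule sym_partials_mset[OF f]) simp
  have "var i j c * P = (\<Sum>M\<in>?K. Poly_Mapping.single ({#(i, j)#} + M) (c * ?l M))"
    by (subst (1) sum_singles[of P, symmetric]) (simp only: sum_distrib_left mult_single)
  then have "diff_op (var i j c * P) f r = (\<Sum>M\<in>?K. of_real (c * ?l M) * sym_partial i j (sym_partials (mset_list M) f) r)"
    by (simp only: diff_op_sum diff_op_single sp)
  also have "\<dots> = of_real c * (\<Sum>M\<in>?K. of_real (?l M) * sym_partial i j (sym_partials (mset_list M) f) r)"
    by (simp add: sum_distrib_left mult.assoc)
  also have "(\<Sum>M\<in>?K. of_real (?l M) * sym_partial i j (sym_partials (mset_list M) f) r) = sym_partial i j (diff_op P f) r"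
    unfolding diff_op_def
    using test_function_sum[OF _ test_function_partials[OF f] f, of ?K "\<lambda>M. of_real (?l M)" mset_list i j] by simp
  finally show "diff_op (var i j c * P) f r = of_real c * sym_partial i j (diff_op P f) r" .
qed

definition op_mat :: "'m set \<Rightarrow> (('m \<times> 'm) multiset \<Rightarrow>\<^sub>0 real)^'m::finite^'m" where
  "op_mat S = (\<chi> i j. if i \<in> S \<and> j \<in> S then var i j (eta i j) else if i = j then 1 else 0)"

lemma diff_op_foldr:
  assumes f: "f \<in> test_functions"
  shows "diff_op (prod_list (map (\<lambda>i. var i (p i) (eta i (p i))) xs)) f =
    foldr (\<lambda>i g r. eta i (p i) *\<^sub>R sym_partial i (p i) g r) xs f"
  by (induction xs) (simp_all add: diff_op_var_mult[OF f] scaleR_conv_of_real del: of_real_eq_0_iff)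

text \<open>Each ordered composition in \<open>D_minus\<close> is the action of a monomial, so the
  Leibniz sum becomes the action of a genuine determinant, to which row expansion applies.\<close>

lemma D_minus_eq_diff_op:
  fixes f :: "real^'m::{finite,wellorder}^'m::_ \<Rightarrow> complex"
  assumes f: "f \<in> test_functions"
  shows "D_minus f r = (- 1) ^ CARD('m) * diff_op (det (op_mat UNIV)) f r"
proof -
  have "diff_op (of_int (sign p) * (\<Prod>i\<in>UNIV. op_mat UNIV $ i $ p i)) f r =
    of_int (sign p) * foldr (\<lambda>i g r. eta i (p i) *\<^sub>R sym_partial i (p i) g r) (sorted_list_of_set UNIV) f r" for p :: "'m \<Rightarrow> 'm"
  proof -
    have "(\<Prod>i\<in>UNIV. op_mat UNIV $ i $ p i) = prod_list (map (\<lambda>i. var i (p i) (eta i (p i))) (sorted_list_of_set UNIV))"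
      by (subst prod.distinct_set_conv_list[symmetric]) (simp_all add: op_mat_def)
    then have "diff_op (\<Prod>i\<in>UNIV. op_mat UNIV $ i $ p i) f = foldr (\<lambda>i g r. eta i (p i) *\<^sub>R sym_partial i (p i) g r) (sorted_list_of_set UNIV) f"
      using diff_op_foldr[OF f] by simp
    moreover have "sign p = 1 \<or> sign p = - 1" by (simp add: sign_def)
    ultimately show ?thesis by (elim disjE) (simp_all add: diff_op_uminus)
  qed
  then show ?thesis unfolding det_def D_minus_def diff_op_sum by simp
qed

lemma D_minus_test_function:
  fixes f :: "real^'m::{finite,wellorder}^'m::_ \<Rightarrow> complex"
  assumes f: "f \<in> test_functions"
  shows "D_minus f \<in> test_functions"
proof -
  have "D_minus f = (\<lambda>r. (- 1) ^ CARD('m) * diff_op (det (op_mat UNIV)) f r + diff_op 0 f r)"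
    by (simp add: fun_eq_iff D_minus_eq_diff_op[OF f])
  then show ?thesis
    using test_function_lin(1)[OF diff_op_test_function[OF f, of "det (op_mat UNIV)"] diff_op_test_function[OF f, of 0],
        where c = "(- 1) ^ CARD('m)"] by simp
qed

text \<open>The cofactor of entry \<open>(a, i)\<close>, written as a determinant of full size with
  row \<open>a\<close> replaced by a unit vector, so that no submatrix type is needed.\<close>

definition cof :: "'m set \<Rightarrow> 'm \<Rightarrow> 'm \<Rightarrow> ('m::finite \<times> 'm) multiset \<Rightarrow>\<^sub>0 real" where
  "cof S a i = det (\<chi> k. if k = a then axis i 1 else op_mat S $ k)"

text \<open>Both sides are the determinant of \<open>op_mat S\<close> with row \<open>a\<close> replaced by row \<open>j\<close>.\<close>

lemma cof_expand:
  assumes "a \<in> S" "j \<in> S"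
  shows "(\<Sum>i\<in>S. var j i (eta j i) * cof S a i) = (if j = a then det (op_mat S) else 0)"
proof -
  let ?G = "op_mat S"
  have row: "(\<Sum>i\<in>S. var j i (eta j i) *s axis i 1) = ?G $ j"
  proof -
    have "(\<Sum>i\<in>S. var j i (eta j i) *s axis i 1) $ l = ?G $ j $ l" for l
      using assms(2) by (auto simp: op_mat_def axis_def if_distrib[of "\<lambda>x. _ * x"] sum.delta' cong: if_cong)
    then show ?thesis by (simp add: vec_eq_iff)
  qed
  have "(\<Sum>i\<in>S. var j i (eta j i) * cof S a i) =
    (\<Sum>i\<in>S. det (\<chi> k. if k = a then var j i (eta j i) *s axis i 1 else ?G $ k))"
    unfolding cof_def by (simp add: det_row_mul)
  also have "\<dots> = det (\<chi> k. if k = a then (\<Sum>i\<in>S. var j i (eta j i) *s axis i 1) else ?G $ k)"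
    by (rule det_linear_row_sum[symmetric]) simp
  also have "\<dots> = det (\<chi> k. if k = a then ?G $ j else ?G $ k)" unfolding row ..
  also have "\<dots> = (if j = a then det ?G else 0)"
  proof (cases "j = a")
    case True
    then have "(\<chi> k. if k = a then ?G $ j else ?G $ k) = ?G" by (simp add: vec_eq_iff)
    then show ?thesis using True by simp
  next
    case False
    then have "det (\<chi> k. if k = a then ?G $ j else ?G $ k) = 0"
      by (intro det_identical_rows[OF False]) (simp add: row_def)
    then show ?thesis using False by simp
  qed
  finally show ?thesis .
qed

text \<open>Compare Leibniz terms: permutations fixing \<open>a\<close> give equal products, and all
  others give zero on both sides.\<close>

lemma cof_diag:
  assumes "a \<notin> T"
  shows "cof (insert a T) a a = det (op_mat T)"
proof -
  let ?A = "(\<chi> k. if k = a then axis a 1 else op_mat (insert a T) $ k) :: (('a \<times> 'a) multiset \<Rightarrow>\<^sub>0 real)^'a^'a"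
  have "(\<Prod>i\<in>UNIV. ?A $ i $ p i) = (\<Prod>i\<in>UNIV. op_mat T $ i $ p i)" if p: "p permutes UNIV" for p
  proof (cases "p a = a")
    case True
    then have "p i \<noteq> a" if "i \<noteq> a" for i using p that permutes_inj[OF p] by (metis injD)
    then show ?thesis
      using assms True by (intro prod.cong refl) (auto simp: op_mat_def axis_def)
  next
    case False
    have 1: "?A $ a $ p a = 0" using False by (simp add: axis_def)
    have 2: "op_mat T $ a $ p a = 0" using False assms by (simp add: op_mat_def)
    have "(\<Prod>i\<in>UNIV. ?A $ i $ p i) = 0" using 1 by (intro prod_zero bexI[of _ a]) simp_all
    moreover have "(\<Prod>i\<in>UNIV. op_mat T $ i $ p i) = 0" using 2 by (intro prod_zero bexI[of _ a]) simp_all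
    ultimately show ?thesis by simp
  qed
  then show ?thesis unfolding cof_def det_def by (intro sum.cong refl) auto
qed

subsection \<open>Gram matrices with two rows\<close>

text \<open>Although \<open>f\<close> is continuous only on symmetric matrices, it equals its
  restriction to a compact set extended by zero, which is Borel on all matrices.\<close>

lemma test_function_measurable:
  fixes f :: "real^'m^'m \<Rightarrow> complex"
  assumes f: "f \<in> test_functions"
  shows "f \<in> borel_measurable borel"
proof -
  obtain K where K: "compact K" "K \<subseteq> pos_def_cone" "\<And>ps r. r \<notin> K \<Longrightarrow> sym_partials ps f r = 0"
    using test_function_support[OF f] by metis
  have c: "continuous_on K f"
    using continuous_on_subset[OF test_function_continuous[OF f]] K(2) pos_def_cone_subset_symm by blast
  have "(\<lambda>r. indicator K r *\<^sub>R f r) \<in> borel_measurable borel"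
    using K(1) by (intro borel_measurable_continuous_on_indicator c borel_closed compact_imp_closed)
  moreover have "indicator K r *\<^sub>R f r = f r" for r
    using K(3)[of r "[]"] by (cases "r \<in> K") (simp_all add: sym_partials_Nil)
  ultimately show ?thesis by simp
qed

lemma test_function_bounded:
  fixes f :: "real^'m^'m \<Rightarrow> complex"
  assumes f: "f \<in> test_functions"
  obtains B where "0 \<le> B" "\<And>r. norm (f r) \<le> B"
proof -
  obtain K where K: "compact K" "K \<subseteq> pos_def_cone" "\<And>ps r. r \<notin> K \<Longrightarrow> sym_partials ps f r = 0"
    using test_function_support[OF f] by metis
  have c: "continuous_on K f"
    using continuous_on_subset[OF test_function_continuous[OF f]] K(2) pos_def_cone_subset_symm by blast
  then have "bounded (f ` K)" using K(1) by (intro compact_imp_bounded compact_continuous_image)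
  then obtain B where B: "B > 0" "\<And>r. r \<in> K \<Longrightarrow> norm (f r) \<le> B" unfolding bounded_pos by blast
  have "norm (f r) \<le> B" for r
    using B K(3)[of r "[]"] by (cases "r \<in> K") (simp_all add: sym_partials_Nil)
  then show ?thesis using that[of B] B(1) by simp
qed

text \<open>A diagonal entry of a Gram matrix is the sum of squares of a column, so the bounded
  support of \<open>f\<close> bounds every entry of the array. The bound \<open>R\<close> depends on
  \<open>f\<close> and \<open>s\<close> only, not on the row and column sets.\<close>

lemma test_function_gram_support:
  fixes f :: "real^'m^'m \<Rightarrow> complex"
  assumes f: "f \<in> test_functions"
  obtains R where "0 \<le> R" "\<And>I S v k j. finite I \<Longrightarrow> f (s + gram I S v) \<noteq> 0 \<Longrightarrow> k \<in> I \<Longrightarrow> j \<in> S \<Longrightarrow> \<bar>v (k :: 'k, j)\<bar> \<le> R"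
proof -
  obtain K where K: "compact K" "K \<subseteq> pos_def_cone" "\<And>ps r. r \<notin> K \<Longrightarrow> sym_partials ps f r = 0"
    using test_function_support[OF f] by metis
  from compact_imp_bounded[OF K(1)] obtain B where B: "\<And>r. r \<in> K \<Longrightarrow> norm r \<le> B" unfolding bounded_iff by blast
  let ?R = "1 + \<bar>B\<bar> + norm s"
  have "\<bar>v (k, j)\<bar> \<le> ?R" if "finite I" "f (s + gram I S v) \<noteq> 0" "k \<in> I" "j \<in> S" for I S v and k :: 'k and j
  proof -
    have "s + gram I S v \<in> K" using that(2) K(3)[of _ "[]"] by (auto simp: sym_partials_Nil)
    from B[OF this] have "norm ((s + gram I S v) $ j $ j) \<le> B"
      by (meson Finite_Cartesian_Product.norm_nth_le order_trans)
    moreover have "norm (s $ j $ j) \<le> norm s"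
      by (meson Finite_Cartesian_Product.norm_nth_le order_trans)
    moreover have "gram I S v $ j $ j = (\<Sum>i\<in>I. (v (i, j))\<^sup>2)"
      using that(4) by (simp add: gram_def power2_eq_square)
    ultimately have "(\<Sum>i\<in>I. (v (i, j))\<^sup>2) \<le> \<bar>B\<bar> + norm s" by simp
    moreover have "(v (k, j))\<^sup>2 \<le> (\<Sum>i\<in>I. (v (i, j))\<^sup>2)"
      using that by (intro member_le_sum) auto
    ultimately have "\<bar>v (k, j)\<bar>\<^sup>2 \<le> \<bar>B\<bar> + norm s" by simp
    \<comment> \<open>Passes from the square to the entry itself; this is where the summand 1 in
      \<open>?R\<close> comes from.\<close>
    moreover have "\<bar>v (k, j)\<bar> \<le> 1 + \<bar>v (k, j)\<bar>\<^sup>2"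
    proof -
      have "0 \<le> (\<bar>v (k, j)\<bar> - 1 / 2)\<^sup>2" by simp
      also have "\<dots> = \<bar>v (k, j)\<bar>\<^sup>2 - \<bar>v (k, j)\<bar> + 1 / 4" by (simp add: power2_diff power_divide)
      finally show ?thesis by linarith
    qed
    ultimately show ?thesis by linarith
  qed
  then show ?thesis using that[of ?R] by simp
qed

lemma integrable_LP_bounded_support:
  fixes g :: "('i \<Rightarrow> real) \<Rightarrow> complex"
  assumes A: "finite A" and g: "g \<in> borel_measurable (LP A)" and B: "\<And>w. norm (g w) \<le> B"
    and R: "\<And>w x. g w \<noteq> 0 \<Longrightarrow> x \<in> A \<Longrightarrow> \<bar>w x\<bar> \<le> R"
  shows "integrable (LP A) g"
proof (rule Bochner_Integration.integrable_bound[OF _ g])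
  have "integrable lborel (indicator {-R..R} :: real \<Rightarrow> real)"
    by (intro integrable_real_indicator) (simp_all add: emeasure_lborel_Icc_eq)
  then show "integrable (LP A) (\<lambda>w. B * (\<Prod>x\<in>A. indicator {-R..R} (w x)))"
    by (intro integrable_mult_right LP.product_integrable_prod[OF A])
  show "AE w in LP A. norm (g w) \<le> norm (B * (\<Prod>x\<in>A. indicator {-R..R} (w x)))"
  proof (intro AE_I2)
    fix w
    show "norm (g w) \<le> norm (B * (\<Prod>x\<in>A. indicator {-R..R} (w x)))"
    proof (cases "g w = 0")
      case False
      have "(\<Prod>x\<in>A. indicator {-R..R} (w x)) = (1 :: real)"
      proof (intro prod.neutral ballI)
        fix x assume "x \<in> A"
        then have "- R \<le> w x \<and> w x \<le> R" using R[OF False] by (metis abs_le_iff minus_le_iff)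
        then show "indicator {-R..R} (w x) = (1 :: real)" by simp
      qed
      moreover have "norm (g w) \<le> \<bar>B\<bar>" using B[of w] by linarith
      ultimately show ?thesis by simp
    qed simp
  qed
qed

text \<open>With two rows, column \<open>a\<close> is a planar vector whose radius has density
  \<open>2 * pi * r\<close>. The radius is stored as the coordinate \<open>(p, a)\<close>, so that
  it can be differentiated like any other entry of row \<open>p\<close>; the coordinate
  \<open>(q, a)\<close> disappears.\<close>

lemma nn_integral_gram_polar:
  fixes F :: "real^'m::finite^'m \<Rightarrow> ennreal"
  assumes pq: "p \<noteq> q" and a: "a \<notin> T" and F: "F \<in> borel_measurable borel"
  shows "(\<integral>\<^sup>+w. F (gram {p, q} (insert a T) w) \<partial>LP ({p, q} \<times> insert a T)) =
    (\<integral>\<^sup>+w. ennreal (indicator {0<..} (w (p, a)) * (2 * pi * w (p, a))) *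
      F (gram {p, q} (insert a T) (ext_col a p (w (p, a)) w)) \<partial>LP (insert (p, a) ({p, q} \<times> T)))"
proof -
  let ?I = "{p, q}" and ?S = "insert a T"
  have I: "finite ?I" "p \<in> ?I" by auto
  have fin: "finite (?I \<times> T)" "finite (?I \<times> {a})" "?I \<times> {a} \<noteq> {}" by auto
  define H where "H t = (\<integral>\<^sup>+w. F (gram ?I ?S (ext_col a p t w)) \<partial>LP (?I \<times> T))" for t
  have m: "(\<lambda>z. gram ?I ?S (ext_col a p (fst z) (snd z))) \<in> borel_measurable (borel \<Otimes>\<^sub>M LP (?I \<times> T))"
    by (rule measurable_gram_ext_col[OF I a order_refl]) simp_all
  have mH: "H \<in> borel_measurable borel"
    using measurable_compose[OF m F] unfolding H_def[abs_def]
    by (intro sigma_finite_measure.borel_measurable_nn_integral LP.sigma_finite fin) (simp add: case_prod_unfold)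
  have "(\<integral>\<^sup>+w. F (gram ?I ?S w) \<partial>LP (?I \<times> ?S)) = (\<integral>\<^sup>+v. H (sqrt (\<Sum>x\<in>?I \<times> {a}. (v x)\<^sup>2)) \<partial>LP (?I \<times> {a}))"
    unfolding H_def by (rule nn_integral_gram_insert[OF I a F])
  also have "\<dots> = (\<integral>\<^sup>+r. ennreal (indicator {0<..} r * (2 * pi * r)) * H r \<partial>lborel)"
  proof -
    have c: "card (?I \<times> {a}) = 2" using pq by (simp add: card_cartesian_product)
    have e: "indicator {0<..} r * (real 2 * unit_ball_vol (real 2) * r powr (real 2 - 1)) = indicator {0<..} r * (2 * pi * r)" for r :: real
      using unit_ball_vol_2 by (simp add: indicator_def)
    show ?thesis using nn_integral_LP_norm[OF fin(2,3) mH] unfolding c e .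
  qed
  also have "\<dots> = (\<integral>\<^sup>+r. \<integral>\<^sup>+x. ennreal (indicator {0<..} r * (2 * pi * r)) * F (gram ?I ?S (ext_col a p r x)) \<partial>LP (?I \<times> T) \<partial>lborel)"
  proof (rule nn_integral_cong)
    fix r :: real
    have "(\<lambda>x. F (gram ?I ?S (ext_col a p r x))) \<in> borel_measurable (LP (?I \<times> T))"
      by (rule measurable_compose[OF measurable_gram_ext_col[OF I a order_refl] F]) simp_all
    then show "ennreal (indicator {0<..} r * (2 * pi * r)) * H r =
      (\<integral>\<^sup>+x. ennreal (indicator {0<..} r * (2 * pi * r)) * F (gram ?I ?S (ext_col a p r x)) \<partial>LP (?I \<times> T))"
      unfolding H_def by (rule nn_integral_cmult[symmetric])
  qed
  also have "\<dots> = (\<integral>\<^sup>+r. \<integral>\<^sup>+x. ennreal (indicator {0<..} ((x((p, a) := r)) (p, a)) * (2 * pi * (x((p, a) := r)) (p, a))) *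
      F (gram ?I ?S (ext_col a p ((x((p, a) := r)) (p, a)) (x((p, a) := r)))) \<partial>LP (?I \<times> T) \<partial>lborel)"
  proof -
    have "ext_col a p r (x((p, a) := r)) = ext_col a p r x" for r and x :: "'a \<times> 'm \<Rightarrow> real"
      by (auto simp: ext_col_def fun_eq_iff)
    then show ?thesis by simp
  qed
  also have "\<dots> = (\<integral>\<^sup>+w. ennreal (indicator {0<..} (w (p, a)) * (2 * pi * w (p, a))) *
      F (gram ?I ?S (ext_col a p (w (p, a)) w)) \<partial>LP (insert (p, a) (?I \<times> T)))"
  proof (rule LP.product_nn_integral_insert_rev[symmetric, OF fin(1)])
    show "(p, a) \<notin> ?I \<times> T" using a by auto
    have c: "(\<lambda>w. w (p, a)) \<in> borel_measurable (LP (insert (p, a) (?I \<times> T)))"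
      by (rule LP_component') simp
    have "(\<lambda>w. F (gram ?I ?S (ext_col a p (w (p, a)) w))) \<in> borel_measurable (LP (insert (p, a) (?I \<times> T)))"
      by (rule measurable_compose[OF measurable_gram_ext_col[where B = "insert (p, a) (?I \<times> T)", OF I a _ c] F]) auto
    moreover have "(\<lambda>w. ennreal (indicator {0<..} (w (p, a)) * (2 * pi * w (p, a)))) \<in> borel_measurable (LP (insert (p, a) (?I \<times> T)))"
      by (rule measurable_compose[OF c]) measurable
    ultimately show "(\<lambda>w. ennreal (indicator {0<..} (w (p, a)) * (2 * pi * w (p, a))) *
      F (gram ?I ?S (ext_col a p (w (p, a)) w))) \<in> borel_measurable (LP (insert (p, a) (?I \<times> T)))"
      by (rule borel_measurable_times_ennreal[rotated])
  qed
  finally show ?thesis .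
qed

text \<open>Both sides integrate \<open>F\<close> against the same image measure on matrices, so the
  nonnegative version carries over.\<close>

lemma integral_gram_polar:
  fixes F :: "real^'m::finite^'m \<Rightarrow> complex"
  assumes pq: "p \<noteq> q" and a: "a \<notin> T" and F: "F \<in> borel_measurable borel"
  shows "(\<integral>w. F (gram {p, q} (insert a T) w) \<partial>LP ({p, q} \<times> insert a T)) =
    (\<integral>w. (indicator {0<..} (w (p, a)) * (2 * pi * w (p, a))) *\<^sub>R
      F (gram {p, q} (insert a T) (ext_col a p (w (p, a)) w)) \<partial>LP (insert (p, a) ({p, q} \<times> T)))"
proof -
  let ?I = "{p, q}" and ?S = "insert a T" and ?A = "insert (p, a) ({p, q} \<times> T)"
  let ?d = "\<lambda>w. indicator {0<..} (w (p, a)) * (2 * pi * w (p, a)) :: real"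
  let ?g = "\<lambda>w. gram ?I ?S (ext_col a p (w (p, a)) w)"
  have c: "(\<lambda>w. w (p, a)) \<in> borel_measurable (LP ?A)"
    by (rule LP_component') simp
  have mg: "?g \<in> borel_measurable (LP ?A)"
    by (rule measurable_gram_ext_col[where B = ?A, OF _ _ a _ c]) auto
  have mgr: "gram ?I ?S \<in> borel_measurable (LP (?I \<times> ?S))"
    by (rule measurable_gram) auto
  have md: "?d \<in> borel_measurable (LP ?A)"
    by (rule measurable_compose[OF c]) measurable
  have mde: "(\<lambda>w. ennreal (?d w)) \<in> borel_measurable (LP ?A)"
    by (rule measurable_compose[OF md measurable_ennreal])
  have mgd: "?g \<in> density (LP ?A) (\<lambda>w. ennreal (?d w)) \<rightarrow>\<^sub>M borel" using mg by simp
  have "distr (LP (?I \<times> ?S)) borel (gram ?I ?S) = distr (density (LP ?A) (\<lambda>w. ennreal (?d w))) borel ?g"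
  proof (rule distr_eqI_nn_integral[OF mgr mgd])
    fix H :: "real^'m^'m \<Rightarrow> ennreal" assume H: "H \<in> borel_measurable borel"
    show "(\<integral>\<^sup>+w. H (gram ?I ?S w) \<partial>LP (?I \<times> ?S)) = (\<integral>\<^sup>+w. H (?g w) \<partial>density (LP ?A) (\<lambda>w. ennreal (?d w)))"
      unfolding nn_integral_gram_polar[OF pq a H]
      by (rule nn_integral_density[symmetric, OF mde measurable_compose[OF mg H]])
  qed
  then have "(\<integral>r. F r \<partial>distr (LP (?I \<times> ?S)) borel (gram ?I ?S)) = (\<integral>r. F r \<partial>distr (density (LP ?A) (\<lambda>w. ennreal (?d w))) borel ?g)"
    by (rule arg_cong)
  moreover have "(\<integral>r. F r \<partial>distr (LP (?I \<times> ?S)) borel (gram ?I ?S)) = (\<integral>w. F (gram ?I ?S w) \<partial>LP (?I \<times> ?S))"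
    by (rule integral_distr[OF mgr F])
  moreover have "(\<integral>r. F r \<partial>distr (density (LP ?A) (\<lambda>w. ennreal (?d w))) borel ?g) = (\<integral>w. F (?g w) \<partial>density (LP ?A) (\<lambda>w. ennreal (?d w)))"
    using mg F by (intro integral_distr) simp_all
  moreover have "(\<integral>w. F (?g w) \<partial>density (LP ?A) (\<lambda>w. ennreal (?d w))) = (\<integral>w. ?d w *\<^sub>R F (?g w) \<partial>LP ?A)"
    by (rule integral_density[OF measurable_compose[OF mg F] md]) (simp add: indicator_def)
  ultimately show ?thesis by simp
qed

lemma integral_derivative_zero:
  fixes u u' :: "real \<Rightarrow> complex"
  assumes d: "\<And>x. (u has_vector_derivative u' x) (at x)" and c: "continuous_on UNIV u'"
    and z: "\<And>x. \<bar>x\<bar> > R \<Longrightarrow> u x = 0 \<and> u' x = 0"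
  shows "(\<integral>x. u' x \<partial>lborel) = 0" "(\<integral>x. indicator {0<..} x *\<^sub>R u' x \<partial>lborel) = - u 0"
proof -
  \<comment> \<open>The hypothesis \<open>z\<close> is strict in \<open>R\<close>; the added 1 makes
    \<open>u\<close> vanish at the endpoints themselves.\<close>
  define M where "M = \<bar>R\<bar> + 1"
  have M: "M > 0" "u M = 0" "u (- M) = 0" using z[of M] z[of "- M"] by (auto simp: M_def)
  have z': "u' x = 0" if "\<bar>x\<bar> > M" for x using that z[of x] by (auto simp: M_def)
  have c': "continuous_on X u'" for X using c continuous_on_subset by blast
  have "(\<integral>x. indicator {- M..M} x *\<^sub>R u' x \<partial>lborel) = u M - u (- M)"
    using M by (intro integral_FTC_Icc has_vector_derivative_at_within[OF d] c') simp
  moreover have "indicator {- M..M} x *\<^sub>R u' x = u' x" for x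
    using z'[of x] by (auto simp: indicator_def abs_le_iff)
  ultimately show "(\<integral>x. u' x \<partial>lborel) = 0" using M by simp
  have "(\<integral>x. indicator {0..M} x *\<^sub>R u' x \<partial>lborel) = u M - u 0"
    using M by (intro integral_FTC_Icc has_vector_derivative_at_within[OF d] c') simp
  moreover have "(\<integral>x. indicator {0<..} x *\<^sub>R u' x \<partial>lborel) = (\<integral>x. indicator {0..M} x *\<^sub>R u' x \<partial>lborel)"
  proof (rule integral_cong_AE)
    have [measurable]: "u' \<in> borel_measurable borel" by (rule borel_measurable_continuous_onI[OF c])
    show "(\<lambda>x. indicator {0<..} x *\<^sub>R u' x) \<in> borel_measurable lborel"
      "(\<lambda>x. indicator {0..M} x *\<^sub>R u' x) \<in> borel_measurable lborel" by measurable
    have "AE x in lborel. x \<noteq> (0 :: real)" by (rule AE_lborel_singleton)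
    then show "AE x in lborel. indicator {0<..} x *\<^sub>R u' x = indicator {0..M} x *\<^sub>R u' x"
    proof (rule AE_mp, intro AE_I2 impI)
      fix x :: real assume "x \<noteq> 0"
      then show "indicator {0<..} x *\<^sub>R u' x = indicator {0..M} x *\<^sub>R u' x"
        using z'[of x] by (cases "x > M") (auto simp: indicator_def)
    qed
  qed
  ultimately show "(\<integral>x. indicator {0<..} x *\<^sub>R u' x \<partial>lborel) = - u 0" using M by simp
qed

section \<open>Differentiating a Gram matrix in one entry of the array\<close>

lemma gram_symm: "gram I S v \<in> symm"
  by (simp add: gram_def transpose_def vec_eq_iff mult.commute conj_commute)

text \<open>Changing the entry \<open>(p, i)\<close> affects only row and column \<open>i\<close> of
  the Gram matrix, so the path runs in the span of the \<open>sym_unit i j\<close>, the form that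
  \<open>test_function_chain\<close> expects.\<close>

lemma gram_update:
  assumes "finite I" "p \<in> I" "i \<in> S"
  shows "gram I S (v((p, i) := x)) = gram I S (v((p, i) := 0)) +
    (\<Sum>j\<in>S. (if j = i then x\<^sup>2 else x * v (p, j)) *\<^sub>R sym_unit i j)"
proof -
  let ?v = "\<lambda>x. v((p, i) := x)"
  have s: "(\<Sum>k\<in>I. ?v x (k, a) * ?v x (k, b)) = (\<Sum>k\<in>I - {p}. v (k, a) * v (k, b)) + ?v x (p, a) * ?v x (p, b)" for x a b
  proof -
    have "(\<Sum>k\<in>I - {p}. ?v x (k, a) * ?v x (k, b)) = (\<Sum>k\<in>I - {p}. v (k, a) * v (k, b))"
      by (intro sum.cong) auto
    then show ?thesis by (subst sum.remove[OF assms(1,2)]) simp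
  qed
  have u: "(\<Sum>j\<in>S. c j *\<^sub>R sym_unit i j) $ a $ b = (if a = i \<and> b \<in> S then c b else if b = i \<and> a \<in> S then c a else 0)"
    for c :: "_ \<Rightarrow> real" and a b
  proof -
    have "(\<Sum>j\<in>S. c j *\<^sub>R sym_unit i j) $ a $ b = (\<Sum>j\<in>S. if a = i \<and> b = j \<or> a = j \<and> b = i then c j else 0)"
      by (simp add: sum_component sym_unit_def if_distrib[of "\<lambda>x. _ * x"] cong: if_cong)
    \<comment> \<open>For given \<open>a\<close> and \<open>b\<close> at most one index
      \<open>j\<close> contributes.\<close>
    also have "\<dots> = (\<Sum>j\<in>S. if j = (if a = i then b else a) then if a = i \<or> b = i then c j else 0 else 0)"
      by (intro sum.cong) auto
    also have "\<dots> = (if a = i \<and> b \<in> S then c b else if b = i \<and> a \<in> S then c a else 0)"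
      using assms(3) by (auto simp: sum.delta')
    finally show ?thesis .
  qed
  have "gram I S (?v x) $ a $ b = (gram I S (?v 0) + (\<Sum>j\<in>S. (if j = i then x\<^sup>2 else x * v (p, j)) *\<^sub>R sym_unit i j)) $ a $ b" for a b
    using assms(3) unfolding vector_add_component u gram_def
    by (cases "a \<in> S"; cases "b \<in> S"; cases "a = i"; cases "b = i") (simp_all add: s power2_eq_square del: fun_upd_apply, simp_all add: mult.commute)
  then show ?thesis by (simp add: vec_eq_iff)
qed

text \<open>The diagonal coordinate is quadratic in \<open>x\<close>, the others are linear. The
  factor 1/2 in \<open>eta\<close> off the diagonal gives both kinds the common form
  \<open>2 * v * eta\<close>.\<close>

lemma gram_derivative:
  fixes f :: "real^'m^'m \<Rightarrow> complex"
  assumes f: "f \<in> test_functions" and s: "s \<in> symm" and I: "finite I" "p \<in> I" "i \<in> S"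
  shows "((\<lambda>x. f (s + gram I S (v((p, i) := x)))) has_vector_derivative
     (\<Sum>j\<in>S. (2 * (v((p, i) := x)) (p, j) * eta j i) *\<^sub>R sym_partial j i f (s + gram I S (v((p, i) := x))))) (at x)"
proof -
  let ?A = "s + gram I S (v((p, i) := 0))"
  let ?\<gamma> = "\<lambda>j x. if j = i then x\<^sup>2 else x * v (p, j)"
  have e: "s + gram I S (v((p, i) := x)) = ?A + (\<Sum>j\<in>S. ?\<gamma> j x *\<^sub>R sym_unit i j)" for x
    by (subst gram_update[OF I]) simp
  have "((\<lambda>x. f (?A + (\<Sum>j\<in>S. ?\<gamma> j x *\<^sub>R sym_unit i j))) has_vector_derivative
    (\<Sum>j\<in>S. (if j = i then 2 * x else v (p, j)) *\<^sub>R sym_partial i j f (?A + (\<Sum>j\<in>S. ?\<gamma> j x *\<^sub>R sym_unit i j)))) (at x)"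
  proof (rule test_function_chain[OF _ f])
    show "?A \<in> symm" by (rule symm_add[OF s gram_symm])
    fix j
    show "(?\<gamma> j has_real_derivative (if j = i then 2 * x else v (p, j))) (at x)"
      by (cases "j = i") (auto intro!: derivative_eq_intros)
  qed simp
  then show ?thesis
    unfolding e[symmetric]
    by (rule has_vector_derivative_eq_rhs) (auto intro!: sum.cong simp: eta_def sym_partial_commute)
qed

lemma gram_derivative_continuous:
  fixes f :: "real^'m^'m \<Rightarrow> complex"
  assumes f: "f \<in> test_functions" and s: "s \<in> symm" and I: "finite I" "p \<in> I" "i \<in> S"
  shows "continuous_on UNIV (\<lambda>x. f (s + gram I S (v((p, i) := x))))"
proof (rule continuous_on_compose2[OF test_function_continuous[OF f]])
  have "continuous_on UNIV (\<lambda>x. (if j = i then x\<^sup>2 else x * v (p, j)) :: real)" for j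
    by (cases "j = i") (auto intro!: continuous_intros)
  then show "continuous_on UNIV (\<lambda>x. s + gram I S (v((p, i) := x)))"
    by (subst gram_update[OF I]) (intro continuous_intros)
  show "(\<lambda>x. s + gram I S (v((p, i) := x))) ` UNIV \<subseteq> symm"
    using symm_add[OF s gram_symm] by blast
qed

lemma gram_ext_col_zero:
  assumes "finite I" "p \<in> I" "a \<notin> T"
  shows "gram I (insert a T) (ext_col a p 0 w) = gram I T w"
  unfolding gram_ext_col[OF assms] unfolding gram_def vec_eq_iff using assms(3) by auto

text \<open>Row \<open>p\<close> of the array enters only through \<open>w (p, i)\<close>, so \<open>adj(G)\<close> applied to the gradient in this row
  is a divergence; Cramer's rule turns it into \<open>det G\<close>.\<close>

lemma cramer_gram:
  fixes \<phi> :: "real^'m^'m \<Rightarrow> complex"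
  assumes \<phi>: "\<phi> \<in> test_functions" and a: "a \<in> S"
  shows "(\<Sum>i\<in>S. \<Sum>j\<in>S. (2 * v j * eta j i) *\<^sub>R sym_partial j i (diff_op (cof S a i) \<phi>) r) =
    (2 * v a) *\<^sub>R diff_op (det (op_mat S)) \<phi> r"
proof -
  have "(\<Sum>i\<in>S. \<Sum>j\<in>S. (2 * v j * eta j i) *\<^sub>R sym_partial j i (diff_op (cof S a i) \<phi>) r) =
    (\<Sum>j\<in>S. (2 * v j) *\<^sub>R (\<Sum>i\<in>S. eta j i *\<^sub>R sym_partial j i (diff_op (cof S a i) \<phi>) r))"
    by (subst sum.swap) (simp add: scaleR_sum_right)
  also have "\<dots> = (\<Sum>j\<in>S. (2 * v j) *\<^sub>R diff_op (\<Sum>i\<in>S. var j i (eta j i) * cof S a i) \<phi> r)"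
    by (simp add: diff_op_sum diff_op_var_mult[OF \<phi>] scaleR_conv_of_real)
  also have "\<dots> = (\<Sum>j\<in>S. if j = a then (2 * v a) *\<^sub>R diff_op (det (op_mat S)) \<phi> r else 0)"
    by (intro sum.cong refl) (simp add: cof_expand[OF a])
  also have "\<dots> = (2 * v a) *\<^sub>R diff_op (det (op_mat S)) \<phi> r"
    using a by simp
  finally show ?thesis .
qed

text \<open>\<open>S\<close> varies because the boundary term for column \<open>a\<close> is the
  same integral for the minor on the remaining columns. Only entries of row \<open>p\<close> are
  differentiated; row \<open>q\<close> remains a parameter.\<close>

lemma integral_diff_op_det:
  fixes \<phi> :: "real^'m::finite^'m \<Rightarrow> complex" and p q :: 'k and S :: "'m set"
  assumes \<phi>: "\<phi> \<in> test_functions" and s: "s \<in> symm" and pq: "p \<noteq> q"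
  shows "(\<integral>w. diff_op (det (op_mat S)) \<phi> (s + gram {p, q} S w) \<partial>LP ({p, q} \<times> S)) = (- of_real pi) ^ card S * \<phi> s"
  using finite[of S]
proof (induction S rule: finite_induct)
  case empty
  have "op_mat ({} :: 'm set) = mat 1" by (simp add: op_mat_def mat_def)
  moreover have "gram {p, q} {} w = 0" for w :: "'k \<times> 'm \<Rightarrow> real" by (simp add: gram_def vec_eq_iff)
  moreover have "measure (LP {}) (space (LP {}) :: ('k \<times> 'm \<Rightarrow> real) set) = 1"
    by (simp add: measure_def emeasure_LP_empty)
  ultimately show ?case by simp
next
  case (insert a T)
  let ?I = "{p, q}" and ?S = "insert a T"
  let ?A = "insert (p, a) (?I \<times> T)"
  have aT: "a \<notin> T" by fact
  have I: "finite ?I" "p \<in> ?I" by auto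
  have finA: "finite ?A" by simp
  define X where "X w = ext_col a p (w (p, a)) w" for w :: "'k \<times> 'm \<Rightarrow> real"
  \<comment> \<open>By \<open>gram_derivative\<close>, the derivative of the cofactor
    \<open>(a, i)\<close> of the operator matrix, applied to \<open>\<phi>\<close>, in the array
    entry \<open>(p, i)\<close>.\<close>
  define \<Psi> where "\<Psi> i w = (\<Sum>j\<in>?S. (2 * X w (p, j) * eta j i) *\<^sub>R
      sym_partial j i (diff_op (cof ?S a i) \<phi>) (s + gram ?I ?S (X w)))" for i w
  define hv where "hv w = (indicator {0<..} (w (p, a)) :: real)" for w :: "'k \<times> 'm \<Rightarrow> real"
  have Xw: "X w (k, j) = w (k, j)" if "(k, j) \<in> ?A" for w k j
    using that aT by (auto simp: X_def ext_col_def)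
  have tf: "diff_op P \<phi> \<in> test_functions" for P by (rule diff_op_test_function[OF \<phi>])
  have mw: "(\<lambda>w. w x) \<in> borel_measurable (LP ?A)" if "x \<in> ?A" for x
    by (rule LP_component'[OF that])
  have mX: "(\<lambda>w. s + gram ?I ?S (X w)) \<in> borel_measurable (LP ?A)"
    unfolding X_def
    by (intro borel_measurable_add borel_measurable_const measurable_gram_ext_col[where B = ?A, OF I aT] mw) auto
  have mhv: "hv \<in> borel_measurable (LP ?A)"
    unfolding hv_def[abs_def] by (rule measurable_compose[OF mw]) simp_all
  \<comment> \<open>Needed both to split the sum over \<open>i\<close> and to integrate over
    \<open>(p, i)\<close> first.\<close>
  have int: "integrable (LP ?A) (\<lambda>w. hv w *\<^sub>R \<Psi> i w)" for i
  proof -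
    have "integrable (LP ?A) (\<lambda>w. hv w *\<^sub>R (2 * X w (p, j) * eta j i) *\<^sub>R
      sym_partial j i (diff_op (cof ?S a i) \<phi>) (s + gram ?I ?S (X w)))" if j: "j \<in> ?S" for j
    proof -
      let ?f = "sym_partial j i (diff_op (cof ?S a i) \<phi>)"
      have f: "?f \<in> test_functions" by (rule test_function_partial[OF tf])
      obtain B where B: "0 \<le> B" "\<And>r. norm (?f r) \<le> B" using test_function_bounded[OF f] by metis
      obtain R where R: "0 \<le> R" "\<And>I S v k j. finite I \<Longrightarrow> ?f (s + gram I S v) \<noteq> 0 \<Longrightarrow> k \<in> I \<Longrightarrow> j \<in> S \<Longrightarrow> \<bar>v (k :: 'k, j)\<bar> \<le> R"
        by (rule test_function_gram_support[OF f, of s]) blast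
      have pj: "(p, j) \<in> ?A" using j by auto
      let ?g = "\<lambda>w. hv w *\<^sub>R (2 * X w (p, j) * eta j i) *\<^sub>R ?f (s + gram ?I ?S (X w))"
      show ?thesis
      proof (rule integrable_LP_bounded_support[OF finA, where B = "2 * R * B" and R = R])
        have "(\<lambda>w. ?f (s + gram ?I ?S (X w))) \<in> borel_measurable (LP ?A)"
          by (rule measurable_compose[OF mX test_function_measurable[OF f]])
        then show "?g \<in> borel_measurable (LP ?A)"
          unfolding Xw[OF pj] using mw[OF pj]
          by (intro borel_measurable_scaleR borel_measurable_times borel_measurable_const mhv)
      next
        fix w
        show "norm (?g w) \<le> 2 * R * B"
        proof (cases "?f (s + gram ?I ?S (X w)) = 0")
          case True
          then show ?thesis using B(1) R(1) by simp
        next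
          case False
          have "\<bar>X w (p, j)\<bar> \<le> R" using R(2)[OF I(1) False I(2) j] .
          moreover have "\<bar>eta j i\<bar> \<le> 1" by (simp add: eta_def)
          ultimately have "\<bar>X w (p, j)\<bar> * \<bar>eta j i\<bar> \<le> R * 1" by (intro mult_mono) auto
          then have "(\<bar>X w (p, j)\<bar> * \<bar>eta j i\<bar>) * norm (?f (s + gram ?I ?S (X w))) \<le> R * B"
            using B R(1) by (intro mult_mono) auto
          moreover have "hv w = 0 \<or> hv w = 1" by (simp add: hv_def indicator_def)
          ultimately show ?thesis using R(1) B(1) by (auto simp: abs_mult)
        qed
      next
        fix w x assume g: "?g w \<noteq> 0" and x: "x \<in> ?A"
        obtain k l where kl: "x = (k, l)" by force
        have "?f (s + gram ?I ?S (X w)) \<noteq> 0" using g by auto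
        moreover have "k \<in> ?I" "l \<in> ?S" using x kl by auto
        ultimately have "\<bar>X w (k, l)\<bar> \<le> R" using R(2)[OF I(1)] by blast
        then show "\<bar>w x\<bar> \<le> R" using Xw x kl by simp
      qed
    qed
    then show ?thesis unfolding \<Psi>_def scaleR_sum_right by (intro Bochner_Integration.integrable_sum) 
  qed
  \<comment> \<open>This includes \<open>i = a\<close>: the radius is an entry of row
    \<open>p\<close> in the normal form as well.\<close>
  have X_upd: "X (w((p, i) := x)) = (X w)((p, i) := x)" if "i \<in> ?S" for w i x
  proof (cases "i = a")
    case True
    then show ?thesis by (auto simp: X_def ext_col_def fun_eq_iff)
  next
    case False
    then show ?thesis by (auto simp: X_def ext_col_def fun_eq_iff)
  qed
  have deriv: "((\<lambda>x. diff_op (cof ?S a i) \<phi> (s + gram ?I ?S (X (w((p, i) := x))))) has_vector_derivative \<Psi> i (w((p, i) := x))) (at x)"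
    if i: "i \<in> ?S" for i w x
    unfolding \<Psi>_def X_upd[OF i] by (rule gram_derivative[OF tf s I i])
  have cont: "continuous_on UNIV (\<lambda>x. \<Psi> i (w((p, i) := x)))" if i: "i \<in> ?S" for i w
  proof -
    have "continuous_on UNIV (\<lambda>x. (if j = i then x else X w (p, j)) :: real)" for j
      by (cases "j = i") (auto intro!: continuous_intros)
    then have "continuous_on UNIV (\<lambda>x. ((X w)((p, i) := x)) (p, j))" for j
      by (simp add: fun_upd_def)
    then show ?thesis
      unfolding \<Psi>_def X_upd[OF i]
      by (intro continuous_on_sum continuous_on_scaleR continuous_on_mult continuous_on_const
          gram_derivative_continuous[OF test_function_partial[OF tf] s I i])
  qed
  have vanish: "\<exists>R. \<forall>x. \<bar>x\<bar> > R \<longrightarrow> diff_op (cof ?S a i) \<phi> (s + gram ?I ?S (X (w((p, i) := x)))) = 0 \<and> \<Psi> i (w((p, i) := x)) = 0"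
    if i: "i \<in> ?S" for i w
  proof -
    have ex: "\<exists>R. \<forall>x. \<bar>x\<bar> > R \<longrightarrow> f (s + gram ?I ?S (X (w((p, i) := x)))) = 0" if f: "f \<in> test_functions" for f :: "real^'m^'m \<Rightarrow> complex"
    proof -
      obtain R where R: "0 \<le> R" "\<And>I S v k j. finite I \<Longrightarrow> f (s + gram I S v) \<noteq> 0 \<Longrightarrow> k \<in> I \<Longrightarrow> j \<in> S \<Longrightarrow> \<bar>v (k :: 'k, j)\<bar> \<le> R"
        by (rule test_function_gram_support[OF f, of s]) blast
      have "f (s + gram ?I ?S (X (w((p, i) := x)))) = 0" if "\<bar>x\<bar> > R" for x
        using R(2)[of ?I ?S "X (w((p, i) := x))" p i] i that unfolding X_upd[OF i] by force
      then show ?thesis by blast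
    qed
    obtain R0 where R0: "\<And>x. \<bar>x\<bar> > R0 \<Longrightarrow> diff_op (cof ?S a i) \<phi> (s + gram ?I ?S (X (w((p, i) := x)))) = 0"
      using ex[OF tf] by blast
    have "\<forall>j. \<exists>R. \<forall>x. \<bar>x\<bar> > R \<longrightarrow> sym_partial j i (diff_op (cof ?S a i) \<phi>) (s + gram ?I ?S (X (w((p, i) := x)))) = 0"
      using ex[OF test_function_partial[OF tf]] by blast
    then obtain R where R: "\<And>j x. \<bar>x\<bar> > R j \<Longrightarrow> sym_partial j i (diff_op (cof ?S a i) \<phi>) (s + gram ?I ?S (X (w((p, i) := x)))) = 0"
      by metis
    define M where "M = max R0 (Max (R ` ?S))"
    have "R j \<le> M" if "j \<in> ?S" for j
      using that unfolding M_def by (intro max.coboundedI2 Max_ge) auto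
    then have "\<Psi> i (w((p, i) := x)) = 0" if "\<bar>x\<bar> > M" for x
      unfolding \<Psi>_def using R that by (intro sum.neutral ballI) force
    moreover have "R0 \<le> M" by (simp add: M_def)
    ultimately show ?thesis using R0 by (intro exI[of _ M]) force
  qed
  have split: "(\<integral>w. hv w *\<^sub>R \<Psi> i w \<partial>LP ?A) =
      (\<integral>w. \<integral>x. hv (w((p, i) := x)) *\<^sub>R \<Psi> i (w((p, i) := x)) \<partial>lborel \<partial>LP (?A - {(p, i)}))" if "(p, i) \<in> ?A" for i
  proof -
    have A: "?A = insert (p, i) (?A - {(p, i)})" using that by blast
    have "integrable (LP (insert (p, i) (?A - {(p, i)}))) (\<lambda>w. hv w *\<^sub>R \<Psi> i w)"
      using int A by metis
    from LP.product_integral_insert[OF _ _ this] finA A show ?thesis by simp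
  qed
  \<comment> \<open>For \<open>i \<noteq> a\<close> the half-line factor does not involve
    \<open>(p, i)\<close>, so a derivative with compact support is integrated over the whole
    line.\<close>
  have zero: "(\<integral>w. hv w *\<^sub>R \<Psi> i w \<partial>LP ?A) = 0" if i: "i \<in> T" for i
  proof -
    have ia: "i \<noteq> a" "i \<in> ?S" "(p, i) \<in> ?A" using i aT by auto
    have "(\<integral>x. hv (w((p, i) := x)) *\<^sub>R \<Psi> i (w((p, i) := x)) \<partial>lborel) = 0" for w
    proof -
      obtain R where R: "\<And>x. \<bar>x\<bar> > R \<Longrightarrow> diff_op (cof ?S a i) \<phi> (s + gram ?I ?S (X (w((p, i) := x)))) = 0 \<and> \<Psi> i (w((p, i) := x)) = 0"
        using vanish[OF ia(2)] by blast
      have "hv (w((p, i) := x)) = hv w" for x using ia(1) by (simp add: hv_def)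
      then show ?thesis
        using integral_derivative_zero(1)[OF deriv[OF ia(2)] cont[OF ia(2)] R] by simp
    qed
    then show ?thesis unfolding split[OF ia(3)] by simp
  qed
  \<comment> \<open>The radius runs over a half-line, leaving the boundary value at 0. There column
    \<open>a\<close> is zero, the Gram matrix reduces to the columns \<open>T\<close>, and the
    diagonal cofactor to \<open>op_mat T\<close>.\<close>
  have main: "(\<integral>w. hv w *\<^sub>R \<Psi> a w \<partial>LP ?A) = - ((- of_real pi) ^ card T * \<phi> s)"
  proof -
    have aS: "a \<in> ?S" "(p, a) \<in> ?A" by auto
    have A: "?A - {(p, a)} = ?I \<times> T" using aT by auto
    have "(\<integral>x. hv (w((p, a) := x)) *\<^sub>R \<Psi> a (w((p, a) := x)) \<partial>lborel) = - diff_op (det (op_mat T)) \<phi> (s + gram ?I T w)" for w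
    proof -
      obtain R where R: "\<And>x. \<bar>x\<bar> > R \<Longrightarrow> diff_op (cof ?S a a) \<phi> (s + gram ?I ?S (X (w((p, a) := x)))) = 0 \<and> \<Psi> a (w((p, a) := x)) = 0"
        using vanish[OF aS(1)] by blast
      have "X (w((p, a) := 0)) = ext_col a p 0 w" by (auto simp: X_def ext_col_def fun_eq_iff)
      then have g: "gram ?I ?S (X (w((p, a) := 0))) = gram ?I T w" using gram_ext_col_zero[OF I aT] by simp
      have "hv (w((p, a) := x)) = indicator {0<..} x" for x by (simp add: hv_def)
      then show ?thesis
        using integral_derivative_zero(2)[OF deriv[OF aS(1)] cont[OF aS(1)] R] unfolding g cof_diag[OF aT] by simp
    qed
    then have "(\<integral>w. hv w *\<^sub>R \<Psi> a w \<partial>LP ?A) = - (\<integral>w. diff_op (det (op_mat T)) \<phi> (s + gram ?I T w) \<partial>LP (?I \<times> T))"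
      unfolding split[OF aS(2)] A by simp
    then show ?thesis using insert.IH by simp
  qed
  have mF: "(\<lambda>r. diff_op (det (op_mat ?S)) \<phi> (s + r)) \<in> borel_measurable borel"
    using test_function_measurable[OF tf] by measurable
  have "(\<integral>w. diff_op (det (op_mat ?S)) \<phi> (s + gram ?I ?S w) \<partial>LP (?I \<times> ?S)) =
    (\<integral>w. (indicator {0<..} (w (p, a)) * (2 * pi * w (p, a))) *\<^sub>R diff_op (det (op_mat ?S)) \<phi> (s + gram ?I ?S (X w)) \<partial>LP ?A)"
    unfolding X_def by (rule integral_gram_polar[OF pq aT mF])
  \<comment> \<open>The polar density is \<open>pi\<close> times the factor
    \<open>2 * w (p, a)\<close> that Cramer's rule produces.\<close>
  also have "\<dots> = (\<integral>w. of_real pi * (\<Sum>i\<in>?S. hv w *\<^sub>R \<Psi> i w) \<partial>LP ?A)"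
  proof (intro Bochner_Integration.integral_cong refl)
    fix w
    have "(\<Sum>i\<in>?S. \<Psi> i w) = (2 * X w (p, a)) *\<^sub>R diff_op (det (op_mat ?S)) \<phi> (s + gram ?I ?S (X w))"
      unfolding \<Psi>_def by (rule cramer_gram[OF \<phi>]) simp
    then show "(indicator {0<..} (w (p, a)) * (2 * pi * w (p, a))) *\<^sub>R diff_op (det (op_mat ?S)) \<phi> (s + gram ?I ?S (X w)) =
      of_real pi * (\<Sum>i\<in>?S. hv w *\<^sub>R \<Psi> i w)"
      unfolding scaleR_sum_right[symmetric] by (simp add: Xw hv_def scaleR_conv_of_real)
  qed
  also have "\<dots> = of_real pi * (\<Sum>i\<in>?S. \<integral>w. hv w *\<^sub>R \<Psi> i w \<partial>LP ?A)"
    using int by (simp only: integral_mult_right_zero Bochner_Integration.integral_sum)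
  also have "(\<Sum>i\<in>?S. \<integral>w. hv w *\<^sub>R \<Psi> i w \<partial>LP ?A) = - ((- of_real pi) ^ card T * \<phi> s)"
    using zero main aT by (simp add: sum.insert)
  finally show ?case using aT by simp
qed

subsection \<open>The fractional integral\<close>

text \<open>\<open>lborel\<close> is the image of the product measure over \<open>Basis\<close>,
  whose elements are the matrix units. The bijection \<open>e\<close> relabels the rows.\<close>

lemma nn_integral_lborel_matrix:
  fixes F :: "real^'m^'k \<Rightarrow> ennreal" and e :: "'k \<Rightarrow> 'i"
  assumes e: "bij_betw e UNIV I" and F: "F \<in> borel_measurable borel"
  shows "(\<integral>\<^sup>+\<omega>. F \<omega> \<partial>lborel) = (\<integral>\<^sup>+w. F (\<chi> i j. w (e i, j)) \<partial>LP (I \<times> UNIV))"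
proof -
  have I: "finite I" using bij_betw_finite[OF e] by simp
  have eI: "e i \<in> I" for i using e by (auto simp: bij_betw_def)
  let ?e' = "the_inv_into UNIV e"
  have inv: "?e' (e i) = i" "k \<in> I \<Longrightarrow> e (?e' k) = k" for i k
    by (rule the_inv_into_f_f[OF bij_betw_imp_inj_on[OF e] UNIV_I], rule f_the_inv_into_f_bij_betw[OF e])
  let ?g = "\<lambda>(k, j). axis (?e' k) (axis j 1) :: real^'m^'k"
  have Basis: "\<exists>i j. b = axis i (axis j 1)" if b: "b \<in> Basis" for b :: "real^'m^'k"
  proof -
    from b obtain i u where "b = axis i u" "u \<in> Basis" by (auto simp: Basis_vec_def)
    moreover then obtain j where "u = axis j 1" by (auto simp: Basis_vec_def)
    ultimately show ?thesis by blast
  qed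
  have im: "?g ` (I \<times> UNIV) = Basis"
  proof -
    have 1: "axis i (axis j 1) \<in> ?g ` (I \<times> UNIV)" for i :: 'k and j :: 'm
      by (rule image_eqI[of _ _ "(e i, j)"]) (simp_all add: inv(1) eI)
    have 2: "axis i (axis j 1) \<in> (Basis :: (real^'m^'k) set)" for i j
      by (simp add: axis_in_Basis_iff)
    show ?thesis
    proof
      show "?g ` (I \<times> UNIV) \<subseteq> Basis" using 2 by force
      show "Basis \<subseteq> ?g ` (I \<times> UNIV)"
      proof
        fix b :: "real^'m^'k" assume "b \<in> Basis"
        then obtain i j where "b = axis i (axis j 1)" using Basis by blast
        then show "b \<in> ?g ` (I \<times> UNIV)" using 1 by (simp only:)
      qed
    qed
  qed
  have inj: "inj_on ?g (I \<times> UNIV)"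
  proof (rule inj_onI, clarify)
    fix k j k' j' assume k: "k \<in> I" "k' \<in> I" and eq: "axis (?e' k) (axis j 1) = (axis (?e' k') (axis j' 1) :: real^'m^'k)"
    then have "?e' k = ?e' k' \<and> j = j'" by (auto simp: axis_eq_axis axis_eq_0_iff)
    then show "k = k' \<and> j = j'" using inv(2)[OF k(1)] inv(2)[OF k(2)] by metis
  qed
  have m: "(\<lambda>w. \<chi> i j. w (e i, j)) \<in> borel_measurable (LP (I \<times> UNIV))"
    by (intro measurable_matrix LP_component') (auto simp: eI)
  have b: "(\<lambda>f. \<Sum>b\<in>Basis. f b *\<^sub>R b) \<in> borel_measurable (LP (Basis :: (real^'m^'k) set))"
    by (intro borel_measurable_sum borel_measurable_scaleR LP_component' borel_measurable_const)
  have mat: "(\<chi> i j. x (axis i (axis j 1))) = (\<Sum>b\<in>Basis. x b *\<^sub>R b)" for x :: "real^'m^'k \<Rightarrow> real"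
  proof (rule euclidean_eqI)
    fix b :: "real^'m^'k" assume "b \<in> Basis"
    then obtain i j where "b = axis i (axis j 1)" using Basis by blast
    then show "(\<chi> i j. x (axis i (axis j 1))) \<bullet> b = (\<Sum>b\<in>Basis. x b *\<^sub>R b) \<bullet> b"
      unfolding inner_sum_left_Basis[OF \<open>b \<in> Basis\<close>] by (simp add: inner_axis)
  qed
  have "(\<integral>\<^sup>+w. F (\<chi> i j. w (e i, j)) \<partial>LP (I \<times> UNIV)) =
    (\<integral>\<^sup>+x. F (\<chi> i j. (\<lambda>z\<in>I \<times> UNIV. x (?g z)) (e i, j)) \<partial>LP (?g ` (I \<times> UNIV)))"
    by (rule LP_reindex[OF _ inj measurable_compose[OF m F]]) (use I in simp)
  also have "\<dots> = (\<integral>\<^sup>+x. F (\<Sum>b\<in>Basis. x b *\<^sub>R b) \<partial>LP Basis)"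
    unfolding im mat[symmetric] by (simp add: eI inv)
  also have "\<dots> = (\<integral>\<^sup>+\<omega>. F \<omega> \<partial>distr (LP Basis) borel (\<lambda>f. \<Sum>b\<in>Basis. f b *\<^sub>R b))"
    by (rule nn_integral_distr[symmetric, OF b]) (use F in simp)
  finally show ?thesis unfolding lborel_eq[symmetric] by simp
qed

text \<open>Replaces the row type by the rows below \<open>CARD('k)\<close> in the natural numbers,
  so that further rows can be adjoined.\<close>

lemma integral_lborel_gram:
  fixes f :: "real^'m^'m \<Rightarrow> complex" and s :: "real^'m^'m"
  assumes f: "f \<in> borel_measurable borel"
  shows "(LINT \<omega>|(lborel :: (real^'m^'k::finite) measure). f (s + transpose \<omega> ** \<omega>)) =
    (\<integral>w. f (s + gram {..<CARD('k)} UNIV w) \<partial>LP ({..<CARD('k)} \<times> UNIV))"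
proof -
  let ?I = "{..<CARD('k)}"
  obtain e :: "'k \<Rightarrow> nat" where e: "bij_betw e UNIV ?I"
    using finite_same_card_bij[of "UNIV :: 'k set" ?I] by auto
  then have eI: "e i \<in> ?I" for i by (auto simp: bij_betw_def)
  have m: "(\<lambda>w. \<chi> i j. w (e i, j)) \<in> borel_measurable (LP (?I \<times> UNIV))"
    using eI by (intro measurable_matrix LP_component') auto
  have id: "(\<lambda>\<omega>. \<omega>) \<in> lborel \<rightarrow>\<^sub>M borel" by simp
  have "distr (lborel :: (real^'m^'k) measure) borel (\<lambda>\<omega>. \<omega>) = distr (LP (?I \<times> UNIV)) borel (\<lambda>w. \<chi> i j. w (e i, j) :: real^'m^'k)"
    by (rule distr_eqI_nn_integral[OF id m nn_integral_lborel_matrix[OF e]])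
  moreover have "distr lborel borel (\<lambda>\<omega>. \<omega>) = (lborel :: (real^'m^'k) measure)"
    by (rule distr_id2) simp
  ultimately have l: "(lborel :: (real^'m^'k) measure) = distr (LP (?I \<times> UNIV)) borel (\<lambda>w. \<chi> i j. w (e i, j))"
    by simp
  have c: "continuous_on UNIV (\<lambda>\<omega> :: real^'m^'k. s + transpose \<omega> ** \<omega>)"
    unfolding matrix_matrix_mult_def transpose_def by (intro continuous_intros continuous_on_vec_lambda) 
  have mf: "(\<lambda>\<omega> :: real^'m^'k. f (s + transpose \<omega> ** \<omega>)) \<in> borel_measurable borel"
    by (rule measurable_compose[OF borel_measurable_continuous_onI[OF c] f])
  have g: "transpose (\<chi> i j. w (e i, j)) ** (\<chi> i j. w (e i, j) :: real^'m^'k) = gram ?I UNIV w" for w :: "nat \<times> 'm \<Rightarrow> real"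
  proof -
    have "(\<Sum>i\<in>UNIV. w (e i, j) * w (e i, l)) = (\<Sum>k\<in>?I. w (k, j) * w (k, l))" for j l
      by (rule sum.reindex_bij_betw[OF e, of "\<lambda>k. w (k, j) * w (k, l)"])
    then show ?thesis by (simp add: matrix_matrix_mult_def transpose_def gram_def vec_eq_iff)
  qed
  show ?thesis
    unfolding l by (subst integral_distr[OF m mf]) (simp add: g)
qed

section \<open>The density case, with at least as many rows as columns\<close>

lemma sym_pad_UNIV: "sym_pad UNIV = (sym_matrix :: _ \<Rightarrow> real^'m::{finite,wellorder}^'m::_)"
  by (simp add: fun_eq_iff sym_pad_def sym_matrix_def pad_def vec_eq_iff)

lemma upr_UNIV: "upr UNIV = upper_pairs"
  by (simp add: upr_def upper_pairs_def)

lemma sym_lborel_translate: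
  fixes s :: "real^'m::{finite,wellorder}^'m::_"
  assumes s: "s \<in> symm"
  shows "distr sym_lborel borel (\<lambda>r. r + s) = sym_lborel"
proof -
  let ?b = "\<lambda>(i, j). s $ i $ j"
  have t: "(\<lambda>r. r + s) \<in> borel \<rightarrow>\<^sub>M borel" by measurable
  have "distr (LP upper_pairs) borel (\<lambda>x. sym_matrix x + s) = distr (LP upper_pairs) borel sym_matrix"
  proof (rule distr_eqI_nn_integral)
    fix F :: "real^'m::_^'m::_ \<Rightarrow> ennreal" assume F: "F \<in> borel_measurable borel"
    have "(\<integral>\<^sup>+x. F (sym_matrix x) \<partial>LP upper_pairs) = (\<integral>\<^sup>+x. F (sym_matrix (\<lambda>i\<in>upper_pairs. 1 * x i + ?b i)) \<partial>LP upper_pairs)"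
      using LP_affine[OF _ zero_less_one measurable_compose[OF measurable_sym_matrix F], of ?b] by simp
    moreover have "sym_matrix (\<lambda>i\<in>upper_pairs. 1 * x i + ?b i) = sym_matrix x + s" for x
    proof -
      have "(min i j, max i j) \<in> upper_pairs" for i j :: 'm
        by (simp add: upper_pairs_def min_le_iff_disj le_max_iff_disj)
      moreover have "s $ min i j $ max i j = s $ i $ j" for i j
        using s by (auto simp: min_def max_def transpose_eq_iff)
      ultimately show ?thesis by (simp add: sym_matrix_def vec_eq_iff)
    qed
    ultimately show "(\<integral>\<^sup>+x. F (sym_matrix x + s) \<partial>LP upper_pairs) = (\<integral>\<^sup>+x. F (sym_matrix x) \<partial>LP upper_pairs)"
      by simp
  qed (intro measurable_compose[OF measurable_sym_matrix t] measurable_sym_matrix)+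
  then show ?thesis
    unfolding sym_lborel_def by (subst distr_distr[OF t measurable_sym_matrix]) (simp add: o_def)
qed

lemma gram_const_pos: "n \<le> k \<Longrightarrow> gram_const k n > 0"
  unfolding gram_const_def by (intro prod_pos divide_pos_pos Gamma_real_pos) auto

text \<open>The Gamma factors cancel. The exponents of \<open>pi\<close> are (k - j) / 2 summed over
  j < n, together with n (n - 1) / 4 from \<open>Gamma_m\<close>, and add up to k n / 2.\<close>

lemma gram_const_eq:
  assumes "n \<le> k"
  shows "of_real (gram_const k n) * Gamma_m n (of_nat k / 2) = of_real (pi powr (real k * real n / 2))"
proof -
  have "(\<Prod>j<n. pi powr ((real k - real j) / 2)) * pi powr (real n * (real n - 1) / 4) = pi powr (real k * real n / 2)" for n
  proof (induction n)
    case (Suc n)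
    have "(\<Prod>j<Suc n. pi powr ((real k - real j) / 2)) * pi powr (real (Suc n) * (real (Suc n) - 1) / 4) =
      ((\<Prod>j<n. pi powr ((real k - real j) / 2)) * pi powr (real n * (real n - 1) / 4)) * (pi powr ((real k - real n) / 2) * pi powr (real n / 2))"
    proof -
      have "real (Suc n) * (real (Suc n) - 1) / 4 = real n * (real n - 1) / 4 + real n / 2" by (simp add: field_simps)
      then show ?thesis by (simp only: powr_add prod.lessThan_Suc ac_simps)
    qed
    also have "\<dots> = pi powr (real k * real n / 2) * pi powr (real k / 2)"
      unfolding Suc.IH by (simp add: powr_add[symmetric] field_simps)
    also have "\<dots> = pi powr (real k * real (Suc n) / 2)"
      by (simp add: powr_add[symmetric] field_simps)
    finally show ?case .
  qed simp
  note p = this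
  have G: "Gamma (of_nat k / 2 - of_nat j / 2 :: complex) = of_real (Gamma ((real k - real j) / 2))" for j
    by (simp add: Gamma_complex_of_real[symmetric] diff_divide_distrib)
  have "(\<Prod>j<n. Gamma ((real k - real j) / 2)) > 0"
    using assms by (intro prod_pos Gamma_real_pos) auto
  moreover have "x / y * (c * y) = x * c" if "y > 0" for x y c :: real using that by simp
  ultimately have "gram_const k n * (pi powr (real n * (real n - 1) / 4) * (\<Prod>j<n. Gamma ((real k - real j) / 2))) = pi powr (real k * real n / 2)"
    unfolding gram_const_def prod_dividef p[of n, symmetric] by blast
  then show ?thesis
    unfolding Gamma_m_def G of_real_prod[symmetric] of_real_mult[symmetric] by simp
qed

text \<open>By \<open>nn_integral_gram\<close> the Gram matrix has density \<open>?C * d\<close>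
  with respect to \<open>sym_lborel\<close>. Translation by the symmetric matrix \<open>s\<close>
  turns its integral into the one in \<open>GG_integral\<close>.\<close>

lemma GG_integral_eq:
  fixes f :: "real^'m::{finite,wellorder}^'m::_ \<Rightarrow> complex"
  assumes k: "CARD('m) \<le> k" and f: "f \<in> borel_measurable borel" and s: "s \<in> symm"
  shows "GG_integral (of_nat k / 2) f s = of_real (pi powr (- (real k * real CARD('m) / 2))) *
    (\<integral>w. f (s + gram {..<k} UNIV w) \<partial>LP ({..<k} \<times> UNIV))"
proof -
  let ?m = "CARD('m)"
  let ?\<beta> = "(real k - real ?m - 1) / 2"
  let ?C = "gram_const k ?m"
  define d where "d r = indicator pos_def_cone r * \<bar>det r\<bar> powr ?\<beta>" for r :: "real^'m::_^'m::_"
  have C: "?C > 0" by (rule gram_const_pos[OF k])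
  have md: "d \<in> borel_measurable borel"
  proof -
    have [measurable]: "(det :: real^'m::_^'m::_ \<Rightarrow> real) \<in> borel_measurable borel"
      unfolding det_def by (intro borel_measurable_continuous_onI continuous_intros)
    show ?thesis unfolding d_def[abs_def] by measurable
  qed
  have mCd: "(\<lambda>r. ennreal (?C * d r)) \<in> borel_measurable sym_lborel" using md by (simp add: sym_lborel_def)
  have mg: "gram {..<k} UNIV \<in> borel_measurable (LP ({..<k} \<times> (UNIV :: 'm set)))"
    by (rule measurable_gram) auto
  have idm: "(\<lambda>r. r) \<in> density sym_lborel (\<lambda>r. ennreal (?C * d r)) \<rightarrow>\<^sub>M borel" by (simp add: sym_lborel_def)
  have "distr (LP ({..<k} \<times> (UNIV :: 'm set))) borel (gram {..<k} UNIV) = distr (density sym_lborel (\<lambda>r. ennreal (?C * d r))) borel (\<lambda>r. r)"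
  proof (rule distr_eqI_nn_integral[OF mg idm])
    fix F :: "real^'m::_^'m::_ \<Rightarrow> ennreal" assume F: "F \<in> borel_measurable borel"
    have p0: "pad (UNIV :: 'm set) = 0" by (simp add: pad_def vec_eq_iff)
    have mdF: "(\<lambda>r. ennreal (d r) * F r) \<in> borel_measurable borel" using md F by measurable
    have "(\<integral>\<^sup>+w. F (gram {..<k} UNIV w) \<partial>LP ({..<k} \<times> (UNIV :: 'm set))) =
      ennreal ?C * (\<integral>\<^sup>+x. ennreal (d (sym_matrix x)) * F (sym_matrix x) \<partial>LP upper_pairs)"
      using nn_integral_gram[of "{..<k}" "UNIV :: 'm set" F] F k
      unfolding wishart_weight_def sym_pad_UNIV upr_UNIV p0 d_def by simp
    also have "\<dots> = ennreal ?C * (\<integral>\<^sup>+r. ennreal (d r) * F r \<partial>sym_lborel)"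
      unfolding sym_lborel_def by (subst nn_integral_distr[OF measurable_sym_matrix]) (use mdF in simp_all)
    also have "\<dots> = (\<integral>\<^sup>+r. ennreal ?C * (ennreal (d r) * F r) \<partial>sym_lborel)"
      using mdF by (intro nn_integral_cmult[symmetric]) (simp add: sym_lborel_def)
    also have "\<dots> = (\<integral>\<^sup>+r. ennreal (?C * d r) * F r \<partial>sym_lborel)"
      using C by (simp add: ennreal_mult' mult.assoc)
    also have "\<dots> = (\<integral>\<^sup>+r. F r \<partial>density sym_lborel (\<lambda>r. ennreal (?C * d r)))"
      by (rule nn_integral_density[symmetric, OF mCd]) (use F in \<open>simp add: sym_lborel_def\<close>)
    finally show "(\<integral>\<^sup>+w. F (gram {..<k} UNIV w) \<partial>LP ({..<k} \<times> (UNIV :: 'm set))) = (\<integral>\<^sup>+r. F r \<partial>density sym_lborel (\<lambda>r. ennreal (?C * d r)))" .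
  qed
  note law = this
  have mfs: "(\<lambda>r. f (s + r)) \<in> borel_measurable borel" using f by measurable
  have "(\<integral>w. f (s + gram {..<k} UNIV w) \<partial>LP ({..<k} \<times> (UNIV :: 'm set))) = (\<integral>r. f (s + r) \<partial>distr (LP ({..<k} \<times> (UNIV :: 'm set))) borel (gram {..<k} UNIV))"
    by (rule integral_distr[symmetric, OF mg mfs])
  also have "\<dots> = (\<integral>r. f (s + r) \<partial>density sym_lborel (\<lambda>r. ennreal (?C * d r)))"
    unfolding law by (rule integral_distr[OF idm mfs])
  also have "\<dots> = (\<integral>r. (?C * d r) *\<^sub>R f (s + r) \<partial>sym_lborel)"
  proof (rule integral_density)
    show "(\<lambda>r. f (s + r)) \<in> borel_measurable sym_lborel" using mfs by (simp add: sym_lborel_def)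
    show "(\<lambda>r. ?C * d r) \<in> borel_measurable sym_lborel" using md by (simp add: sym_lborel_def)
    show "AE r in sym_lborel. 0 \<le> ?C * d r" using C by (simp add: d_def)
  qed
  also have "\<dots> = of_real ?C * (\<integral>r. d r *\<^sub>R f (s + r) \<partial>sym_lborel)"
    by (simp add: scaleR_conv_of_real mult.assoc)
  finally have J: "(\<integral>w. f (s + gram {..<k} UNIV w) \<partial>LP ({..<k} \<times> (UNIV :: 'm set))) = of_real ?C * (\<integral>r. d r *\<^sub>R f (s + r) \<partial>sym_lborel)" .
  define H where "H r = d (r - s) *\<^sub>R f r" for r
  have mH: "H \<in> borel_measurable borel" unfolding H_def[abs_def] using md f by measurable
  \<comment> \<open>For alpha = k / 2 the exponent is real, so the complex power is the real
    one.\<close>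
  have exp: "of_real \<bar>det r\<bar> powr (of_nat k / 2 - of_real (dim_d ?m)) = (of_real (\<bar>det r\<bar> powr ?\<beta>) :: complex)" for r :: "real^'m::_^'m::_"
  proof -
    have "(of_nat k / 2 - of_real (dim_d ?m) :: complex) = of_real ?\<beta>"
      by (simp add: dim_d_def field_simps)
    then show ?thesis by (simp only: powr_of_real abs_ge_zero)
  qed
  have "indicator {r. r - s \<in> pos_def_cone} r *\<^sub>R (f r * of_real (\<bar>det (r - s)\<bar> powr ?\<beta>)) = H r" for r
    by (simp add: H_def d_def indicator_def scaleR_conv_of_real)
  then have "GG_integral (of_nat k / 2) f s = 1 / Gamma_m ?m (of_nat k / 2) * (\<integral>r. H r \<partial>sym_lborel)"
    unfolding GG_integral_def set_lebesgue_integral_def exp by simp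
  also have "(\<integral>r. H r \<partial>sym_lborel) = (\<integral>r. H (r + s) \<partial>sym_lborel)"
  proof -
    have "(\<lambda>r. r + s) \<in> sym_lborel \<rightarrow>\<^sub>M borel" by (simp add: sym_lborel_def)
    from integral_distr[OF this mH] show ?thesis unfolding sym_lborel_translate[OF s] .
  qed
  also have "\<dots> = (\<integral>r. d r *\<^sub>R f (s + r) \<partial>sym_lborel)" by (simp add: H_def add.commute)
  also have "\<dots> = (\<integral>w. f (s + gram {..<k} UNIV w) \<partial>LP ({..<k} \<times> (UNIV :: 'm set))) / of_real ?C"
    unfolding J using C by simp
  also have "1 / Gamma_m ?m (of_nat k / 2) * (X / of_real ?C) = of_real (pi powr (- (real k * real ?m / 2))) * X" for X
  proof -
    have "1 / Gamma_m ?m (of_nat k / 2) * (X / of_real ?C) = X / (of_real ?C * Gamma_m ?m (of_nat k / 2))" by simp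
    also have "\<dots> = X / of_real (pi powr (real k * real ?m / 2))" unfolding gram_const_eq[OF k] ..
    finally show ?thesis by (simp add: powr_minus field_simps)
  qed
  finally show ?thesis .
qed

text \<open>The Gram matrix is additive in disjoint sets of rows. Integrating over the last two rows
  first reduces the claim to \<open>integral_diff_op_det\<close> at the symmetric base point
  \<open>s + gram {..<k} UNIV x\<close>; the sign in \<open>D_minus\<close> cancels that of
  \<open>(- pi) ^ m\<close>.\<close>

lemma gram_integral_D_minus:
  fixes f :: "real^'m::{finite,wellorder}^'m::_ \<Rightarrow> complex" and k :: nat
  assumes f: "f \<in> test_functions" and s: "s \<in> symm"
  shows "(\<integral>w. D_minus f (s + gram {..<k + 2} UNIV w) \<partial>LP ({..<k + 2} \<times> UNIV)) =
    of_real pi ^ CARD('m) * (\<integral>w. f (s + gram {..<k} UNIV w) \<partial>LP ({..<k} \<times> UNIV))"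
proof -
  let ?U = "UNIV :: 'm set"
  let ?I = "{..<k} \<times> ?U" and ?J = "{k, k + 1} \<times> ?U"
  have un: "{..<k + 2} \<times> ?U = ?I \<union> ?J" "?I \<inter> ?J = {}" by auto
  have D: "D_minus f \<in> test_functions" by (rule D_minus_test_function[OF f])
  let ?g = "\<lambda>w. D_minus f (s + gram {..<k + 2} UNIV w)"
  have int: "integrable (LP (?I \<union> ?J)) ?g"
  proof -
    obtain B where B: "0 \<le> B" "\<And>r. norm (D_minus f r) \<le> B" using test_function_bounded[OF D] by metis
    obtain R where R: "0 \<le> R" "\<And>I S v k j. finite I \<Longrightarrow> D_minus f (s + gram I S v) \<noteq> 0 \<Longrightarrow> k \<in> I \<Longrightarrow> j \<in> S \<Longrightarrow> \<bar>v (k :: nat, j)\<bar> \<le> R"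
      by (rule test_function_gram_support[OF D, of s]) blast
    have "gram {..<k + 2} UNIV \<in> borel_measurable (LP ({..<k + 2} \<times> ?U))"
      by (rule measurable_gram) auto
    then have "(\<lambda>w. s + gram {..<k + 2} UNIV w) \<in> borel_measurable (LP ({..<k + 2} \<times> ?U))"
      by (intro borel_measurable_add borel_measurable_const)
    from measurable_compose[OF this test_function_measurable[OF D]]
    show ?thesis unfolding un(1)[symmetric]
      by (rule integrable_LP_bounded_support[where B = B and R = R, rotated]) (use B R(2)[of "{..<k + 2}"] in auto)
  qed
  have "(\<integral>w. ?g w \<partial>LP ({..<k + 2} \<times> ?U)) = (\<integral>x. \<integral>y. ?g (merge ?I ?J (x, y)) \<partial>LP ?J \<partial>LP ?I)"
    unfolding un(1) by (rule LP.product_integral_fold[OF un(2) _ _ int]) simp_all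
  also have "\<dots> = (\<integral>x. of_real pi ^ CARD('m) * f (s + gram {..<k} UNIV x) \<partial>LP ?I)"
  proof (intro Bochner_Integration.integral_cong refl)
    fix x :: "nat \<times> 'm \<Rightarrow> real"
    have "gram {..<k + 2} UNIV (merge ?I ?J (x, y)) = gram {..<k} UNIV x + gram {k, k + 1} UNIV y" for y
    proof -
      let ?m = "merge ?I ?J (x, y)"
      have set: "{..<k + 2} = {..<k} \<union> {k, k + 1}" "{..<k} \<inter> {k, k + 1} = {}" by auto
      have "(\<Sum>i<k. ?m (i, a) * ?m (i, b)) = (\<Sum>i<k. x (i, a) * x (i, b))" for a b
        by (intro sum.cong) (auto simp: merge_def)
      moreover have "(\<Sum>i\<in>{k, k + 1}. ?m (i, a) * ?m (i, b)) = (\<Sum>i\<in>{k, k + 1}. y (i, a) * y (i, b))" for a b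
        by (intro sum.cong) (auto simp: merge_def)
      ultimately have "(\<Sum>i\<in>{..<k + 2}. ?m (i, a) * ?m (i, b)) =
          (\<Sum>i<k. x (i, a) * x (i, b)) + (\<Sum>i\<in>{k, k + 1}. y (i, a) * y (i, b))" for a b
        unfolding set(1) by (subst sum.union_disjoint[OF _ _ set(2)]) simp_all
      then show ?thesis unfolding gram_def by (simp only: vec_eq_iff vec_lambda_beta vector_add_component UNIV_I simp_thms if_True)
    qed
    then have "(\<integral>y. ?g (merge ?I ?J (x, y)) \<partial>LP ?J) = (\<integral>y. D_minus f ((s + gram {..<k} UNIV x) + gram {k, k + 1} UNIV y) \<partial>LP ?J)"
      by (simp add: add.assoc)
    also have "\<dots> = (- 1) ^ CARD('m) * (\<integral>y. diff_op (det (op_mat UNIV)) f ((s + gram {..<k} UNIV x) + gram {k, k + 1} UNIV y) \<partial>LP ?J)"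
      unfolding D_minus_eq_diff_op[OF f] by (rule integral_mult_right_zero)
    also have "\<dots> = (- 1) ^ CARD('m) * ((- of_real pi) ^ CARD('m) * f (s + gram {..<k} UNIV x))"
      by (subst integral_diff_op_det[OF f symm_add[OF s gram_symm]]) simp_all
    also have "\<dots> = of_real pi ^ CARD('m) * f (s + gram {..<k} UNIV x)"
      by (simp add: mult.assoc[symmetric] power_mult_distrib[symmetric])
    finally show "(\<integral>y. ?g (merge ?I ?J (x, y)) \<partial>LP ?J) = of_real pi ^ CARD('m) * f (s + gram {..<k} UNIV x)" .
  qed
  also have "\<dots> = of_real pi ^ CARD('m) * (\<integral>w. f (s + gram {..<k} UNIV w) \<partial>LP ?I)"
    by (rule integral_mult_right_zero)
  finally show ?thesis .
qed

lemma D_minus_funpow_test_function: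
  fixes f :: "real^'m::{finite,wellorder}^'m::_ \<Rightarrow> complex"
  shows "f \<in> test_functions \<Longrightarrow> (D_minus ^^ l) f \<in> test_functions"
  by (induction l) (simp_all add: D_minus_test_function)

lemma gram_integral_D_minus_funpow:
  fixes f :: "real^'m::{finite,wellorder}^'m::_ \<Rightarrow> complex" and k :: nat
  assumes f: "f \<in> test_functions" and s: "s \<in> symm"
  shows "(\<integral>w. (D_minus ^^ l) f (s + gram {..<k + 2 * l} UNIV w) \<partial>LP ({..<k + 2 * l} \<times> UNIV)) =
    of_real pi ^ (CARD('m) * l) * (\<integral>w. f (s + gram {..<k} UNIV w) \<partial>LP ({..<k} \<times> UNIV))"
proof (induction l)
  case (Suc l)
  have e: "k + 2 * Suc l = k + 2 * l + 2" by simp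
  have "(\<integral>w. (D_minus ^^ Suc l) f (s + gram {..<k + 2 * Suc l} UNIV w) \<partial>LP ({..<k + 2 * Suc l} \<times> UNIV)) =
    (\<integral>w. D_minus ((D_minus ^^ l) f) (s + gram {..<k + 2 * l + 2} UNIV w) \<partial>LP ({..<k + 2 * l + 2} \<times> UNIV))"
    by (simp only: e funpow.simps o_apply)
  also have "\<dots> = of_real pi ^ CARD('m) * (of_real pi ^ (CARD('m) * l) * (\<integral>w. f (s + gram {..<k} UNIV w) \<partial>LP ({..<k} \<times> UNIV)))"
    unfolding gram_integral_D_minus[OF D_minus_funpow_test_function[OF f] s] Suc.IH ..
  finally show ?case by (simp only: power_add mult.assoc mult_Suc_right)
qed simp

theorem theorem2p13:
  fixes f :: "real^'m::{finite,wellorder}^'m::_ \<Rightarrow> complex"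
    and s :: "real^'m::_^'m::_"
  assumes "f \<in> test_functions"
    and "s \<in> closure pos_def_cone"
  shows "I_minus (of_nat CARD('k::finite) / 2) f s =
    of_real (pi powr (- (real CARD('k) * real CARD('m) / 2))) *
      (LINT \<omega>|(lborel :: (real^'m::_^'k::finite) measure). f (s + transpose \<omega> ** \<omega>))"
proof -
  let ?k = "CARD('k)" and ?m = "CARD('m)"
  let ?J = "\<integral>w. f (s + gram {..<?k} UNIV w) \<partial>LP ({..<?k} \<times> UNIV)"
  have s: "s \<in> symm"
    using closure_minimal[OF pos_def_cone_subset_symm closed_symmetric] assms(2) by blast
  have J: "(LINT \<omega>|(lborel :: (real^'m::_^'k::finite) measure). f (s + transpose \<omega> ** \<omega>)) = ?J"
    by (rule integral_lborel_gram[OF test_function_measurable[OF assms(1)]])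
  have "I_minus (of_nat ?k / 2) f s = of_real (pi powr (- (real ?k * real ?m / 2))) * ?J"
  proof (cases "?m \<le> ?k")
    case True
    \<comment> \<open>Since d - 1 = (m - 1) / 2, the unregularised range of alpha = k / 2 is exactly
      k \<ge> m.\<close>
    then have "Re (of_nat ?k / 2) > dim_d ?m - 1" by (simp add: dim_d_def field_simps)
    then show ?thesis
      unfolding I_minus_def using GG_integral_eq[OF True test_function_measurable[OF assms(1)] s] by simp
  next
    case False
    let ?P = "\<lambda>l::nat. l \<ge> 1 \<and> dim_d ?m - 1 - real l < Re (of_nat ?k / 2) \<and> Re (of_nat ?k / 2) \<le> dim_d ?m - real l"
    have nre: "\<not> Re (of_nat ?k / 2) > dim_d ?m - 1" using False by (simp add: dim_d_def field_simps)
    \<comment> \<open>Multiplied by 2, the bounds on alpha read k + 2 l \<le> m + 1 < k + 2 l + 2,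
      whose only solution is this rounded half. Here k < m, so the subtraction is exact and
      \<open>l \<ge> 1\<close>; moreover k + 2 l is m or m + 1.\<close>
    define l where "l = (?m + 1 - ?k) div 2"
    have l1: "2 * l \<le> ?m + 1 - ?k" "?m + 1 - ?k < 2 * l + 2" unfolding l_def by presburger+
    then have l2: "real ?k + 2 * real l \<le> real ?m + 1" "real ?m + 1 < real ?k + 2 * real l + 2" "l \<ge> 1"
      using False by linarith+
    have Pl: "?P l" using l2 by (simp add: dim_d_def field_simps)
    have "l' = l" if "?P l'" for l'
    proof -
      have "real ?k + 2 * real l' \<le> real ?m + 1" "real ?m + 1 < real ?k + 2 * real l' + 2"
        using that by (simp_all add: dim_d_def field_simps)
      then show ?thesis using l2 by linarith
    qed
    then have THE_l: "(THE l. ?P l) = l" using Pl by (intro the_equality) auto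
    have k': "?m \<le> ?k + 2 * l" using l2 by linarith
    have a: "of_nat ?k / 2 + of_nat l = (of_nat (?k + 2 * l) / 2 :: complex)" by (simp add: field_simps)
    have "I_minus (of_nat ?k / 2) f s = GG_integral (of_nat (?k + 2 * l) / 2) ((D_minus ^^ l) f) s"
      unfolding I_minus_def Let_def THE_l a using nre by simp
    also have "\<dots> = of_real (pi powr (- (real (?k + 2 * l) * real ?m / 2))) * (of_real pi ^ (?m * l) * ?J)"
      unfolding GG_integral_eq[OF k' test_function_measurable[OF D_minus_funpow_test_function[OF assms(1)]] s]
        gram_integral_D_minus_funpow[OF assms(1) s] ..
    also have "(of_real pi :: complex) ^ (?m * l) = of_real (pi powr real (?m * l))"
      unfolding powr_realpow[OF pi_gt_zero] by (rule of_real_power[symmetric])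
    also have "of_real (pi powr (- (real (?k + 2 * l) * real ?m / 2))) * (of_real (pi powr real (?m * l)) * ?J) =
        of_real (pi powr (- (real (?k + 2 * l) * real ?m / 2)) * pi powr real (?m * l)) * ?J"
      by (simp only: of_real_mult mult.assoc)
    \<comment> \<open>The \<open>2 * l\<close> additional rows cost \<open>pi powr (- l m)\<close>,
      which the \<open>l\<close> applications of \<open>D_minus\<close> give back.\<close>
    also have "pi powr (- (real (?k + 2 * l) * real ?m / 2)) * pi powr real (?m * l) = pi powr (- (real ?k * real ?m / 2))"
      unfolding powr_add[symmetric] by (simp add: field_simps)
    finally show ?thesis .
  qed
  then show ?thesis unfolding J .
qed

end
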